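(* Let $C > 0$ be a real constant and let $\alpha = A/B \in \mathbb{Q} \setminus \{0\}$ with $\gcd(A, B) = 1$. Let $y(t)$ be the solution of the initial value problem $$\dot{y} = C(1 - y^\alpha), \qquad y(0) = 0.$$ Then $y(t)$ is expressible in terms of elementary functions and the Lambert $W$ function if and only if $\alpha \in \left\{ -1, \tfrac{1}{2}, 1, 2 \right\}$. The two non-elementary solutions are $$\alpha = -1: \quad y(t) = 1 + W_0\left( -\frac{1}{\mathrm{e}} \exp(Ct) \right),$$ $$\alpha = \tfrac{1}{2}: \quad y(t) = \left( 1 + W_0\left( -\frac{1}{\mathrm{e}} \exp\left(-\tfrac{1}{2}Ct\right) \right) \right)^2.$$
   Context: The solution $y(t)$ is the one determined by separation of variables, i.e. by the implicit relation $F_\alpha(y) = Ct$ with $F_\alpha(y) = \int_0^y \frac{\mathrm{d}s}{1 - s^\alpha}$ for $y \in [0,1)$; for $\alpha = -\beta < 0$ one has $F_{-\beta}(y) = y - F_\beta(y)$. The paper restricts its analysis to the domain $y \in [0,1)$, $t \ge 0$. The Lambert $W$ function is the inverse of $w \mapsto w \exp(w)$, and $W_0$ denotes its principal branch. A function of $t$ is elementary if it is obtained from constants and $t$ by finitely many algebraic operations (including algebraic functions), exponentials and logarithms. "Expressible in terms of elementary functions and the Lambert $W$ function" means obtained by finitely many such operations together with applications of the Lambert $W$ function.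
   Formalization: For α < 0 the solution is taken on t ≤ 0 instead of t ≥ 0, with the equation not imposed at t = 0, because for C > 0 the relation F_α(y) = Ct has no solution y in [0,1) when t > 0. *)

theory Defs
  imports "HOL-Analysis.Analysis"
begin

text \<open>
  Separation of variables for \<open>y' = C (1 - y\<^sup>\<alpha>)\<close>, \<open>y(0) = 0\<close>. The integral is the intended one
  for negative \<open>\<alpha>\<close> as well: the value \<open>0 powr \<alpha> = 0\<close> only affects the single point \<open>s = 0\<close>, and
  \<open>1 / (1 - s powr (-\<beta>)) = 1 - 1 / (1 - s powr \<beta>)\<close> for \<open>0 < s < 1\<close>.
\<close>

definition sep_integral :: "real \<Rightarrow> real \<Rightarrow> real" where
  "sep_integral \<alpha> y = integral {0..y} (\<lambda>s. 1 / (1 - s powr \<alpha>))"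

text \<open>
  On \<open>[0,1)\<close> the function \<open>sep_integral \<alpha>\<close> takes all values in \<open>[0,\<infinity>)\<close> if \<open>\<alpha> > 0\<close>, and all values
  in \<open>(-\<infinity>,0]\<close> if \<open>\<alpha> < 0\<close>. So for \<open>C > 0\<close> the solution with values in \<open>[0,1)\<close> lives on
  \<open>t \<ge> 0\<close> if \<open>\<alpha> > 0\<close>, but on \<open>t \<le> 0\<close> if \<open>\<alpha> < 0\<close>.
\<close>

definition sol_domain :: "real \<Rightarrow> real set" where
  "sol_domain \<alpha> = (if \<alpha> > 0 then {0..} else {..0})"

text \<open>
  For \<open>\<alpha> < 0\<close> the right-hand side of the differential equation is singular at \<open>y = 0\<close>, so the
  equation is not imposed at \<open>t = 0\<close> in that case.
\<close>

definition ivp_solution :: "real \<Rightarrow> real \<Rightarrow> (real \<Rightarrow> real) \<Rightarrow> bool" where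
  "ivp_solution C \<alpha> y \<longleftrightarrow>
     y 0 = 0 \<and>
     (\<forall>t\<in>sol_domain \<alpha>. 0 < \<alpha> \<or> t \<noteq> 0 \<longrightarrow>
        (y has_real_derivative C * (1 - y t powr \<alpha>)) (at t within sol_domain \<alpha>)) \<and>
     (\<forall>t\<in>sol_domain \<alpha>. y t \<in> {0..<1} \<and> sep_integral \<alpha> (y t) = C * t)"

text \<open>The real principal branch of the Lambert W function, meaningful on \<open>[-1/e, \<infinity>)\<close>.\<close>

definition lambert_W0 :: "real \<Rightarrow> real" where
  "lambert_W0 = inv_into {-1..} (\<lambda>w. w * exp w)"

text \<open>
  \<open>closed_form w J f\<close>: on the interval \<open>J\<close>, the complex-valued function \<open>f\<close> is built from constants
  and the variable by finitely many algebraic operations, exponentials and logarithms and, if \<open>w\<close>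
  holds, applications of Lambert W. Complex values are allowed, and algebraic functions, logarithms
  and Lambert W may be taken on any branch that is continuous along \<open>J\<close>; such a branch is described
  by the equation that it solves. Differences, quotients and radicals are instances of
  \<open>algebraic\<close>, and only the values of \<open>f\<close> on \<open>J\<close> matter.
\<close>

inductive closed_form :: "bool \<Rightarrow> real set \<Rightarrow> (real \<Rightarrow> complex) \<Rightarrow> bool"
  for w :: bool and J :: "real set" where
  const: "closed_form w J (\<lambda>t. c)"
| var: "closed_form w J (\<lambda>t. complex_of_real t)"
| add: "closed_form w J f \<Longrightarrow> closed_form w J g \<Longrightarrow> closed_form w J (\<lambda>t. f t + g t)"
| mult: "closed_form w J f \<Longrightarrow> closed_form w J g \<Longrightarrow> closed_form w J (\<lambda>t. f t * g t)"
| algebraic: "(\<And>i. i \<le> n \<Longrightarrow> closed_form w J (a i)) \<Longrightarrow> (\<forall>t\<in>J. \<exists>i\<le>n. a i t \<noteq> 0) \<Longrightarrow>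
    continuous_on J f \<Longrightarrow> (\<forall>t\<in>J. (\<Sum>i\<le>n. a i t * f t ^ i) = 0) \<Longrightarrow> closed_form w J f"
| exp: "closed_form w J f \<Longrightarrow> closed_form w J (\<lambda>t. exp (f t))"
| log: "closed_form w J g \<Longrightarrow> continuous_on J f \<Longrightarrow> (\<forall>t\<in>J. exp (f t) = g t) \<Longrightarrow>
    closed_form w J f"
| lambert: "w \<Longrightarrow> closed_form w J g \<Longrightarrow> continuous_on J f \<Longrightarrow>
    (\<forall>t\<in>J. f t * exp (f t) = g t) \<Longrightarrow> closed_form w J f"

definition elementary_on :: "real set \<Rightarrow> (real \<Rightarrow> real) \<Rightarrow> bool" where
  "elementary_on J y \<longleftrightarrow> closed_form False J (\<lambda>t. complex_of_real (y t))"

definition elementary_lambert_on :: "real set \<Rightarrow> (real \<Rightarrow> real) \<Rightarrow> bool" where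
  "elementary_lambert_on J y \<longleftrightarrow> closed_form True J (\<lambda>t. complex_of_real (y t))"

end

(*
  Suppose that u is built from constants and t by algebraic operations, exponentials, logarithms and
  Lambert W. At a generic point the Taylor series of u lies in a tower of differential subfields
  of C((X)), each algebraic over a simple extension k(\<theta>) of the previous field k with
  (l \<theta> + m) \<theta>' = g \<theta>, where g \<in> k and (l, m) is (1, 0) for a logarithm, (0, 1) for an
  exponential and (1, 1) for Lambert W. Put y = u^B. Then the equation for y becomes
  u^e u' = \<kappa> (u^a - 1) with a = |A|.

  Take the step at which u becomes algebraic over k(\<theta>). Then k(u, \<theta>) has transcendence
  degree 1 over k, and the differential forms u^e du / (\<kappa> (u^a - 1)) and l d\<theta> + m d\<theta>/\<theta> are
  proportional with a constant factor, because both are invariant under the derivation (an argument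
  of Rosenlicht). Taking traces to k(u) and comparing residues at the a-th roots of unity \<rho> shows that
  the numbers \<rho>^(e+1) are rational, hence a \<le> 2. If l = 0, comparing degrees gives e < a. If
  l = m = 1, an element with an algebraic exponential is constant, which makes \<theta> an affine
  function of a polynomial in u; this is possible only for a = e = 1.
*)
theory Submission
  imports Defs "HOL-Computational_Algebra.Formal_Laurent_Series"
    "HOL-Computational_Algebra.Polynomial_FPS"
begin

section \<open>Subfields, simple extensions and algebraic closure\<close>

text \<open>The height of the tower is not bounded in advance, so all fields are subsets of one
  type. Closed forms come with branches that are merely continuous; they turn out smooth on an open
  dense set, and at a point of it formal Taylor series map them into a field without any question of
  convergence. \<theta> is algebraic but in general not rational over \<open>k(u)\<close>, so
  residues at points of the \<open>u\<close>-line make sense only after a trace. It is read off the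
  minimal polynomial: up to sign, the norm \<open>N\<close> and the trace \<open>T\<close> of
  \<theta> are two of its coefficients, and the form becomes \<open>l dT + m dN/N\<close>. A
  logarithm step cannot introduce \<open>u\<close>: the exact form \<open>dT\<close> has no
  residues, whereas the form of \<open>u\<close> has a nonzero one at 1. An exponential step leaves
  \<open>dN/N\<close>, whose behaviour at infinity bounds \<open>e\<close>. In a Lambert step
  \<open>dT\<close> may have any degree, so degrees decide nothing. There the form of
  \<open>u\<close> is integrated explicitly, as a polynomial plus a multiple of the logarithm of a
  rational function; \<theta> minus a multiple of that polynomial then has an algebraic exponential
  up to scaling, and this forces it to be constant.\<close>

definition subfield :: "'a::field set \<Rightarrow> bool" where
  "subfield F \<longleftrightarrow> 1 \<in> F \<and> (\<forall>x\<in>F. \<forall>y\<in>F. x - y \<in> F \<and> x * y \<in> F) \<and> (\<forall>x\<in>F. inverse x \<in> F)"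

definition polys :: "'a::zero set \<Rightarrow> 'a poly set" where
  "polys F = {p. \<forall>i. coeff p i \<in> F}"

definition adj :: "'a::field set \<Rightarrow> 'a \<Rightarrow> 'a set" where
  "adj F x = {poly p x / poly q x | p q. p \<in> polys F \<and> q \<in> polys F \<and> poly q x \<noteq> 0}"

text \<open>Algebraic closure relative to the ambient type. With \<open>alg k = k\<close>, every
  element outside \<open>k\<close> is transcendental over \<open>k\<close>; the later locales
  express transcendence in this way.\<close>

definition alg :: "'a::field set \<Rightarrow> 'a set" where
  "alg F = {x. \<exists>p\<in>polys F. p \<noteq> 0 \<and> poly p x = 0}"

lemma subfield_minus_mult:
  assumes "subfield F" "x \<in> F" "y \<in> F"
  shows "x - y \<in> F" "x * y \<in> F"
  using assms by (auto simp: subfield_def)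

lemma subfield_0_1: assumes "subfield F" shows "0 \<in> F" "1 \<in> F"
proof -
  show "1 \<in> F" using assms by (auto simp: subfield_def)
  then show "0 \<in> F" using subfield_minus_mult(1)[OF assms, of 1 1] by simp
qed

lemma subfield_uminus: "subfield F \<Longrightarrow> x \<in> F \<Longrightarrow> - x \<in> F"
  using subfield_minus_mult(1)[of F 0 x] subfield_0_1(1)[of F] by simp

lemma subfield_add: "subfield F \<Longrightarrow> x \<in> F \<Longrightarrow> y \<in> F \<Longrightarrow> x + y \<in> F"
  using subfield_minus_mult(1)[of F x "- y"] subfield_uminus[of F y] by simp

lemma subfield_inverse: "subfield F \<Longrightarrow> x \<in> F \<Longrightarrow> inverse x \<in> F"
  by (auto simp: subfield_def)

lemma subfield_divide: "subfield F \<Longrightarrow> x \<in> F \<Longrightarrow> y \<in> F \<Longrightarrow> x / y \<in> F"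
  by (simp add: divide_inverse subfield_inverse subfield_minus_mult)

lemma subfield_power: "subfield F \<Longrightarrow> x \<in> F \<Longrightarrow> x ^ n \<in> F"
  by (induction n) (auto simp: subfield_0_1 subfield_minus_mult)

lemma subfield_sum: "subfield F \<Longrightarrow> (\<And>i. i \<in> I \<Longrightarrow> f i \<in> F) \<Longrightarrow> sum f I \<in> F"
  by (induction I rule: infinite_finite_induct) (auto simp: subfield_0_1 subfield_add)

lemma subfield_of_nat: "subfield F \<Longrightarrow> of_nat n \<in> F"
  by (induction n) (auto simp: subfield_0_1 subfield_add)

lemma subfield_of_int: "subfield F \<Longrightarrow> of_int n \<in> F"
  by (cases n) (auto simp: subfield_of_nat subfield_uminus subfield_0_1 subfield_add
      simp del: of_nat_Suc)

lemmas subfield_closed = subfield_0_1 subfield_minus_mult subfield_uminus subfield_add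
  subfield_divide subfield_inverse subfield_power subfield_sum subfield_of_nat subfield_of_int

lemma polys_pCons [simp]: "pCons a p \<in> polys F \<longleftrightarrow> a \<in> F \<and> p \<in> polys F"
proof
  assume *: "pCons a p \<in> polys F"
  show "a \<in> F \<and> p \<in> polys F"
  proof -
    have "coeff (pCons a p) 0 \<in> F" "coeff (pCons a p) (Suc i) \<in> F" for i
      using * unfolding polys_def by blast+
    then show ?thesis by (simp add: polys_def)
  qed
next
  assume "a \<in> F \<and> p \<in> polys F"
  then show "pCons a p \<in> polys F" by (auto simp: polys_def coeff_pCons split: nat.split)
qed

lemma polys_0: "subfield F \<Longrightarrow> 0 \<in> polys F"
  by (simp add: polys_def subfield_closed)

lemma polys_1: "subfield F \<Longrightarrow> 1 \<in> polys F"
  by (simp add: polys_def subfield_closed)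

lemma polys_const: "subfield F \<Longrightarrow> a \<in> F \<Longrightarrow> [:a:] \<in> polys F"
  by (simp add: polys_0)

lemma polys_add: "subfield F \<Longrightarrow> p \<in> polys F \<Longrightarrow> q \<in> polys F \<Longrightarrow> p + q \<in> polys F"
  by (simp add: polys_def subfield_closed)

lemma polys_diff: "subfield F \<Longrightarrow> p \<in> polys F \<Longrightarrow> q \<in> polys F \<Longrightarrow> p - q \<in> polys F"
  by (simp add: polys_def subfield_closed)

lemma polys_uminus: "subfield F \<Longrightarrow> p \<in> polys F \<Longrightarrow> - p \<in> polys F"
  by (simp add: polys_def subfield_closed)

lemma polys_mult: "subfield F \<Longrightarrow> p \<in> polys F \<Longrightarrow> q \<in> polys F \<Longrightarrow> p * q \<in> polys F"
  by (auto simp: polys_def coeff_mult subfield_closed)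

lemma polys_smult: "subfield F \<Longrightarrow> a \<in> F \<Longrightarrow> q \<in> polys F \<Longrightarrow> smult a q \<in> polys F"
  by (auto simp: polys_def subfield_closed)

lemma polys_power: "subfield F \<Longrightarrow> p \<in> polys F \<Longrightarrow> p ^ n \<in> polys F"
  by (induction n) (auto simp: polys_1 polys_mult)

lemma polys_sum: "subfield F \<Longrightarrow> (\<And>i. i \<in> I \<Longrightarrow> f i \<in> polys F) \<Longrightarrow> sum f I \<in> polys F"
  by (induction I rule: infinite_finite_induct) (auto simp: polys_0 polys_add)

lemma polys_monom: "subfield F \<Longrightarrow> a \<in> F \<Longrightarrow> monom a n \<in> polys F"
  by (auto simp: polys_def subfield_closed)

lemma polys_pderiv: "subfield F \<Longrightarrow> p \<in> polys F \<Longrightarrow> pderiv p \<in> polys F"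
  using subfield_of_nat[of F] by (auto simp: polys_def coeff_pderiv subfield_closed simp del: of_nat_Suc)

lemmas polys_closed = polys_0 polys_1 polys_const polys_add polys_diff polys_uminus polys_mult
  polys_smult polys_power polys_sum polys_monom polys_pderiv

lemma polys_mono: "F \<subseteq> G \<Longrightarrow> polys F \<subseteq> polys G"
  by (auto simp: polys_def)

lemma poly_in: "subfield K \<Longrightarrow> p \<in> polys K \<Longrightarrow> x \<in> K \<Longrightarrow> poly p x \<in> K"
  by (induction p) (auto simp: subfield_closed)

lemma adjI: "p \<in> polys F \<Longrightarrow> q \<in> polys F \<Longrightarrow> poly q x \<noteq> 0 \<Longrightarrow> poly p x / poly q x \<in> adj F x"
  by (auto simp: adj_def)

lemma adj_poly: "subfield F \<Longrightarrow> p \<in> polys F \<Longrightarrow> poly p x \<in> adj F x"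
  using adjI[of p F 1 x] by (simp add: polys_closed)

lemma adj_superset: "subfield F \<Longrightarrow> F \<subseteq> adj F x"
  using adj_poly[of F "[:a:]" x for a] by (auto simp: polys_closed)

lemma adj_gen: "subfield F \<Longrightarrow> x \<in> adj F x"
  using adj_poly[of F "[:0,1:]" x] by (simp add: polys_closed subfield_closed)

lemma subfield_adj: assumes F: "subfield F" shows "subfield (adj F x)"
proof -
  have "r - s \<in> adj F x \<and> r * s \<in> adj F x" if "r \<in> adj F x" "s \<in> adj F x" for r s
  proof -
    from that obtain p q p' q' where *: "p \<in> polys F" "q \<in> polys F" "poly q x \<noteq> 0"
      "r = poly p x / poly q x" "p' \<in> polys F" "q' \<in> polys F" "poly q' x \<noteq> 0"
      "s = poly p' x / poly q' x"
      by (auto simp: adj_def)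
    have "r - s = poly (p * q' - p' * q) x / poly (q * q') x"
      "r * s = poly (p * p') x / poly (q * q') x"
      unfolding *(4,8) using *(3,7) by (simp_all add: field_simps)
    moreover have "poly (p * q' - p' * q) x / poly (q * q') x \<in> adj F x"
      "poly (p * p') x / poly (q * q') x \<in> adj F x"
      by (rule adjI; use * F in \<open>simp add: polys_closed\<close>)+
    ultimately show ?thesis by metis
  qed
  moreover have "inverse r \<in> adj F x" if "r \<in> adj F x" for r
  proof -
    from that obtain p q where *: "p \<in> polys F" "q \<in> polys F" "poly q x \<noteq> 0"
      "r = poly p x / poly q x" by (auto simp: adj_def)
    show ?thesis
    proof (cases "poly p x = 0")
      case True
      then show ?thesis using adj_superset[OF F, of x] subfield_0_1[OF F] * by auto
    next
      case False
      then show ?thesis using * adjI[of q F p x] by simp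
    qed
  qed
  moreover have "1 \<in> adj F x" using adj_superset[OF F] subfield_0_1[OF F] by blast
  ultimately show ?thesis unfolding subfield_def by blast
qed

lemma adj_minimal: "subfield K \<Longrightarrow> F \<subseteq> K \<Longrightarrow> x \<in> K \<Longrightarrow> adj F x \<subseteq> K"
  unfolding adj_def using poly_in[of K] polys_mono[of F K] by (auto intro!: subfield_closed)

lemma alg_mono: "F \<subseteq> G \<Longrightarrow> alg F \<subseteq> alg G"
  using polys_mono[of F G] by (auto simp: alg_def)

lemma alg_superset: assumes "subfield F" shows "F \<subseteq> alg F"
proof
  fix a assume "a \<in> F"
  then show "a \<in> alg F" using assms
    by (auto simp: alg_def polys_closed subfield_closed intro!: bexI[of _ "[:-a, 1:]"])
qed

text \<open>Horner style: the quotient for \<open>pCons a p\<close> is the shifted quotient for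
  \<open>p\<close> plus one constant, so all coefficients visibly stay in \<open>F\<close>.\<close>

lemma poly_division:
  assumes F: "subfield F" and P: "P \<in> polys F" "lead_coeff P = 1"
  shows "p \<in> polys F \<Longrightarrow> \<exists>q r. q \<in> polys F \<and> r \<in> polys F \<and> p = q * P + r \<and>
    (degree r < degree P \<or> r = 0)"
proof (induction p)
  case 0
  then show ?case using polys_0[OF F] by (intro exI[of _ 0]) auto
next
  case (pCons a p)
  then obtain q r where *: "q \<in> polys F" "r \<in> polys F" "p = q * P + r"
    "degree r < degree P \<or> r = 0" and a: "a \<in> F" by auto
  define s where "s = pCons a r"
  define c where "c = coeff s (degree P)"
  have s: "s \<in> polys F" "degree s \<le> degree P"
    using * a by (auto simp: s_def degree_pCons_eq_if)
  have c: "c \<in> F" using s by (auto simp: c_def polys_def)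
  have eq: "pCons a p = (pCons 0 q + [:c:]) * P + (s - smult c P)"
    using * by (simp add: s_def algebra_simps)
  have "degree (s - smult c P) \<le> degree P"
    using s by (intro degree_diff_le) (auto simp: degree_smult_le)
  moreover have "coeff (s - smult c P) (degree P) = 0"
    using P by (simp add: c_def)
  ultimately have "degree (s - smult c P) < degree P \<or> s - smult c P = 0"
    by (metis eq_zero_or_degree_less)
  moreover have "pCons 0 q + [:c:] \<in> polys F" "s - smult c P \<in> polys F"
    using F * c s P by (auto intro!: polys_closed simp: subfield_closed)
  ultimately show ?case using eq by blast
qed

text \<open>Minimality of the degree stands in for irreducibility: it is the form in which traces
  and extensions of derivations use the minimal polynomial.\<close>

lemma minpoly_exists:
  assumes F: "subfield F" and x: "x \<in> alg F"
  obtains P where "P \<in> polys F" "lead_coeff P = 1" "poly P x = 0" "degree P \<ge> 1"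
    "\<And>q. q \<in> polys F \<Longrightarrow> poly q x = 0 \<Longrightarrow> degree q < degree P \<Longrightarrow> q = 0"
proof -
  define M where "M = (\<lambda>p. p \<in> polys F \<and> p \<noteq> 0 \<and> poly p x = 0)"
  obtain p where p: "M p" "\<And>q. M q \<Longrightarrow> degree p \<le> degree q"
    using x ex_has_least_nat[of M _ degree] unfolding M_def alg_def by blast
  define P where "P = smult (inverse (lead_coeff p)) p"
  have "lead_coeff p \<in> F" using p by (auto simp: M_def polys_def)
  then have P: "P \<in> polys F" "lead_coeff P = 1" "poly P x = 0" "degree P = degree p"
    using p F by (auto simp: M_def P_def intro!: polys_closed subfield_closed)
  have "degree P \<ge> 1"
  proof (rule ccontr)
    assume "\<not> ?thesis"
    then obtain a where "P = [:a:]" by (metis degree_eq_zeroE less_one not_le)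
    with P show False by simp
  qed
  moreover have "q = 0" if "q \<in> polys F" "poly q x = 0" "degree q < degree P" for q
    using p(2)[of q] that P by (auto simp: M_def)
  ultimately show ?thesis using that P by metis
qed

text \<open>Closure of algebraic elements under the field operations is proved by counting dimensions:
  the powers of an element of a ring that is finitely spanned over \<open>F\<close> are linearly dependent.\<close>

inductive_set lspan :: "'a::field set \<Rightarrow> 'a set \<Rightarrow> 'a set" for F S where
  zero: "0 \<in> lspan F S"
| add: "c \<in> F \<Longrightarrow> s \<in> S \<Longrightarrow> v \<in> lspan F S \<Longrightarrow> c * s + v \<in> lspan F S"

lemma lspan_add: assumes "x \<in> lspan F S" "y \<in> lspan F S" shows "x + y \<in> lspan F S"
  using assms by induction (auto simp: add.assoc intro: lspan.intros)

lemma lspan_sum: "(\<And>i. i \<in> I \<Longrightarrow> f i \<in> lspan F S) \<Longrightarrow> sum f I \<in> lspan F S"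
  by (induction I rule: infinite_finite_induct) (auto intro: lspan.zero lspan_add)

lemma lspan_scale: assumes "subfield F" "a \<in> F" "x \<in> lspan F S" shows "a * x \<in> lspan F S"
  using assms(3)
proof induction
  case (add c s v)
  have "a * (c * s + v) = (a * c) * s + a * v" by (simp add: algebra_simps)
  moreover have "a * c \<in> F" using add assms by (auto intro: subfield_closed)
  ultimately show ?case using add by (auto intro!: lspan.add)
qed (auto intro: lspan.zero)

lemma lspan_times:
  assumes "x \<in> lspan F S" shows "x * y \<in> lspan F ((\<lambda>s. s * y) ` S)"
  using assms
proof induction
  case (add c s v)
  have "(c * s + v) * y = c * (s * y) + v * y" by (simp add: algebra_simps)
  then show ?case using add by (auto intro!: lspan.add)
qed (auto intro: lspan.zero)

lemma lspan_mono: assumes "x \<in> lspan F S" "S \<subseteq> T" shows "x \<in> lspan F T"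
  using assms by induction (auto intro: lspan.intros)

lemma lspan_insert:
  assumes F: "subfield F" and "x \<in> lspan F (insert s S)"
  shows "\<exists>c\<in>F. x - c * s \<in> lspan F S"
  using assms(2)
proof induction
  case zero
  show ?case using F by (intro bexI[of _ 0]) (auto simp: lspan.zero subfield_closed)
next
  case (add c t v)
  then obtain d where d: "d \<in> F" "v - d * s \<in> lspan F S" by auto
  show ?case
  proof (cases "t = s")
    case True
    then have "c * t + v - (c + d) * s = v - d * s" by (simp add: algebra_simps)
    then have "c * t + v - (c + d) * s \<in> lspan F S" using d(2) by metis
    then show ?thesis using d add F by (intro bexI[of _ "c + d"]) (auto intro: subfield_closed)
  next
    case False
    then have "c * t + (v - d * s) \<in> lspan F S" using add d by (auto intro: lspan.add)
    then show ?thesis using d by (intro bexI[of _ d]) (auto simp: algebra_simps)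
  qed
qed

text \<open>Gaussian elimination by induction on \<open>S\<close>: a vector \<open>v j\<close> that
  involves \<open>s\<close> clears \<open>s\<close> from all the others, at the cost of one vector
  and one generator.\<close>

lemma lspan_dependent:
  assumes F: "subfield F" and "finite S"
  shows "finite I \<Longrightarrow> card I > card S \<Longrightarrow> \<forall>i\<in>I. v i \<in> lspan F S \<Longrightarrow>
    \<exists>c. (\<forall>i\<in>I. c i \<in> F) \<and> (\<exists>i\<in>I. c i \<noteq> 0) \<and> (\<Sum>i\<in>I. c i * v i) = 0"
  using assms(2)
proof (induction S arbitrary: I v)
  case empty
  have "x = 0" if "x \<in> lspan F {}" for x using that by cases auto
  then have "\<forall>i\<in>I. v i = 0" using empty by blast
  moreover have "I \<noteq> {}" using empty by auto
  ultimately show ?case using F by (intro exI[of _ "\<lambda>_. 1"]) (auto simp: subfield_closed)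
next
  case (insert s S)
  obtain c where c: "\<forall>i\<in>I. c i \<in> F \<and> v i - c i * s \<in> lspan F S"
    using bchoice[of I "\<lambda>i c. c \<in> F \<and> v i - c * s \<in> lspan F S"]
      lspan_insert[OF F] insert.prems(3) by blast
  show ?case
  proof (cases "\<exists>j\<in>I. c j \<noteq> 0")
    case False
    then have "\<forall>i\<in>I. v i \<in> lspan F S" using c by auto
    moreover have "card S < card I" using insert by auto
    ultimately show ?thesis using insert.IH[of I v] insert.prems by blast
  next
    case True
    then obtain j where j: "j \<in> I" "c j \<noteq> 0" by blast
    define w where "w i = v i - c i / c j * v j" for i
    have w: "w i \<in> lspan F S" if "i \<in> I" for i
    proof -
      have "w i = (v i - c i * s) + (- (c i / c j)) * (v j - c j * s)"
        using j by (simp add: w_def field_simps)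
      also have "\<dots> \<in> lspan F S"
        using c j that F by (intro lspan_add lspan_scale) (auto intro!: subfield_closed)
      finally show ?thesis .
    qed
    have "card (I - {j}) > card S" using insert j by auto
    then obtain d where d: "\<forall>i\<in>I - {j}. d i \<in> F" "\<exists>i\<in>I - {j}. d i \<noteq> 0"
      "(\<Sum>i\<in>I - {j}. d i * w i) = 0"
      using insert.IH[of "I - {j}" w] w insert.prems by blast
    \<comment> \<open>The coefficient of \<open>v j\<close> collects the multiples of
      \<open>v j\<close> that were subtracted in the \<open>w i\<close>.\<close>
    define e where "e = d(j := - (\<Sum>i\<in>I - {j}. d i * (c i / c j)))"
    have "(\<Sum>i\<in>I. e i * v i) = e j * v j + (\<Sum>i\<in>I - {j}. e i * v i)"
      using insert.prems j by (simp add: sum.remove)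
    also have "(\<Sum>i\<in>I - {j}. e i * v i) = (\<Sum>i\<in>I - {j}. d i * v i)"
      by (intro sum.cong) (auto simp: e_def)
    also have "\<dots> = (\<Sum>i\<in>I - {j}. d i * w i) + (\<Sum>i\<in>I - {j}. d i * (c i / c j)) * v j"
      unfolding w_def sum_distrib_right sum.distrib[symmetric]
      by (intro sum.cong) (auto simp: algebra_simps)
    finally have "(\<Sum>i\<in>I. e i * v i) = 0" using d by (simp add: e_def)
    moreover have "\<forall>i\<in>I. e i \<in> F"
      using d c j F by (auto simp: e_def intro!: subfield_closed)
    moreover have "\<exists>i\<in>I. e i \<noteq> 0" using d by (auto simp: e_def)
    ultimately show ?thesis by blast
  qed
qed

text \<open>Only containment in a finite span is asked: by \<open>lspan_dependent\<close> this
  already bounds the size of independent families, and it is easy to maintain when elements are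
  adjoined.\<close>

definition fin_ring :: "'a::field set \<Rightarrow> 'a set \<Rightarrow> bool" where
  "fin_ring F V \<longleftrightarrow> F \<subseteq> V \<and> (\<forall>x\<in>V. \<forall>y\<in>V. x + y \<in> V \<and> x * y \<in> V) \<and>
     (\<exists>S. finite S \<and> V \<subseteq> lspan F S)"

lemma fin_ring_algebraic:
  assumes F: "subfield F" and V: "fin_ring F V" and x: "x \<in> V"
  shows "x \<in> alg F"
proof -
  have pow: "x ^ i \<in> V" for i
  proof (induction i)
    case 0
    then show ?case using V F subfield_0_1(2) unfolding fin_ring_def by auto
  next
    case (Suc i)
    then show ?case using V x by (auto simp: fin_ring_def)
  qed
  obtain S where S: "finite S" "V \<subseteq> lspan F S" using V by (auto simp: fin_ring_def)
  have "\<exists>c. (\<forall>i\<in>{..card S}. c i \<in> F) \<and> (\<exists>i\<in>{..card S}. c i \<noteq> 0) \<and> (\<Sum>i\<in>{..card S}. c i * x ^ i) = 0"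
    by (rule lspan_dependent[OF F S(1)]) (use pow S in auto)
  then obtain c where c: "\<forall>i\<le>card S. c i \<in> F" "\<exists>i\<le>card S. c i \<noteq> 0"
    "(\<Sum>i\<le>card S. c i * x ^ i) = 0" by auto
  define p where "p = (\<Sum>i\<le>card S. monom (c i) i)"
  have "coeff p i = (if i \<le> card S then c i else 0)" for i
    by (simp add: p_def coeff_sum)
  then have "p \<in> polys F" "p \<noteq> 0"
    using c F by (auto simp: polys_def subfield_closed poly_eq_iff)
  moreover have "poly p x = 0" using c by (simp add: p_def poly_sum poly_monom)
  ultimately show ?thesis by (auto simp: alg_def)
qed

text \<open>\<open>W\<close> is \<open>V[x]\<close>; the monic equation reduces \<open>x ^ n\<close>
  to lower powers. The coefficients of \<open>P\<close> may lie in \<open>V\<close> and not only in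
  \<open>F\<close>, which is what makes algebraicity transitive in \<open>alg_idem\<close>.\<close>

lemma fin_ring_adjoin:
  assumes F: "subfield F" and V: "fin_ring F V"
    and P: "\<And>i. coeff P i \<in> V" "lead_coeff P = 1" "poly P x = 0" "degree P \<ge> 1"
  shows "\<exists>W. fin_ring F W \<and> V \<subseteq> W \<and> x \<in> W"
proof -
  define n where "n = degree P"
  define W where "W = {\<Sum>i<n. a i * x ^ i | a. \<forall>i. a i \<in> V}"
  have V0: "0 \<in> V" "1 \<in> V" "-1 \<in> V"
    using V F subfield_closed(1,2,5)[OF F] unfolding fin_ring_def by auto
  have Vc: "a + b \<in> V" "a * b \<in> V" if "a \<in> V" "b \<in> V" for a b
    using that V by (auto simp: fin_ring_def)
  have Vm: "- a \<in> V" if "a \<in> V" for a using Vc(2)[OF V0(3) that] by simp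
  have Wadd: "r + s \<in> W" if "r \<in> W" "s \<in> W" for r s
  proof -
    from that obtain a b where "r = (\<Sum>i<n. a i * x ^ i)" "\<forall>i. a i \<in> V"
      "s = (\<Sum>i<n. b i * x ^ i)" "\<forall>i. b i \<in> V" by (auto simp: W_def)
    then show ?thesis unfolding W_def
      by (intro CollectI exI[of _ "\<lambda>i. a i + b i"]) (auto simp: sum.distrib algebra_simps Vc)
  qed
  have Wscale: "c * s \<in> W" if "c \<in> V" "s \<in> W" for c s
  proof -
    from that obtain b where "s = (\<Sum>i<n. b i * x ^ i)" "\<forall>i. b i \<in> V" by (auto simp: W_def)
    then show ?thesis unfolding W_def using that
      by (intro CollectI exI[of _ "\<lambda>i. c * b i"]) (auto simp: sum_distrib_left algebra_simps Vc)
  qed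
  have Wpow: "x ^ j \<in> W" if "j < n" for j
    unfolding W_def using that V0
    by (intro CollectI exI[of _ "\<lambda>i. if i = j then 1 else 0"]) (auto simp: if_distrib if_distribR cong: if_cong)
  have Wsum: "sum f A \<in> W" if "finite A" "\<And>i. i \<in> A \<Longrightarrow> f i \<in> W" for f and A :: "nat set"
  proof -
    have "0 \<in> W" using V0 unfolding W_def by (intro CollectI exI[of _ "\<lambda>_. 0"]) auto
    with that show ?thesis by (induction A rule: finite_induct) (auto intro: Wadd)
  qed
  have xn: "x ^ n \<in> W"
  proof -
    have "x ^ n = (\<Sum>i<n. (- coeff P i) * x ^ i)"
    proof -
      have "0 = (\<Sum>i\<le>n. coeff P i * x ^ i)" using P by (simp add: poly_altdef n_def)
      also have "{..n} = insert n {..<n}" by auto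
      finally have "0 = x ^ n + (\<Sum>i<n. coeff P i * x ^ i)" using P by (simp add: n_def)
      then show ?thesis by (simp add: sum_negf eq_neg_iff_add_eq_0)
    qed
    then show ?thesis unfolding W_def using P Vm by (intro CollectI exI[of _ "\<lambda>i. - coeff P i"]) auto
  qed
  have Wx: "s * x \<in> W" if "s \<in> W" for s
  proof -
    from that obtain b where b: "s = (\<Sum>i<n. b i * x ^ i)" "\<forall>i. b i \<in> V" by (auto simp: W_def)
    have "s * x = (\<Sum>i<n. b i * x ^ Suc i)"
      unfolding b(1) sum_distrib_right by (intro sum.cong) (auto simp: algebra_simps)
    also have "\<dots> \<in> W"
    proof (intro Wsum Wscale)
      fix i assume "i \<in> {..<n}"
      then show "x ^ Suc i \<in> W" using xn Wpow[of "Suc i"] by (cases "Suc i = n") auto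
    qed (use b in auto)
    finally show ?thesis .
  qed
  have Wxp: "s * x ^ j \<in> W" if "s \<in> W" for s j
  proof (induction j)
    case (Suc j)
    then show ?case using Wx[of "s * x ^ j"] by (simp add: algebra_simps)
  qed (use that in auto)
  have Wmult: "r * s \<in> W" if "r \<in> W" "s \<in> W" for r s
  proof -
    from that obtain b where b: "s = (\<Sum>i<n. b i * x ^ i)" "\<forall>i. b i \<in> V" by (auto simp: W_def)
    have "r * s = (\<Sum>i<n. b i * (r * x ^ i))"
      unfolding b(1) sum_distrib_left by (intro sum.cong) (auto simp: algebra_simps)
    also have "\<dots> \<in> W" using b that by (intro Wsum Wscale Wxp) auto
    finally show ?thesis .
  qed
  have one: "1 \<in> W" using Wpow[of 0] P by (simp add: n_def)
  have VW: "V \<subseteq> W" using Wscale[OF _ one] by auto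
  have xW: "x \<in> W" using Wx[OF one] by simp
  obtain S where S: "finite S" "V \<subseteq> lspan F S" using V by (auto simp: fin_ring_def)
  define T where "T = (\<Union>i<n. (\<lambda>s. s * x ^ i) ` S)"
  have "W \<subseteq> lspan F T"
  proof
    fix r assume "r \<in> W"
    then obtain b where b: "r = (\<Sum>i<n. b i * x ^ i)" "\<forall>i. b i \<in> V" by (auto simp: W_def)
    show "r \<in> lspan F T" unfolding b(1)
    proof (intro lspan_sum)
      fix i assume "i \<in> {..<n}"
      then show "b i * x ^ i \<in> lspan F T"
        using b S lspan_times[of "b i" F S "x ^ i"] by (auto simp: T_def intro: lspan_mono)
    qed
  qed
  moreover have "finite T" using S by (auto simp: T_def)
  moreover have "F \<subseteq> W" using V VW by (auto simp: fin_ring_def)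
  ultimately show ?thesis using Wadd Wmult VW xW unfolding fin_ring_def by (intro exI[of _ W]) auto
qed

lemma fin_ring_finite:
  assumes F: "subfield F" and "finite A" "A \<subseteq> alg F"
  shows "\<exists>V. fin_ring F V \<and> A \<subseteq> V"
  using assms(2,3)
proof induction
  case empty
  have "x \<in> lspan F {1}" if "x \<in> F" for x
    using lspan.add[OF that, of 1 "{1}" 0] lspan.zero by auto
  then have "fin_ring F F" unfolding fin_ring_def
    by (auto intro!: subfield_closed F exI[of _ "{1}"])
  then show ?case by auto
next
  case (insert x A)
  then obtain V where V: "fin_ring F V" "A \<subseteq> V" by auto
  obtain P where P: "P \<in> polys F" "lead_coeff P = 1" "poly P x = 0" "degree P \<ge> 1"
  proof -
    have "x \<in> alg F" using insert.prems by simp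
    from minpoly_exists[OF F this] that show thesis by metis
  qed
  have "coeff P i \<in> V" for i
    using P(1) V(1) unfolding polys_def fin_ring_def by blast
  then obtain W where "fin_ring F W" "V \<subseteq> W" "x \<in> W"
    using fin_ring_adjoin[OF F V(1) _ P(2-4)] by blast
  then show ?case using V(2) by blast
qed

lemma subfield_alg: assumes F: "subfield F" shows "subfield (alg F)"
proof -
  have 1: "x - y \<in> alg F \<and> x * y \<in> alg F" if xy: "x \<in> alg F" "y \<in> alg F" for x y
  proof -
    obtain V where V: "fin_ring F V" "{x, y, -1} \<subseteq> V"
      using fin_ring_finite[OF F, of "{x,y,-1}"] xy alg_superset[OF F] subfield_closed(2,5)[OF F] by auto
    have "a + b \<in> V" "a * b \<in> V" if "a \<in> V" "b \<in> V" for a b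
      using that V(1) by (auto simp: fin_ring_def)
    then have "x + (-1) * y \<in> V" "x * y \<in> V" using V(2) by blast+
    then show ?thesis using fin_ring_algebraic[OF F V(1)] by simp
  qed
  have 2: "inverse x \<in> alg F" if x: "x \<in> alg F" for x
  proof (cases "x = 0")
    case False
    obtain p where p: "p \<in> polys F" "p \<noteq> 0" "poly p x = 0" using x by (auto simp: alg_def)
    have "poly (reflect_poly p) (inverse x) = 0"
      using poly_reflect_poly_nz[of "inverse x" p] p False by simp
    moreover have "reflect_poly p \<in> polys F"
      using p F by (auto simp: polys_def coeff_reflect_poly subfield_closed)
    moreover have "reflect_poly p \<noteq> 0" using p by simp
    ultimately show ?thesis unfolding alg_def by blast
  qed (use x in auto)
  show ?thesis using 1 2 alg_superset[OF F] subfield_0_1[OF F] unfolding subfield_def by blast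
qed

lemma alg_idem: assumes F: "subfield F" shows "alg (alg F) = alg F"
proof
  show "alg F \<subseteq> alg (alg F)" by (intro alg_superset subfield_alg F)
  show "alg (alg F) \<subseteq> alg F"
  proof
    fix x assume "x \<in> alg (alg F)"
    then obtain P where P: "P \<in> polys (alg F)" "lead_coeff P = 1" "poly P x = 0" "degree P \<ge> 1"
      using minpoly_exists[OF subfield_alg[OF F]] by metis
    obtain V where V: "fin_ring F V" "insert 0 (coeff P ` {..degree P}) \<subseteq> V"
      using fin_ring_finite[OF F, of "insert 0 (coeff P ` {..degree P})"] P
        subfield_0_1(1)[OF subfield_alg[OF F]] by (auto simp: polys_def)
    have "coeff P i \<in> V" for i
      using V by (cases "i \<le> degree P") (auto simp: coeff_eq_0)
    then show "x \<in> alg F"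
      using fin_ring_adjoin[OF F V(1) _ P(2-4)] fin_ring_algebraic[OF F] by blast
  qed
qed

lemma transcendental_eq:
  assumes "subfield F" "x \<notin> alg F" "p \<in> polys F" "q \<in> polys F" "poly p x = poly q x"
  shows "p = q"
proof -
  have "p - q \<in> polys F" "poly (p - q) x = 0" using assms by (auto intro: polys_diff)
  then have "p - q = 0" using assms(2) unfolding alg_def by blast
  then show ?thesis by simp
qed

text \<open>Exchange: a polynomial relation over \<open>F[y]\<close> satisfied by \<open>x\<close> is read as a relation
  over \<open>F[x]\<close> satisfied by \<open>y\<close>.\<close>

lemma alg_adj_exchange:
  assumes F: "subfield F" and x: "x \<in> alg (adj F y)" "x \<notin> alg F"
  shows "y \<in> alg (adj F x)"
proof -
  obtain p where p: "p \<in> polys (adj F y)" "p \<noteq> 0" "poly p x = 0" using x by (auto simp: alg_def)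
  have "\<forall>i. \<exists>a b. a \<in> polys F \<and> b \<in> polys F \<and> poly b y \<noteq> 0 \<and> coeff p i = poly a y / poly b y"
  proof
    fix i
    have "coeff p i \<in> adj F y" using p by (simp add: polys_def)
    then show "\<exists>a b. a \<in> polys F \<and> b \<in> polys F \<and> poly b y \<noteq> 0 \<and> coeff p i = poly a y / poly b y"
      unfolding adj_def by blast
  qed
  then obtain a b where ab: "\<And>i. a i \<in> polys F" "\<And>i. b i \<in> polys F" "\<And>i. poly (b i) y \<noteq> 0"
    "\<And>i. coeff p i = poly (a i) y / poly (b i) y" by metis
  define n where "n = degree p"
  \<comment> \<open>Denominators are cleared: up to one common factor the coefficients of
    \<open>p\<close> become polynomials \<open>g i\<close> in \<open>y\<close>.\<close>
  define g where "g i = a i * (\<Prod>j\<in>{..n} - {i}. b j)" for i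
  have prodF: "(\<Prod>j\<in>A. b j) \<in> polys F" if "finite A" for A
    using that by (induction A rule: finite_induct) (auto simp: polys_closed F ab)
  have g: "g i \<in> polys F" for i using F ab prodF by (auto simp: g_def intro!: polys_closed)
  have gp: "poly (g i) y = (\<Prod>j\<le>n. poly (b j) y) * coeff p i" if "i \<le> n" for i
  proof -
    have "(\<Prod>j\<le>n. poly (b j) y) = poly (b i) y * (\<Prod>j\<in>{..n} - {i}. poly (b j) y)"
      using that by (simp add: prod.remove)
    then show ?thesis using ab(3)[of i] by (simp add: g_def poly_prod ab(4))
  qed
  have nz: "(\<Prod>j\<le>n. poly (b j) y) \<noteq> 0" using ab by auto
  define m where "m = Max ((\<lambda>i. degree (g i)) ` {..n})"
  have m: "degree (g i) \<le> m" if "i \<le> n" for i using that by (auto simp: m_def)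
  \<comment> \<open>The coefficient matrix of the \<open>g i\<close> is transposed:
    \<open>h j\<close> gathers what multiplies \<open>y ^ j\<close>, as a polynomial in
    \<open>x\<close>.\<close>
  define h where "h j = (\<Sum>i\<le>n. monom (coeff (g i) j) i)" for j
  have hF: "h j \<in> polys F" for j
    using F g by (auto simp: h_def polys_def[of F] coeff_sum intro!: subfield_closed)
  have sumpoly: "poly r z = (\<Sum>j\<le>m. coeff r j * z ^ j)" if "degree r \<le> m" for r and z :: 'a
    unfolding poly_altdef using that by (intro sum.mono_neutral_left) (auto simp: coeff_eq_0)
  define q where "q = (\<Sum>j\<le>m. monom (poly (h j) x) j)"
  have cq: "coeff q j = (if j \<le> m then poly (h j) x else 0)" for j
    by (simp add: q_def coeff_sum)
  have qF: "q \<in> polys (adj F x)"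
    unfolding polys_def mem_Collect_eq cq
    using adj_poly[OF F hF] subfield_0_1(1)[OF subfield_adj[OF F]] by simp
  have "poly q y = (\<Sum>j\<le>m. \<Sum>i\<le>n. coeff (g i) j * x ^ i * y ^ j)"
    by (simp add: q_def poly_sum poly_monom h_def sum_distrib_right)
  also have "\<dots> = (\<Sum>i\<le>n. \<Sum>j\<le>m. coeff (g i) j * x ^ i * y ^ j)" by (rule sum.swap)
  also have "\<dots> = (\<Sum>i\<le>n. poly (g i) y * x ^ i)"
    by (intro sum.cong) (simp_all add: sumpoly m sum_distrib_right sum_distrib_left mult_ac)
  also have "\<dots> = (\<Prod>j\<le>n. poly (b j) y) * poly p x"
    unfolding poly_altdef[of p] n_def[symmetric] sum_distrib_left
    by (intro sum.cong) (simp_all add: gp mult_ac)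
  finally have "poly q y = 0" using p by simp
  moreover have "q \<noteq> 0"
  proof
    assume "q = 0"
    then have "poly (h j) x = 0" if "j \<le> m" for j using cq[of j] that by simp
    then have h0: "h j = 0" if "j \<le> m" for j using x(2) hF that by (auto simp: alg_def)
    have "coeff (g n) j = 0" for j
    proof (cases "j \<le> m")
      case True
      then have "coeff (h j) n = 0" using h0 by simp
      then show ?thesis by (simp add: h_def coeff_sum)
    next
      case False
      then show ?thesis using m[of n] by (intro coeff_eq_0) auto
    qed
    then have "g n = 0" by (simp add: poly_eq_iff)
    then show False using gp[of n] nz p by (simp add: n_def)
  qed
  ultimately show ?thesis using qF by (auto simp: alg_def)
qed

section \<open>Derivations on subfields\<close>

text \<open>Values may lie anywhere in the ambient field. Stability of a subfield under
  \<open>d\<close> is stated separately where it is needed, which allows derivations to be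
  restricted and rescaled freely.\<close>

definition derivation_on :: "'a::field set \<Rightarrow> ('a \<Rightarrow> 'a) \<Rightarrow> bool" where
  "derivation_on K d \<longleftrightarrow>
     (\<forall>x\<in>K. \<forall>y\<in>K. d (x + y) = d x + d y \<and> d (x * y) = d x * y + x * d y)"

context
  fixes K :: "'a::field set" and d
  assumes K: "subfield K" and d: "derivation_on K d"
begin

lemma derivation_add: "x \<in> K \<Longrightarrow> y \<in> K \<Longrightarrow> d (x + y) = d x + d y"
  using d unfolding derivation_on_def by blast

lemma derivation_mult: "x \<in> K \<Longrightarrow> y \<in> K \<Longrightarrow> d (x * y) = d x * y + x * d y"
  using d unfolding derivation_on_def by blast

lemma derivation_0: "d 0 = 0"
  using derivation_add[of 0 0] subfield_closed(1)[OF K] by (metis add_0 add_cancel_left_left)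

lemma derivation_1: "d 1 = 0"
  using derivation_mult[of 1 1] subfield_closed(2)[OF K]
  by (metis mult_1 mult.right_neutral add_cancel_left_left)

lemma derivation_uminus: "x \<in> K \<Longrightarrow> d (- x) = - d x"
  using derivation_add[of x "- x"] subfield_uminus[OF K, of x] derivation_0
  by (simp add: eq_neg_iff_add_eq_0 add.commute)

lemma derivation_diff: "x \<in> K \<Longrightarrow> y \<in> K \<Longrightarrow> d (x - y) = d x - d y"
  using derivation_add[of x "- y"] derivation_uminus[of y] subfield_uminus[OF K, of y] by simp

lemma derivation_of_nat: "d (of_nat n) = 0"
proof (induction n)
  case (Suc n)
  then show ?case
    using derivation_add[of 1 "of_nat n"] subfield_closed(2)[OF K] subfield_of_nat[OF K, of n]
    by (simp add: derivation_1)
qed (simp add: derivation_0)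

lemma derivation_divide:
  assumes "x \<in> K" "y \<in> K" "y \<noteq> 0"
  shows "d (x / y) = (d x * y - x * d y) / y\<^sup>2"
proof -
  have "x / y \<in> K" using assms K by (intro subfield_closed)
  then have "d (x / y * y) = d (x / y) * y + x / y * d y"
    using assms by (intro derivation_mult)
  then have "d x = d (x / y) * y + x / y * d y" using assms by simp
  then show ?thesis using assms by (simp add: field_simps power2_eq_square)
qed

text \<open>The extra factor \<open>x\<close> avoids the exponent \<open>n - 1\<close> and a case
  distinction at \<open>n = 0\<close>.\<close>

lemma derivation_power: "x \<in> K \<Longrightarrow> d (x ^ n) * x = of_nat n * x ^ n * d x"
proof (induction n)
  case (Suc n)
  then have "d (x ^ Suc n) = d x * x ^ n + x * d (x ^ n)"
    using derivation_mult[of x "x ^ n"] subfield_power[OF K, of x n] by simp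
  then have "d (x ^ Suc n) * x = d x * x ^ n * x + x * (d (x ^ n) * x)"
    by (simp add: algebra_simps)
  then show ?case using Suc by (simp add: algebra_simps)
qed (simp add: derivation_1)

end

text \<open>The value that the chain rule prescribes for the derivative of \<open>poly p x\<close>
  when \<open>x\<close> is to be sent to \<open>y\<close>.\<close>

definition dpoly :: "('a::field \<Rightarrow> 'a) \<Rightarrow> 'a \<Rightarrow> 'a \<Rightarrow> 'a poly \<Rightarrow> 'a" where
  "dpoly d x y p = poly (map_poly d p) x + poly (pderiv p) x * y"

context
  fixes F :: "'a::field set" and d and x y :: 'a
  assumes F: "subfield F" and d: "derivation_on F d"
begin

lemma dpoly_pCons: "dpoly d x y (pCons a p) = d a + poly p x * y + x * dpoly d x y p"
  by (simp add: dpoly_def derivation_0[OF F d] pderiv_pCons map_poly_pCons algebra_simps)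

lemma dpoly_0: "dpoly d x y 0 = 0"
  by (simp add: dpoly_def)

lemma dpoly_add:
  assumes "p \<in> polys F" "q \<in> polys F"
  shows "dpoly d x y (p + q) = dpoly d x y p + dpoly d x y q"
proof -
  have "map_poly d (p + q) = map_poly d p + map_poly d q"
    using assms derivation_add[OF F d]
    by (intro poly_eqI) (simp add: coeff_map_poly derivation_0[OF F d] polys_def)
  then show ?thesis by (simp add: dpoly_def pderiv_add algebra_simps)
qed

lemma dpoly_smult:
  assumes a: "a \<in> F" and q: "q \<in> polys F"
  shows "dpoly d x y (smult a q) = d a * poly q x + a * dpoly d x y q"
  using q
proof (induction q)
  case (pCons b q)
  then show ?case using a
    by (simp add: dpoly_pCons derivation_mult[OF F d] algebra_simps)
qed (simp add: dpoly_0)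

lemma dpoly_diff:
  assumes "p \<in> polys F" "q \<in> polys F"
  shows "dpoly d x y (p - q) = dpoly d x y p - dpoly d x y q"
  using dpoly_add[of "p - q" q] assms F by (simp add: polys_closed)

lemma dpoly_mult:
  assumes p: "p \<in> polys F" and q: "q \<in> polys F"
  shows "dpoly d x y (p * q) = dpoly d x y p * poly q x + poly p x * dpoly d x y q"
  using p
proof (induction p)
  case (pCons a p)
  have "dpoly d x y (pCons a p * q) = dpoly d x y (smult a q) + dpoly d x y (pCons 0 (p * q))"
    using pCons q F by (subst dpoly_add[symmetric]) (auto intro!: polys_closed subfield_closed)
  then show ?case using pCons q
    by (simp add: dpoly_pCons dpoly_smult derivation_0[OF F d] algebra_simps)
qed (simp add: dpoly_0)

lemma derivation_poly:
  assumes "x \<in> F" "p \<in> polys F"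
  shows "d (poly p x) = dpoly d x (d x) p"
  using assms(2)
proof (induction p)
  case 0
  then show ?case by (simp add: dpoly_def derivation_0[OF F d])
next
  case (pCons a p)
  then show ?case using assms(1) F
    by (simp add: dpoly_def derivation_add[OF F d] derivation_mult[OF F d] poly_in
        subfield_closed pderiv_pCons map_poly_pCons derivation_0[OF F d] algebra_simps)
qed

text \<open>The hypothesis on \<open>y\<close> says that \<open>dpoly d x y p\<close> depends only
  on \<open>poly p x\<close>. The quotient rule then gives values on fractions, and the hypothesis
  for \<open>p * q' - p' * q\<close> shows that they do not depend on the chosen
  representation.\<close>

lemma derivation_extend:
  assumes y: "\<And>p. p \<in> polys F \<Longrightarrow> poly p x = 0 \<Longrightarrow> dpoly d x y p = 0"
  obtains d' where "derivation_on (adj F x) d'" "\<And>a. a \<in> F \<Longrightarrow> d' a = d a" "d' x = y"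
proof -
  let ?D = "dpoly d x y"
  let ?v = "\<lambda>p q. (?D p * poly q x - poly p x * ?D q) / (poly q x)\<^sup>2"
  define d' where "d' r = (SOME v. \<exists>p q. p \<in> polys F \<and> q \<in> polys F \<and> poly q x \<noteq> 0 \<and>
    r = poly p x / poly q x \<and> v = ?v p q)" for r
  have d': "d' (poly p x / poly q x) = ?v p q"
    if pq: "p \<in> polys F" "q \<in> polys F" "poly q x \<noteq> 0" for p q
  proof -
    let ?P = "\<lambda>v. \<exists>p' q'. p' \<in> polys F \<and> q' \<in> polys F \<and> poly q' x \<noteq> 0 \<and>
      poly p x / poly q x = poly p' x / poly q' x \<and> v = ?v p' q'"
    have "?P (d' (poly p x / poly q x))"
      unfolding d'_def by (rule someI[of ?P "?v p q"]) (use pq in blast)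
    then obtain p' q' where *: "p' \<in> polys F" "q' \<in> polys F" "poly q' x \<noteq> 0"
      "poly p x / poly q x = poly p' x / poly q' x" "d' (poly p x / poly q x) = ?v p' q'" by blast
    define c where "c = poly p x / poly q x"
    have c: "poly p x = c * poly q x" "poly p' x = c * poly q' x"
      using * pq unfolding c_def by (simp_all add: field_simps)
    have "?D (p * q' - p' * q) = 0"
      using * pq F c by (intro y) (auto intro!: polys_closed subfield_closed)
    then have "?D p * poly q' x + poly p x * ?D q' = ?D p' * poly q x + poly p' x * ?D q"
      using * pq F by (simp add: dpoly_diff dpoly_mult polys_closed)
    then have eq: "(?D p - c * ?D q) * poly q' x = (?D p' - c * ?D q') * poly q x"
      by (simp add: c algebra_simps)
    have "?v p q = (?D p - c * ?D q) / poly q x" "?v p' q' = (?D p' - c * ?D q') / poly q' x"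
      using pq * by (simp_all add: c power2_eq_square field_simps)
    moreover have "(?D p - c * ?D q) / poly q x = (?D p' - c * ?D q') / poly q' x"
      unfolding frac_eq_eq[OF pq(3) *(3)] by (rule eq)
    ultimately show ?thesis using *(5) by simp
  qed
  have pol: "d' (poly p x) = ?D p" if "p \<in> polys F" for p
  proof -
    have "?D 1 = 0"
      using dpoly_pCons[of 1 0] by (simp add: dpoly_0 derivation_1[OF F d] one_pCons)
    then show ?thesis using d'[of p 1] that F by (simp add: polys_closed)
  qed
  have "derivation_on (adj F x) d'"
    unfolding derivation_on_def
  proof safe
    fix r s assume "r \<in> adj F x" "s \<in> adj F x"
    then obtain p q p' q' where *: "p \<in> polys F" "q \<in> polys F" "poly q x \<noteq> 0"
      "p' \<in> polys F" "q' \<in> polys F" "poly q' x \<noteq> 0"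
      and rs: "r = poly p x / poly q x" "s = poly p' x / poly q' x"
      unfolding adj_def by blast
    have add: "r + s = poly (p * q' + p' * q) x / poly (q * q') x"
      and mult: "r * s = poly (p * p') x / poly (q * q') x"
      unfolding rs using *(3,6) by (simp_all add: field_simps)
    have nz: "poly (q * q') x \<noteq> 0" using * by simp
    have "d' (r + s) = ?v (p * q' + p' * q) (q * q')"
      unfolding add using * F nz by (intro d') (auto intro!: polys_closed)
    also have "\<dots> = d' r + d' s"
      using * F unfolding rs d'[OF *(1-3)] d'[OF *(4-6)]
      by (simp add: dpoly_add dpoly_mult polys_closed field_simps power2_eq_square)
    finally show "d' (r + s) = d' r + d' s" .
    have "d' (r * s) = ?v (p * p') (q * q')"
      unfolding mult using * F nz by (intro d') (auto intro!: polys_closed)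
    also have "\<dots> = d' r * s + r * d' s"
      using * F unfolding rs d'[OF *(1-3)] d'[OF *(4-6)]
      by (simp add: dpoly_mult field_simps power2_eq_square)
    finally show "d' (r * s) = d' r * s + r * d' s" .
  qed
  moreover have "d' a = d a" if "a \<in> F" for a
    using pol[of "[:a:]"] that F by (simp add: polys_closed dpoly_pCons dpoly_0)
  moreover have "d' x = y"
    using pol[of "[:0,1:]"] F
    by (simp add: polys_closed subfield_closed dpoly_pCons dpoly_0 derivation_0[OF F d] derivation_1[OF F d])
  ultimately show ?thesis using that by blast
qed

lemma derivation_extend_transcendental:
  assumes "x \<notin> alg F"
  obtains d' where "derivation_on (adj F x) d'" "\<And>a. a \<in> F \<Longrightarrow> d' a = d a" "d' x = y"
proof -
  have "dpoly d x y p = 0" if "p \<in> polys F" "poly p x = 0" for p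
  proof -
    have "p = 0" using assms that by (auto simp: alg_def)
    then show ?thesis by (simp add: dpoly_0)
  qed
  then show ?thesis using derivation_extend that by blast
qed

end

lemma derivation_extend_algebraic:
  fixes F :: "'a::field_char_0 set"
  assumes F: "subfield F" and d: "derivation_on F d" and x: "x \<in> alg F"
  obtains d' where "derivation_on (adj F x) d'" "\<And>a. a \<in> F \<Longrightarrow> d' a = d a"
proof -
  obtain P where P: "P \<in> polys F" "lead_coeff P = 1" "poly P x = 0" "degree P \<ge> 1"
    "\<And>q. q \<in> polys F \<Longrightarrow> poly q x = 0 \<Longrightarrow> degree q < degree P \<Longrightarrow> q = 0"
    using minpoly_exists[OF F x] by metis
  have nz: "poly (pderiv P) x \<noteq> 0"
    using P(5)[of "pderiv P"] P F by (auto simp: polys_closed degree_pderiv pderiv_eq_0_iff)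
  \<comment> \<open>The only possible derivative of \<open>x\<close>, forced by differentiating
    \<open>P(x) = 0\<close>. Minimality of \<open>P\<close> and characteristic 0 keep the
    denominator nonzero.\<close>
  define y where "y = - poly (map_poly d P) x / poly (pderiv P) x"
  have yP: "dpoly d x y P = 0" using nz by (simp add: dpoly_def y_def)
  have "dpoly d x y p = 0" if p: "p \<in> polys F" "poly p x = 0" for p
  proof -
    obtain q r where qr: "q \<in> polys F" "r \<in> polys F" "p = q * P + r" "degree r < degree P \<or> r = 0"
      using poly_division[OF F P(1,2) p(1)] by blast
    have "r = 0" using qr P p by auto
    then show ?thesis using qr P yP by (simp add: dpoly_mult[OF F d])
  qed
  then show ?thesis using derivation_extend[OF F d] that by metis
qed

context
  fixes K :: "'a::field_char_0 set" and d
  assumes K: "subfield K" and d: "derivation_on K d"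
begin

lemma derivation_alg_formula:
  assumes F: "subfield F" "F \<subseteq> K" and x: "x \<in> K" "x \<in> alg F"
  obtains P where "P \<in> polys F" "poly (pderiv P) x \<noteq> 0"
    "d x = - poly (map_poly d P) x / poly (pderiv P) x"
proof -
  obtain P where P: "P \<in> polys F" "lead_coeff P = 1" "poly P x = 0" "degree P \<ge> 1"
    "\<And>q. q \<in> polys F \<Longrightarrow> poly q x = 0 \<Longrightarrow> degree q < degree P \<Longrightarrow> q = 0"
    using minpoly_exists[OF F(1) x(2)] by metis
  have nz: "poly (pderiv P) x \<noteq> 0"
    using P(5)[of "pderiv P"] P F by (auto simp: polys_closed degree_pderiv pderiv_eq_0_iff)
  have "P \<in> polys K" using P polys_mono[OF F(2)] by auto
  then have "dpoly d x (d x) P = 0"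
    using derivation_poly[OF K d x(1), of P] P derivation_0[OF K d] by simp
  then have "d x = - poly (map_poly d P) x / poly (pderiv P) x"
    using nz by (simp add: dpoly_def field_simps eq_neg_iff_add_eq_0)
  then show ?thesis using that P nz by blast
qed

text \<open>The derivative of an algebraic element is forced by its minimal polynomial, whose
  coefficients have derivative 0 here. This is the uniqueness that turns identities between
  derivations into a check on generators.\<close>

lemma derivation_alg_zero:
  assumes F: "subfield F" "F \<subseteq> K" and x: "x \<in> K" "x \<in> alg F" and "\<And>a. a \<in> F \<Longrightarrow> d a = 0"
  shows "d x = 0"
proof -
  obtain P where P: "P \<in> polys F" "d x = - poly (map_poly d P) x / poly (pderiv P) x"
    using derivation_alg_formula[OF F x] by metis
  have "map_poly d P = 0"
    using P assms(5) by (intro poly_eqI) (simp add: coeff_map_poly derivation_0[OF K d] polys_def)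
  then show ?thesis using P by simp
qed

lemma derivation_alg_stable:
  assumes F: "subfield F" "F \<subseteq> K" and x: "x \<in> K" "x \<in> alg F" and "\<And>a. a \<in> F \<Longrightarrow> d a \<in> F"
  shows "d x \<in> adj F x"
proof -
  obtain P where P: "P \<in> polys F" "poly (pderiv P) x \<noteq> 0"
    "d x = poly (- map_poly d P) x / poly (pderiv P) x"
    using derivation_alg_formula[OF F x] by (metis poly_minus)
  have "map_poly d P \<in> polys F"
    using P assms(5) by (simp add: coeff_map_poly derivation_0[OF K d] polys_def)
  then show ?thesis unfolding P(3) using P F by (intro adjI polys_closed)
qed

lemma derivation_poly_const:
  assumes F: "F \<subseteq> K" and x: "x \<in> K" and p: "p \<in> polys F" and 0: "\<And>a. a \<in> F \<Longrightarrow> d a = 0"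
  shows "d (poly p x) = poly (pderiv p) x * d x"
proof -
  have "map_poly d p = 0"
    using p 0 by (intro poly_eqI) (simp add: coeff_map_poly derivation_0[OF K d] polys_def)
  moreover have "p \<in> polys K" using p polys_mono[OF F] by auto
  ultimately show ?thesis using derivation_poly[OF K d x] by (simp add: dpoly_def)
qed

lemma derivation_adj_stable:
  assumes F: "subfield F" "F \<subseteq> K" and x: "x \<in> K" "d x \<in> adj F x"
    and "\<And>a. a \<in> F \<Longrightarrow> d a \<in> adj F x" and r: "r \<in> adj F x"
  shows "d r \<in> adj F x"
proof -
  note A = subfield_adj[OF F(1), of x]
  have pol: "d (poly p x) \<in> adj F x" if p: "p \<in> polys F" for p
    using p
  proof (induction p)
    case (pCons a p)
    then have "a \<in> K" "poly p x \<in> K" "poly p x \<in> adj F x"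
      using F x polys_mono[OF F(2)] by (auto intro!: poly_in K adj_poly)
    then show ?case using pCons assms x adj_gen[OF F(1)]
      by (auto simp: derivation_add[OF K d] derivation_mult[OF K d] subfield_closed K
          intro!: subfield_add[OF A] subfield_minus_mult[OF A])
  qed (use A in \<open>simp add: derivation_0[OF K d] subfield_closed\<close>)
  obtain p q where pq: "p \<in> polys F" "q \<in> polys F" "poly q x \<noteq> 0" "r = poly p x / poly q x"
    using r by (auto simp: adj_def)
  then have "poly p x \<in> K" "poly q x \<in> K" "poly p x \<in> adj F x" "poly q x \<in> adj F x"
    using F x polys_mono[OF F(2)] by (auto intro!: poly_in K adj_poly)
  then show ?thesis using pq pol[of p] pol[of q] A
    by (simp add: derivation_divide[OF K d] subfield_closed)
qed

end

section \<open>Traces and residues\<close>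

lemma derivation_adj_zero:
  fixes K :: "'a::field_char_0 set"
  assumes K: "subfield K" and d: "derivation_on K d"
    and F: "F \<subseteq> K" and x: "x \<in> K" "d x = 0" and 0: "\<And>a. a \<in> F \<Longrightarrow> d a = 0"
    and r: "r \<in> adj F x"
  shows "d r = 0"
proof -
  obtain p q where pq: "p \<in> polys F" "q \<in> polys F" "poly q x \<noteq> 0" "r = poly p x / poly q x"
    using r by (auto simp: adj_def)
  have "poly p x \<in> K" "poly q x \<in> K"
    using pq F x polys_mono[OF F] by (auto intro!: poly_in K)
  then show ?thesis using pq derivation_poly_const[OF K d F x(1)] 0 x
    by (simp add: derivation_divide[OF K d])
qed

text \<open>The numerator of the derivative of \<open>p / q\<close> over the denominator
  \<open>q ^ 2\<close>.\<close>

definition wronskian :: "'a::field_char_0 poly \<Rightarrow> 'a poly \<Rightarrow> 'a poly" where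
  "wronskian p q = pderiv p * q - p * pderiv q"

text \<open>Each of the two products loses a degree. This strict drop is the contradiction in
  \<open>exponential_in_k\<close> and the source of \<open>e < a\<close> in
  \<open>power_ode_step\<close>.\<close>

lemma degree_wronskian:
  "wronskian p q = 0 \<or> degree (wronskian p q) < degree p + degree q"
proof (cases "degree p + degree q = 0")
  case True
  then have "pderiv p = 0" "pderiv q = 0" by (auto simp: pderiv_eq_0_iff)
  then show ?thesis by (simp add: wronskian_def)
next
  case False
  have *: "degree (pderiv r * s) \<le> degree r + degree s - 1" for r s :: "'a poly"
  proof (cases "degree r = 0")
    case True
    then have "pderiv r = 0" by (simp add: pderiv_eq_0_iff)
    then show ?thesis by simp
  next
    case False
    have "degree (pderiv r * s) \<le> degree (pderiv r) + degree s" by (rule degree_mult_le)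
    then show ?thesis using False by (simp add: degree_pderiv)
  qed
  have "degree (wronskian p q) \<le> degree p + degree q - 1"
    unfolding wronskian_def using *[of p q] *[of q p]
    by (intro degree_diff_le) (simp_all add: mult.commute add.commute)
  then show ?thesis using False by linarith
qed

lemma wronskian_in_polys: "subfield F \<Longrightarrow> p \<in> polys F \<Longrightarrow> q \<in> polys F \<Longrightarrow> wronskian p q \<in> polys F"
  by (simp add: wronskian_def polys_closed)

text \<open>Comparing the two outer coefficients of the minimal polynomial amounts to taking the trace
  of \<open>\<lambda> d \<theta> + \<mu> d \<theta> / \<theta> = g\<close>.\<close>

lemma trace_identity:
  fixes K :: "'a::field_char_0 set"
  assumes K: "subfield K" and d: "derivation_on K d"
    and F: "subfield F" "F \<subseteq> K" "\<And>a. a \<in> F \<Longrightarrow> d a \<in> F"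
    and \<theta>: "\<theta> \<in> K" "\<theta> \<in> alg F" "\<theta> \<noteq> 0" "(l * \<theta> + m) * d \<theta> = g * \<theta>"
    and lmg: "l \<in> F" "m \<in> F" "g \<in> F"
  obtains n N T where "n \<ge> 1" "N \<in> F" "N \<noteq> 0" "T \<in> F"
    "of_nat n * g * N = m * d N + l * N * d T"
proof -
  obtain P where P: "P \<in> polys F" "lead_coeff P = 1" "poly P \<theta> = 0" "degree P \<ge> 1"
    "\<And>q. q \<in> polys F \<Longrightarrow> poly q \<theta> = 0 \<Longrightarrow> degree q < degree P \<Longrightarrow> q = 0"
    using minpoly_exists[OF F(1) \<theta>(2)] by metis
  define n where "n = degree P"
  define q where "q = map_poly d P"
  define \<beta> where "\<beta> = l * d (coeff P (n - 1)) + of_nat n * g"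
  have cP: "coeff P i \<in> F" for i using P by (simp add: polys_def)
  have d0: "d 0 = 0" "d 1 = 0" using derivation_0[OF K d] derivation_1[OF K d] by auto
  have cq: "coeff q i = d (coeff P i)" for i by (simp add: q_def coeff_map_poly d0)
  have q: "q \<in> polys F" using P F(3) by (simp add: polys_def cq)
  \<comment> \<open>\<open>(l X + m) q + g X P'\<close> takes at \<theta> the value
    \<open>l \<theta> + m\<close> times the derivative of \<open>P(\<theta>)\<close>, which is 0.
    Subtracting \<open>\<beta> P\<close> removes the term of degree \<open>n\<close>.\<close>
  define S where "S = smult m q + pCons 0 (smult l q) + pCons 0 (smult g (pderiv P)) - smult \<beta> P"
  have bF: "\<beta> \<in> F" unfolding \<beta>_def using F(1,3) lmg cP by (intro subfield_closed) auto
  have SF: "S \<in> polys F"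
    unfolding S_def using F(1) lmg q P bF by (auto intro!: polys_closed subfield_closed)
  have "dpoly d \<theta> (d \<theta>) P = 0"
    using derivation_poly[OF K d \<theta>(1), of P] P polys_mono[OF F(2)] d0 by auto
  then have "poly q \<theta> + poly (pderiv P) \<theta> * d \<theta> = 0" by (simp add: dpoly_def q_def)
  moreover have "poly S \<theta> = (l * \<theta> + m) * (poly q \<theta> + poly (pderiv P) \<theta> * d \<theta>)"
  proof -
    have "poly S \<theta> = (l * \<theta> + m) * poly q \<theta> + (g * \<theta>) * poly (pderiv P) \<theta>"
      using P by (simp add: S_def algebra_simps)
    then show ?thesis unfolding \<theta>(4)[symmetric] by (simp add: algebra_simps)
  qed
  ultimately have S0: "poly S \<theta> = 0" by simp
  \<comment> \<open>In degree \<open>n\<close> this is the choice of \<beta>; above it only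
    derivatives of the leading coefficient 1 and of zero coefficients could contribute.\<close>
  have "coeff S i = 0" if "i \<ge> n" for i
  proof (cases "i = n")
    case True
    then obtain j where j: "n = Suc j" using P by (cases n) (auto simp: n_def)
    have "coeff P (Suc j) = 1" using P(2) by (simp add: n_def[symmetric] j)
    then show ?thesis using True
      by (simp add: S_def cq d0 \<beta>_def j coeff_pderiv)
  next
    case False
    then have "n < i" using that by simp
    then obtain j where j: "i = Suc j" "n \<le> j" by (cases i) auto
    then have "coeff P (Suc j) = 0" by (intro coeff_eq_0) (auto simp: n_def)
    moreover have "d (coeff P j) = 0"
    proof (cases "j = n")
      case True
      then show ?thesis using P(2) by (simp add: n_def d0)
    next
      case False
      then show ?thesis using j by (simp add: coeff_eq_0 n_def d0)
    qed
    ultimately show ?thesis by (simp add: S_def cq d0 j(1) coeff_pderiv)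
  qed
  then have "degree S < n \<or> S = 0"
    by (metis leading_coeff_0_iff not_le)
  then have "S = 0" using P(5)[OF SF S0] by (auto simp: n_def)
  \<comment> \<open>The constant coefficient of \<open>P\<close> is the norm of \<theta> up to sign
    and becomes \<open>N\<close>; the coefficient next to the leading one is minus the trace and
    becomes \<open>- T\<close>.\<close>
  then have "coeff S 0 = 0" by simp
  then have eq: "m * d (coeff P 0) = \<beta> * coeff P 0" by (simp add: S_def cq)
  \<comment> \<open>Otherwise \<open>P\<close> divided by \<open>X\<close> would be a smaller
    equation for \<theta>, which is nonzero.\<close>
  have nz: "coeff P 0 \<noteq> 0"
  proof
    assume "coeff P 0 = 0"
    then obtain P2 where P2: "P = pCons 0 P2" by (metis coeff_pCons_0 pCons_cases)
    then have "poly P2 \<theta> = 0" using P(3) \<theta>(3) by simp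
    moreover have "P2 \<in> polys F" using P(1) P2 by simp
    moreover have "P2 \<noteq> 0"
    proof
      assume "P2 = 0"
      then have "P = 0" using P2 by simp
      then show False using P(2) by simp
    qed
    moreover from this have "degree P2 < degree P"
      unfolding P2 by (simp only: degree_pCons_eq not_False_eq_True simp_thms lessI)
    ultimately show False using P(5)[of P2] by blast
  qed
  have "- coeff P (n - 1) \<in> F" using cP F(1) by (simp add: subfield_closed)
  moreover have "d (- coeff P (n - 1)) = - d (coeff P (n - 1))"
    using cP F(2) by (intro derivation_uminus[OF K d]) auto
  then have "of_nat n * g * coeff P 0 = m * d (coeff P 0) + l * coeff P 0 * d (- coeff P (n - 1))"
    using eq by (simp add: \<beta>_def algebra_simps)
  ultimately show ?thesis using that[of n "coeff P 0"] P(4) nz cP by (auto simp: n_def)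
qed

section \<open>Residues of rational forms at simple poles\<close>

definition taylor_fls :: "'a::field_char_0 \<Rightarrow> 'a poly \<Rightarrow> 'a fls" where
  "taylor_fls r p = fps_to_fls (fps_of_poly (pcompose p [:r, 1:]))"

lemma taylor_fls_hom:
  "taylor_fls r (p + q) = taylor_fls r p + taylor_fls r q"
  "taylor_fls r (p - q) = taylor_fls r p - taylor_fls r q"
  "taylor_fls r (p * q) = taylor_fls r p * taylor_fls r q"
  "taylor_fls r (smult c p) = fls_const c * taylor_fls r p"
  "taylor_fls r (pderiv p) = fls_deriv (taylor_fls r p)"
  by (simp_all add: taylor_fls_def pcompose_add pcompose_diff pcompose_mult pcompose_smult
      fps_of_poly_simps fls_times_fps_to_fls
      fls_deriv_fps_to_fls fps_of_poly_pderiv[symmetric] pderiv_pcompose pderiv_pCons)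

lemma taylor_fls_power: "taylor_fls r (p ^ n) = taylor_fls r p ^ n"
proof (induction n)
  case 0
  show ?case by (simp add: taylor_fls_def pcompose_1)
qed (simp add: taylor_fls_hom)

lemma taylor_fls_eq_0: "taylor_fls r p = 0 \<longleftrightarrow> p = 0"
proof -
  have "taylor_fls r p = 0 \<longleftrightarrow> pcompose p [:r, 1:] = 0"
    by (simp add: taylor_fls_def fps_to_fls_eq_0_iff flip: fps_of_poly_0)
  then show ?thesis using pcompose_eq_0[of p "[:r,1:]"] by auto
qed

lemma fls_residue_log_deriv:
  fixes f :: "'a::field_char_0 fls"
  assumes "f \<noteq> 0"
  shows "fls_residue (fls_deriv f / f) = of_int (fls_subdegree f)"
  using fls_residue_deriv_times_lr_inverse_eq_subdegree(1)[of "inverse (fls_nth f (fls_subdegree f))" f] assms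
  by (simp add: divide_inverse fls_inverse_def')

lemma simple_pole_residue:
  assumes "poly G r = 0" "poly (pderiv G) r \<noteq> 0"
  shows "fls_residue (taylor_fls r H / taylor_fls r G) = poly H r / poly (pderiv G) r"
proof -
  obtain G1 where G1: "G = [:- r, 1:] * G1" using assms(1) poly_eq_0_iff_dvd by (metis dvdE)
  have dG: "poly (pderiv G) r = poly G1 r"
    unfolding G1 pderiv_mult by (simp add: pderiv_pCons)
  define h g where "h = fps_of_poly (pcompose H [:r, 1:])" "g = fps_of_poly (pcompose G1 [:r, 1:])"
  have nth: "fps_nth (fps_of_poly (pcompose p [:r, 1:])) 0 = poly p r" for p
    by (simp add: poly_0_coeff_0[symmetric] poly_pcompose)
  have "taylor_fls r [:- r, 1:] = fls_X"
    by (simp add: taylor_fls_def pcompose_pCons)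
  then have G: "taylor_fls r G = fls_X * fps_to_fls g"
    unfolding G1 taylor_fls_hom by (simp add: h_g_def taylor_fls_def)
  have g0: "fps_nth g 0 \<noteq> 0" using assms dG nth by (simp add: h_g_def)
  have "h = (h * inverse g) * g" using g0 by (simp add: inverse_mult_eq_1 mult.assoc)
  then have "taylor_fls r H = fps_to_fls (h * inverse g) * fps_to_fls g"
    by (simp add: taylor_fls_def h_g_def fls_times_fps_to_fls[symmetric])
  moreover have "fps_to_fls g \<noteq> 0" using g0 by auto
  ultimately have "taylor_fls r H / taylor_fls r G = fps_to_fls (h * inverse g) / fls_X"
    by (simp add: G)
  also have "\<dots> = fls_shift 1 (fps_to_fls (h * inverse g))"
    by (simp add: divide_inverse fls_inverse_X fls_X_inv_times_conv_shift)
  finally have "fls_residue (taylor_fls r H / taylor_fls r G) = fps_nth (h * inverse g) 0" by simp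
  also have "\<dots> = poly H r / poly (pderiv G) r"
    by (simp add: nth h_g_def dG divide_inverse)
  finally show ?thesis .
qed

text \<open>Divided by \<open>G * N1 * N2 * T2^2\<close> the equation reads
  \<open>H/G = m N'/N + l T'\<close> with \<open>N = N1/N2\<close> and \<open>T = T1/T2\<close>. At
  \<open>r\<close> the left side has residue \<open>H(r)/G'(r)\<close>, a logarithmic derivative has
  the order of \<open>N\<close> at \<open>r\<close> as residue, and the derivative \<open>T'\<close>
  has none.\<close>

lemma residue_identity:
  fixes G H N1 N2 T1 T2 :: "'a::field_char_0 poly"
  assumes nz: "N1 \<noteq> 0" "N2 \<noteq> 0" "T2 \<noteq> 0" and G: "poly G r = 0" "poly (pderiv G) r \<noteq> 0"
    and eq: "H * N1 * N2 * T2\<^sup>2 =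
      G * (smult m (wronskian N1 N2) * T2\<^sup>2 + smult l (wronskian T1 T2) * N1 * N2)"
  obtains i :: int where "poly H r = of_int i * m * poly (pderiv G) r"
proof -
  let ?t = "taylor_fls r"
  have G0: "G \<noteq> 0" using G by auto
  have nz': "?t N1 \<noteq> 0" "?t N2 \<noteq> 0" "?t T2 \<noteq> 0" "?t G \<noteq> 0"
    using nz G0 by (simp_all add: taylor_fls_eq_0)
  define Q where "Q = ?t T1 / ?t T2"
  have "fls_deriv (Q * ?t T2) = fls_deriv Q * ?t T2 + Q * fls_deriv (?t T2)"
    by (simp add: algebra_simps)
  moreover have "Q * ?t T2 = ?t T1" using nz' by (simp add: Q_def)
  ultimately have Q: "fls_deriv Q = (fls_deriv (?t T1) * ?t T2 - ?t T1 * fls_deriv (?t T2)) / (?t T2)\<^sup>2"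
    using nz' by (simp add: Q_def field_simps power2_eq_square)
  have "?t H * ?t N1 * ?t N2 * (?t T2)\<^sup>2 =
    ?t G * (fls_const m * (fls_deriv (?t N1) * ?t N2 - ?t N1 * fls_deriv (?t N2)) * (?t T2)\<^sup>2 +
      fls_const l * (fls_deriv (?t T1) * ?t T2 - ?t T1 * fls_deriv (?t T2)) * ?t N1 * ?t N2)"
    using arg_cong[OF eq, of ?t] by (simp add: taylor_fls_hom taylor_fls_power wronskian_def)
  then have "?t H / ?t G = fls_const m * (fls_deriv (?t N1) / ?t N1) - fls_const m * (fls_deriv (?t N2) / ?t N2)
    + fls_const l * fls_deriv Q"
    unfolding Q using nz' by (simp add: field_simps power2_eq_square)
  then have "fls_residue (?t H / ?t G) = m * fls_residue (fls_deriv (?t N1) / ?t N1)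
    - m * fls_residue (fls_deriv (?t N2) / ?t N2) + l * fls_residue (fls_deriv Q)"
    by (simp del: times_divide_eq_right)
  then have "poly H r / poly (pderiv G) r = m * of_int (fls_subdegree (?t N1) - fls_subdegree (?t N2))"
    using nz' fls_residue_log_deriv[of "?t N1"] fls_residue_log_deriv[of "?t N2"]
    unfolding simple_pole_residue[OF G] fls_residue_deriv by (simp add: algebra_simps)
  then have "poly H r = of_int (fls_subdegree (?t N1) - fls_subdegree (?t N2)) * m * poly (pderiv G) r"
    using G(2) by (simp add: field_simps)
  then show ?thesis by (rule that)
qed

section \<open>Derivations with respect to a transcendental element\<close>

text \<open>\<open>d\<close> is differentiation with respect to \<open>u\<close> on
  \<open>k(u, \<theta>)\<close>, a finite extension of the rational function field
  \<open>k(u)\<close>.\<close>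

locale lifted_derivation =
  fixes k :: "'a::field_char_0 set" and u \<theta> :: 'a and d :: "'a \<Rightarrow> 'a"
  assumes k: "subfield k" "alg k = k" and u: "u \<notin> k" and \<theta>: "\<theta> \<in> alg (adj k u)"
    and d: "derivation_on (adj (adj k u) \<theta>) d"
    and d_k: "\<And>a. a \<in> k \<Longrightarrow> d a = 0" and d_u: "d u = 1"
begin

abbreviation "F \<equiv> adj k u"
abbreviation "K \<equiv> adj F \<theta>"

lemma F: "subfield F" by (rule subfield_adj[OF k(1)])
lemma K: "subfield K" by (rule subfield_adj[OF F])
lemma k_F: "k \<subseteq> F" by (rule adj_superset[OF k(1)])
lemma F_K: "F \<subseteq> K" by (rule adj_superset[OF F])
lemma k_K: "k \<subseteq> K" using k_F F_K by blast
lemma u_F: "u \<in> F" by (rule adj_gen[OF k(1)])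
lemma u_K: "u \<in> K" using u_F F_K by blast
lemma \<theta>_K: "\<theta> \<in> K" by (rule adj_gen[OF F])
lemma K_alg: "K \<subseteq> alg F" by (rule adj_minimal[OF subfield_alg[OF F] alg_superset[OF F] \<theta>])
lemma poly_K: "p \<in> polys k \<Longrightarrow> x \<in> K \<Longrightarrow> poly p x \<in> K"
  using polys_mono[OF k_K] by (auto intro: poly_in[OF K])
lemma d_poly: "p \<in> polys k \<Longrightarrow> d (poly p u) = poly (pderiv p) u"
  using derivation_poly_const[OF K d k_K u_K, of p] d_k d_u by simp
lemma trans: "x \<notin> k \<Longrightarrow> p \<in> polys k \<Longrightarrow> q \<in> polys k \<Longrightarrow> poly p x = poly q x \<Longrightarrow> p = q"
  using transcendental_eq[OF k(1)] k(2) by blast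
lemma poly_nz: "p \<in> polys k \<Longrightarrow> p \<noteq> 0 \<Longrightarrow> poly p u \<noteq> 0"
  using trans[OF u, of p 0] k(1) by (auto simp: polys_0)

lemma d_F: assumes "r \<in> F" shows "d r \<in> F"
proof (rule derivation_adj_stable[OF K d k(1) k_K u_K _ _ assms])
  show "d u \<in> F" using d_u F by (simp add: subfield_closed)
  show "d a \<in> F" if "a \<in> k" for a using d_k[OF that] F by (simp add: subfield_closed)
qed

lemma d_K: assumes "r \<in> K" shows "d r \<in> K"
proof (rule derivation_adj_stable[OF K d F F_K \<theta>_K _ _ assms])
  show "d \<theta> \<in> K" by (rule derivation_alg_stable[OF K d F F_K \<theta>_K \<theta> d_F])
  show "d a \<in> K" if "a \<in> F" for a using d_F[OF that] F_K by blast
qed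

lemma exchange_u: assumes "x \<in> K" "x \<notin> k" shows "u \<in> alg (adj k x)"
  using alg_adj_exchange[OF k(1)] assms K_alg k(2) by blast

text \<open>Were \<open>x\<close> outside \<open>k\<close>, then \<open>u\<close> would be algebraic
  over \<open>k(x)\<close>, where \<open>d\<close> vanishes, against \<open>d u = 1\<close>. So
  \<open>k\<close> is the full field of constants of \<open>d\<close> in \<open>K\<close>.\<close>

lemma d_eq_0: assumes x: "x \<in> K" "d x = 0" shows "x \<in> k"
proof (rule ccontr)
  assume "x \<notin> k"
  have sub: "adj k x \<subseteq> K" by (rule adj_minimal[OF K k_K x(1)])
  have "d u = 0"
    by (rule derivation_alg_zero[OF K d subfield_adj[OF k(1)] sub u_K exchange_u[OF x(1) \<open>x \<notin> k\<close>]])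
      (rule derivation_adj_zero[OF K d k_K x d_k])
  then show False using d_u by simp
qed

text \<open>Otherwise \<open>u\<close> is algebraic over \<open>k(z)\<close>, and the norm \<open>N\<close> of \<open>w\<close> in \<open>k(z)\<close> satisfies
  \<open>dN/dz = n N\<close> with \<open>n > 0\<close>, which is impossible for a nonzero rational function.\<close>

lemma exponential_in_k:
  assumes z: "z \<in> K" and w: "w \<in> K" "w \<noteq> 0" "d w = w * d z"
  shows "z \<in> k"
proof (rule ccontr)
  assume zk: "z \<notin> k"
  define \<zeta> where "\<zeta> = d z"
  have \<zeta>: "\<zeta> \<noteq> 0" "\<zeta> \<in> K" using d_eq_0[OF z] zk d_K[OF z] by (auto simp: \<zeta>_def)
  \<comment> \<open>Rescaling turns \<open>d\<close> into differentiation with respect to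
    \<open>z\<close>, under which \<open>k(z)\<close> is stable.\<close>
  define d' where "d' x = d x / \<zeta>" for x
  have d': "derivation_on K d'"
    unfolding derivation_on_def d'_def
    by (auto simp: derivation_add[OF K d] derivation_mult[OF K d] add_divide_distrib)
  define G where "G = adj k z"
  have G: "subfield G" "k \<subseteq> G" "z \<in> G" "G \<subseteq> K"
    unfolding G_def using k(1) by (auto simp: subfield_adj adj_gen intro: adj_superset[THEN subsetD]
        adj_minimal[OF K k_K z, THEN subsetD])
  have d'k: "d' a = 0" if "a \<in> k" for a using d_k[OF that] by (simp add: d'_def)
  have d'z: "d' z = 1" using \<zeta> by (simp add: d'_def \<zeta>_def)
  have d'G: "d' r \<in> G" if "r \<in> G" for r
    using derivation_adj_stable[OF K d' k(1) k_K z, of r] that d'k d'z G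
    unfolding G_def[symmetric] by (auto simp: subfield_closed)
  have "F \<subseteq> alg G"
    using exchange_u[OF z zk] G by (intro adj_minimal subfield_alg) (auto simp: G_def[symmetric] intro: alg_superset[THEN subsetD])
  then have wG: "w \<in> alg G" using K_alg w(1) alg_mono[of F "alg G"] alg_idem[OF G(1)] by auto
  \<comment> \<open>The exponential case \<open>l = 0\<close>, \<open>m = 1\<close>,
    \<open>g = 1\<close> of the trace identity, in which only the norm of \<open>w\<close>
    survives.\<close>
  have "(0 * w + 1) * d' w = 1 * w" using w(3) \<zeta> by (simp add: d'_def \<zeta>_def)
  then obtain n N T where n: "n \<ge> 1" "N \<in> G" "N \<noteq> 0" "of_nat n * 1 * N = 1 * d' N + 0 * N * d' T"
    using trace_identity[OF K d' G(1) G(4) d'G w(1) wG w(2)] subfield_closed(1,2)[OF G(1)] by metis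
  obtain p q where pq: "p \<in> polys k" "q \<in> polys k" "poly q z \<noteq> 0" "N = poly p z / poly q z"
    using n(2) unfolding G_def adj_def by blast
  have dN: "d' N = poly (wronskian p q) z / (poly q z)\<^sup>2"
    using derivation_poly_const[OF K d' k_K z _ d'k] pq d'z
    by (simp add: derivation_divide[OF K d'] poly_K z wronskian_def)
  have "of_nat n * (poly p z / poly q z) = poly (wronskian p q) z / (poly q z)\<^sup>2"
    using n(4) unfolding dN unfolding pq(4) by simp
  then have "of_nat n * (poly p z * poly q z) = poly (wronskian p q) z"
    using pq(3) by (simp add: field_simps power2_eq_square)
  then have "poly (smult (of_nat n) (p * q)) z = poly (wronskian p q) z" by simp
  then have eq: "smult (of_nat n) (p * q) = wronskian p q"
    using pq k(1) by (intro trans[OF zk])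
      (auto intro!: polys_closed wronskian_in_polys subfield_closed)
  have "p \<noteq> 0" "q \<noteq> 0" using pq n(3) by auto
  then have "degree (wronskian p q) = degree p + degree q" "wronskian p q \<noteq> 0"
    using n(1) by (simp_all add: eq[symmetric] degree_mult_eq)
  then show False using degree_wronskian[of p q] by simp
qed

end

text \<open>\<open>step\<close> is the proportionality of the forms: after division by \<theta> it
  says that \<open>l d\<theta> + m d\<theta>/\<theta>\<close> equals
  \<open>c H/G du\<close>.\<close>

locale lifted_step = lifted_derivation +
  fixes l m c :: 'a and G H :: "'a poly"
  assumes lm: "l \<in> k" "m \<in> k" and c: "c \<in> k" "c \<noteq> 0"
    and GH: "G \<in> polys k" "H \<in> polys k" "G \<noteq> 0" and \<theta>_nz: "\<theta> \<noteq> 0"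
    and step: "(l * \<theta> + m) * d \<theta> = c * (poly H u / poly G u) * \<theta>"
begin

text \<open>Since \<open>u\<close> is transcendental over \<open>k\<close>, the trace identity over
  \<open>k(u)\<close> can be read as an identity of polynomials, which can then be expanded at any
  point. The factor \<open>n\<close> comes from the degree of \<theta> over
  \<open>k(u)\<close>.\<close>

lemma trace_polys:
  obtains n N1 N2 T1 T2 where "n \<ge> 1" "N1 \<noteq> 0" "N2 \<noteq> 0" "T2 \<noteq> 0"
    "smult (of_nat n * c) H * N1 * N2 * T2\<^sup>2 =
      G * (smult m (wronskian N1 N2) * T2\<^sup>2 + smult l (wronskian T1 T2) * N1 * N2)"
proof -
  have g: "c * (poly H u / poly G u) \<in> F"
    using c(1) k_F GH F by (intro subfield_closed adj_poly k(1)) auto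
  obtain n N T where n: "n \<ge> 1" "N \<in> F" "N \<noteq> 0" "T \<in> F"
    "of_nat n * (c * (poly H u / poly G u)) * N = m * d N + l * N * d T"
    using trace_identity[OF K d F F_K d_F \<theta>_K \<theta> \<theta>_nz step] lm k_F g by blast
  obtain N1 N2 where N: "N1 \<in> polys k" "N2 \<in> polys k" "poly N2 u \<noteq> 0" "N = poly N1 u / poly N2 u"
    using n(2) unfolding adj_def by blast
  obtain T1 T2 where T: "T1 \<in> polys k" "T2 \<in> polys k" "poly T2 u \<noteq> 0" "T = poly T1 u / poly T2 u"
    using n(4) unfolding adj_def by blast
  have dN: "d N = poly (wronskian N1 N2) u / (poly N2 u)\<^sup>2" and dT: "d T = poly (wronskian T1 T2) u / (poly T2 u)\<^sup>2"
    using N T by (simp_all add: derivation_divide[OF K d] poly_K u_K d_poly wronskian_def)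
  have "poly (smult (of_nat n * c) H * N1 * N2 * T2\<^sup>2) u =
      poly (G * (smult m (wronskian N1 N2) * T2\<^sup>2 + smult l (wronskian T1 T2) * N1 * N2)) u"
  proof -
    have "of_nat n * (c * (poly H u / poly G u)) * (poly N1 u / poly N2 u) =
      m * (poly (wronskian N1 N2) u / (poly N2 u)\<^sup>2) +
      l * (poly N1 u / poly N2 u) * (poly (wronskian T1 T2) u / (poly T2 u)\<^sup>2)"
      using n(5) unfolding dN dT unfolding N(4) .
    then show ?thesis using poly_nz[OF GH(1,3)] N(3) T(3)
      by (simp add: field_simps power2_eq_square)
  qed
  then have "smult (of_nat n * c) H * N1 * N2 * T2\<^sup>2 =
      G * (smult m (wronskian N1 N2) * T2\<^sup>2 + smult l (wronskian T1 T2) * N1 * N2)"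
    using N T GH c lm k(1) by (intro trans[OF u])
      (auto intro!: polys_closed wronskian_in_polys subfield_closed)
  moreover have "N1 \<noteq> 0" "N2 \<noteq> 0" "T2 \<noteq> 0" using N T n(3) by auto
  ultimately show ?thesis using that n(1) by blast
qed

text \<open>By hypothesis \<open>n c H/G\<close> is \<open>n c V'\<close> plus the logarithmic
  derivative of \<open>f1/f2\<close>, and by the step \<open>c H/G\<close> is
  \<open>d \<theta> + d \<theta> / \<theta>\<close>. Hence \<open>w = f1 / (f2 \<theta>^n)\<close>
  satisfies \<open>d w = w * d z\<close> with \<open>z = n (\<theta> - c V)\<close>, and
  \<open>exponential_in_k\<close> puts \<open>z\<close>, and then \<open>w\<close>, into
  \<open>k\<close>.\<close>

lemma lambert_relation:
  assumes lm1: "l = 1" "m = 1" and n: "n \<ge> 1"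
    and V: "V \<in> polys k" and f: "f1 \<in> polys k" "f2 \<in> polys k" "f1 \<noteq> 0" "f2 \<noteq> 0"
    and eq: "smult (of_nat n * c) H * (f1 * f2) =
      G * (smult (of_nat n * c) (pderiv V) * (f1 * f2) + wronskian f1 f2)"
  obtains w s where "w \<noteq> 0" "f1 = smult w (f2 * (smult c V + [:s:]) ^ n)"
proof -
  define A B where "A = poly f1 u" "B = poly f2 u * \<theta> ^ n"
  define w z where "w = A / B" "z = of_nat n * (\<theta> - c * poly V u)"
  have nz: "poly f1 u \<noteq> 0" "poly f2 u \<noteq> 0" "poly G u \<noteq> 0" "A \<noteq> 0" "B \<noteq> 0"
    using f GH \<theta>_nz by (simp_all add: poly_nz A_B_def)
  have in_K: "c \<in> K" "poly V u \<in> K" "A \<in> K" "B \<in> K" "\<theta> ^ n \<in> K" "poly f2 u \<in> K"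
    using c k_K V f \<theta>_K K by (auto simp: A_B_def poly_K u_K intro!: subfield_closed)
  have wz_K: "w \<in> K" "z \<in> K" using in_K \<theta>_K K by (auto simp: w_z_def intro!: subfield_closed)
  define g where "g = c * (poly H u / poly G u)"
  have d\<theta>: "(\<theta> + 1) * d \<theta> = g * \<theta>" using step lm1 by (simp add: g_def)
  have "poly (smult (of_nat n * c) H * (f1 * f2)) u =
     poly (G * (smult (of_nat n * c) (pderiv V) * (f1 * f2) + wronskian f1 f2)) u"
    by (simp only: eq)
  then have ng: "of_nat n * g = of_nat n * c * poly (pderiv V) u + poly (wronskian f1 f2) u / (poly f1 u * poly f2 u)"
    using nz by (simp add: g_def field_simps)
  have dz: "d z = of_nat n * d \<theta> - of_nat n * c * poly (pderiv V) u"
  proof -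
    have "d z = of_nat n * d (\<theta> - c * poly V u)"
      unfolding w_z_def using in_K \<theta>_K K
      by (subst derivation_mult[OF K d]) (auto simp: derivation_of_nat[OF K d] intro!: subfield_closed)
    also have "d (\<theta> - c * poly V u) = d \<theta> - c * poly (pderiv V) u"
      using in_K \<theta>_K K c V d_k
      by (subst derivation_diff[OF K d]) (auto simp: derivation_mult[OF K d] d_poly intro!: subfield_closed)
    finally show ?thesis by (simp add: algebra_simps)
  qed
  have dB: "d B * \<theta> = \<theta> ^ n * (poly (pderiv f2) u * \<theta> + of_nat n * poly f2 u * d \<theta>)"
    using derivation_power[OF K d \<theta>_K, of n] in_K f
    by (simp add: A_B_def derivation_mult[OF K d] d_poly algebra_simps)
  have dA: "d A = poly (pderiv f1) u" using f by (simp add: A_B_def d_poly)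
  have dw: "d w = w * (poly (wronskian f1 f2) u / (poly f1 u * poly f2 u) - of_nat n * d \<theta> / \<theta>)"
  proof -
    have "d B = \<theta> ^ n * (poly (pderiv f2) u * \<theta> + of_nat n * poly f2 u * d \<theta>) / \<theta>"
      using dB \<theta>_nz by (simp add: field_simps)
    then have "d w = (poly (pderiv f1) u * B - A * (\<theta> ^ n * (poly (pderiv f2) u * \<theta> + of_nat n * poly f2 u * d \<theta>) / \<theta>)) / B\<^sup>2"
      using in_K nz dA by (simp add: w_z_def derivation_divide[OF K d])
    also have "\<dots> = w * (poly (wronskian f1 f2) u / (poly f1 u * poly f2 u) - of_nat n * d \<theta> / \<theta>)"
      using nz \<theta>_nz unfolding w_z_def A_B_def wronskian_def
      by (simp add: field_simps power2_eq_square)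
    finally show ?thesis .
  qed
  have "d w = w * d z"
  proof -
    have "g = d \<theta> + d \<theta> / \<theta>" using d\<theta> \<theta>_nz by (simp add: field_simps)
    then have "of_nat n * d \<theta> / \<theta> = of_nat n * g - of_nat n * d \<theta>" by (simp add: algebra_simps)
    then show ?thesis unfolding dw dz ng by simp
  qed
  moreover have w0: "w \<noteq> 0" using nz by (simp add: w_z_def)
  ultimately have zk: "z \<in> k" using exponential_in_k wz_K by blast
  then have "d w = 0" using \<open>d w = w * d z\<close> d_k by simp
  then have wk: "w \<in> k" using d_eq_0 wz_K by blast
  define s where "s = z / of_nat n"
  have sk: "s \<in> k" using zk k(1) by (auto simp: s_def intro!: subfield_closed)
  have "\<theta> = c * poly V u + s" using n by (simp add: s_def w_z_def)
  moreover have "poly f1 u = w * (poly f2 u * \<theta> ^ n)"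
    using nz by (simp add: w_z_def) (simp add: A_B_def)
  ultimately have "poly f1 u = poly (smult w (f2 * (smult c V + [:s:]) ^ n)) u" by simp
  then have "f1 = smult w (f2 * (smult c V + [:s:]) ^ n)"
    using f V wk sk c k(1) by (intro trans[OF u]) (auto intro!: polys_closed)
  then show ?thesis using that w0 by blast
qed

end

section \<open>Differential fields and the passage from D to differentiation along u\<close>

locale diff_field =
  fixes D :: "'a::field_char_0 \<Rightarrow> 'a"
  assumes D: "derivation_on UNIV D"
begin

lemma subfield_UNIV: "subfield UNIV" by (simp add: subfield_def)

lemmas D_rules = derivation_add[OF subfield_UNIV D, simplified]
  derivation_mult[OF subfield_UNIV D, simplified] derivation_0[OF subfield_UNIV D]
  derivation_1[OF subfield_UNIV D] derivation_diff[OF subfield_UNIV D, simplified]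
  derivation_uminus[OF subfield_UNIV D, simplified] derivation_of_nat[OF subfield_UNIV D]
  derivation_divide[OF subfield_UNIV D, simplified]

definition constants :: "'a set" where
  "constants = {c. D c = 0}"

lemma subfield_constants: "subfield constants"
proof -
  have "D (inverse x) = 0" if "D x = 0" for x
    using that derivation_divide[OF subfield_UNIV D, of 1 x]
    by (cases "x = 0") (simp_all add: D_rules inverse_eq_divide)
  then show ?thesis unfolding subfield_def constants_def by (auto simp: D_rules)
qed

lemma alg_constants: "alg constants = constants"
proof
  show "alg constants \<subseteq> constants"
  proof
    fix x assume "x \<in> alg constants"
    then have "D x = 0"
      by (rule derivation_alg_zero[OF subfield_UNIV D subfield_constants subset_UNIV UNIV_I])
        (simp add: constants_def)
    then show "x \<in> constants" by (simp add: constants_def)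
  qed
qed (rule alg_superset[OF subfield_constants])

text \<open>The derivation \<open>\<partial>/\<partial>u\<close> of \<open>k(u)\<close> extends to \<open>k(u)(\<theta>)\<close>, where it commutes with \<open>D\<close> up to
  a factor. Hence \<open>(l + m/\<theta>) \<partial>\<theta>/\<partial>u\<close> and the inverse of \<open>D u\<close> have the same logarithmic derivative.\<close>

lemma lifted_step_exists:
  assumes k: "subfield k" "alg k = k" "\<And>a. a \<in> k \<Longrightarrow> D a \<in> k" "constants \<subseteq> k"
    and u: "u \<notin> k" "u \<in> alg (adj k \<theta>)"
    and GH: "G \<in> polys constants" "H \<in> polys constants" "poly G u \<noteq> 0" "poly H u \<noteq> 0"
      "D u = poly G u / poly H u"
    and lm: "l \<in> constants" "m \<in> constants" "l \<noteq> 0 \<or> m \<noteq> 0"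
    and g: "g \<in> k" "(l * \<theta> + m) * D \<theta> = g * \<theta>"
  obtains d c where "lifted_step k u \<theta> d l m c G H"
proof -
  define F where "F = adj k u"
  define K where "K = adj F \<theta>"
  have F: "subfield F" "k \<subseteq> F" "u \<in> F"
    using subfield_adj[OF k(1)] adj_superset[OF k(1)] adj_gen[OF k(1)] by (auto simp: F_def)
  have \<theta>k: "\<theta> \<notin> k"
  proof
    assume "\<theta> \<in> k"
    then have "alg (adj k \<theta>) \<subseteq> alg k" by (intro alg_mono adj_minimal k order_refl)
    then show False using u k by auto
  qed
  have "u \<notin> alg k" using u k by simp
  then have \<theta>: "\<theta> \<in> alg F" unfolding F_def using alg_adj_exchange[OF k(1)] u by blast
  have K: "subfield K" "F \<subseteq> K" "\<theta> \<in> K"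
    using subfield_adj[OF F(1)] adj_superset[OF F(1)] adj_gen[OF F(1)] by (auto simp: K_def)
  have kK: "k \<subseteq> K" and uK: "u \<in> K" using F K by auto
  have "derivation_on k (\<lambda>_. 0)" by (simp add: derivation_on_def)
  then obtain d0 where d0: "derivation_on F d0" "\<And>a. a \<in> k \<Longrightarrow> d0 a = 0" "d0 u = 1"
    using derivation_extend_transcendental[OF k(1), of "\<lambda>_. 0" u 1] \<open>u \<notin> alg k\<close>
    unfolding F_def by metis
  obtain d where d: "derivation_on K d" "\<And>a. a \<in> F \<Longrightarrow> d a = d0 a"
    using derivation_extend_algebraic[OF F(1) d0(1) \<theta>] unfolding K_def by metis
  have dk: "d a = 0" if "a \<in> k" for a using d(2) d0(2) F that by auto
  have du: "d u = 1" using d(2) d0(3) F by simp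
  interpret L: lifted_derivation k u \<theta> d
    by unfold_locales (use k u \<theta> d dk du in \<open>auto simp: F_def K_def\<close>)
  have FK_eq: "adj k u = F" "adj F \<theta> = K" by (simp_all add: F_def K_def)
  define h where "h = l * \<theta> + m"
  have lmk: "l \<in> k" "m \<in> k" using lm(1,2) k(4) by blast+
  have h0: "h \<noteq> 0"
  proof
    assume "h = 0"
    show False
    proof (cases "l = 0")
      case True
      then show ?thesis using \<open>h = 0\<close> lm by (simp add: h_def)
    next
      case False
      then have "\<theta> = - m / l" using \<open>h = 0\<close> by (simp add: h_def field_simps eq_neg_iff_add_eq_0)
      then have "\<theta> \<in> k" using lmk k(1) by (auto intro: subfield_closed)
      then show ?thesis using \<theta>k by simp
    qed
  qed
  have \<theta>0: "\<theta> \<noteq> 0" using \<theta>k k(1) subfield_closed(1) by auto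
  have D\<theta>: "D \<theta> = g * \<theta> / h" using g h0 by (simp add: h_def field_simps)
  have GHk: "G \<in> polys k" "H \<in> polys k" using GH polys_mono[OF k(4)] by auto
  have DuF: "D u \<in> F"
    unfolding GH(5) FK_eq(1)[symmetric] using GHk GH by (intro adjI)
  have D_F: "D r \<in> F" if "r \<in> F" for r
  proof -
    have "D r \<in> adj k u"
      by (rule derivation_adj_stable[OF subfield_UNIV D k(1)])
        (use DuF k(3) F(2) that in \<open>auto simp: F_def[symmetric]\<close>)
    then show ?thesis by (simp add: F_def)
  qed
  have D\<theta>K: "D \<theta> \<in> K"
    unfolding D\<theta> h_def using K kK g lmk by (auto intro!: subfield_closed)
  have D_K: "D r \<in> K" if "r \<in> K" for r
  proof -
    have "D r \<in> adj F \<theta>"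
      by (rule derivation_adj_stable[OF subfield_UNIV D F(1)])
        (use D\<theta>K D_F K(2) that in \<open>auto simp: K_def[symmetric]\<close>)
    then show ?thesis by (simp add: K_def)
  qed
  have d_K': "d r \<in> K" if "r \<in> K" for r using L.d_K[of r] that by (simp add: FK_eq)
  define R' where "R' = d (D u)"
  have DuK: "D u \<in> K" using DuF K by auto
  \<comment> \<open>A commutator of derivations is a derivation, and the last term corrects its
    value at \<open>u\<close>. As \<open>E\<close> kills \<open>k\<close> and \<open>u\<close>, it
    kills everything algebraic over \<open>k(u)\<close>, in particular \<theta>.\<close>
  define E where "E x = D (d x) - d (D x) + R' * d x" for x
  have E: "derivation_on K E"
    unfolding derivation_on_def
  proof safe
    fix x y assume xy: "x \<in> K" "y \<in> K"
    show "E (x + y) = E x + E y"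
      using xy by (simp add: E_def D_rules derivation_add[OF K(1) d(1)] D_K algebra_simps)
    show "E (x * y) = E x * y + x * E y"
      using xy K(1)
      by (simp add: E_def D_rules derivation_add[OF K(1) d(1)] derivation_mult[OF K(1) d(1)] D_K
          subfield_closed algebra_simps)
  qed
  have Ek: "E a = 0" if "a \<in> k" for a
    using that dk k(3) by (simp add: E_def D_rules)
  have Eu: "E u = 0" by (simp add: E_def du D_rules R'_def)
  have EF: "E a = 0" if "a \<in> F" for a
    using derivation_adj_zero[OF K(1) E kK uK Eu Ek, of a] that by (simp add: F_def)
  have E\<theta>: "E \<theta> = 0"
    by (rule derivation_alg_zero[OF K(1) E F(1) K(2) K(3) \<theta> EF])
  then have Dd\<theta>: "D (d \<theta>) = d (D \<theta>) - R' * d \<theta>" by (simp add: E_def algebra_simps)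
  \<comment> \<open>\<open>D u\<close> is a rational function of \<open>u\<close> whose coefficients
    are constants of \<open>D\<close>, so \<open>D\<close> acts on it through its derivative with
    respect to \<open>u\<close>.\<close>
  have DDu: "D (D u) = R' * D u"
  proof -
    have Dp: "D (poly p u) = poly (pderiv p) u * D u" if "p \<in> polys constants" for p
      by (rule derivation_poly_const[OF subfield_UNIV D _ _ that]) (auto simp: constants_def)
    have dp: "d (poly p u) = poly (pderiv p) u" if "p \<in> polys constants" for p
      using L.d_poly that polys_mono[OF k(4)] by auto
    have "poly G u \<in> K" "poly H u \<in> K" using L.poly_K[OF _ L.u_K] GHk by (auto simp: FK_eq)
    then show ?thesis unfolding R'_def GH(5)
      using GH by (simp add: derivation_divide[OF K(1) d(1)] D_rules Dp dp)
        (simp add: GH(5) field_simps power2_eq_square)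
  qed
  \<comment> \<open>The quotient of the forms \<open>l d\<theta> + m d\<theta>/\<theta>\<close> and
    \<open>H/G du\<close>, with \<open>D u\<close> in place of \<open>G/H\<close>.\<close>
  define c where "c = h * d \<theta> * D u / \<theta>"
  have Dl: "D l = 0" "D m = 0" using lm by (auto simp: constants_def)
  have Dh: "D h = l * D \<theta>" by (simp add: h_def D_rules Dl)
  have dh: "d h = l * d \<theta>"
    unfolding h_def using lmk kK K
    by (subst derivation_add[OF K(1) d(1)])
      (auto simp: derivation_mult[OF K(1) d(1)] dk intro!: subfield_closed)
  have hK: "h \<in> K" unfolding h_def using K kK lmk by (auto intro!: subfield_closed)
  \<comment> \<open>\<open>d\<close> is applied to the defining equation of \<theta>; the
    coefficient \<open>g\<close> lies in \<open>k\<close> and has derivative 0.\<close>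
  have dhD: "l * d \<theta> * D \<theta> + h * d (D \<theta>) = g * d \<theta>"
  proof -
    have "d (h * D \<theta>) = d (g * \<theta>)" using g by (simp add: h_def)
    then show ?thesis using g kK K hK D\<theta>K
      by (simp add: derivation_mult[OF K(1) d(1)] subset_iff dk dh)
  qed
  have c\<theta>: "c * \<theta> = h * d \<theta> * D u" using \<theta>0 by (simp add: c_def)
  have "D (c * \<theta>) = D u * (l * d \<theta> * D \<theta> + h * d (D \<theta>))"
    unfolding c\<theta> by (simp add: D_rules Dh Dd\<theta> DDu algebra_simps)
  also have "\<dots> = D u * g * d \<theta>" by (simp add: dhD)
  also have "\<dots> = c * D \<theta>" unfolding D\<theta> c_def using h0 \<theta>0 by simp
  finally have "D c * \<theta> = 0" by (simp add: D_rules)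
  then have Dc: "D c = 0" using \<theta>0 by simp
  have "d \<theta> \<noteq> 0" using L.d_eq_0[of \<theta>] \<theta>k K by (auto simp: FK_eq)
  then have c0: "c \<noteq> 0" using h0 \<theta>0 GH by (simp add: c_def)
  have "(l * \<theta> + m) * d \<theta> = c * (poly H u / poly G u) * \<theta>"
    using c\<theta> GH by (simp add: h_def field_simps)
  then have "lifted_step k u \<theta> d l m c G H"
    by unfold_locales (use lmk c0 GHk GH \<theta>0 Dc k(4) in \<open>auto simp: constants_def\<close>)
  then show ?thesis by (rule that)
qed

end

section \<open>Degrees, multiplicities and logarithmic derivatives around X^a - 1\<close>

abbreviation "XX \<equiv> [:0, 1:]"

lemma X_power_minus_1:
  fixes a :: nat
  assumes "a \<ge> 1"
  shows "degree (XX ^ a - 1 :: 'a::field_char_0 poly) = a" "(XX ^ a - 1 :: 'a poly) \<noteq> 0"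
proof -
  have "XX ^ a - 1 = XX ^ a + (- 1 :: 'a poly)" by simp
  moreover have "degree (XX ^ a + (- 1 :: 'a poly)) = degree (XX ^ a :: 'a poly)"
    using assms by (intro degree_add_eq_left) (simp add: degree_power_eq)
  ultimately show "degree (XX ^ a - 1 :: 'a poly) = a" by (simp add: degree_power_eq)
  with assms show "(XX ^ a - 1 :: 'a poly) \<noteq> 0" by (metis degree_0 not_one_le_zero)
qed

text \<open>The root 1 of \<open>W\<close> is simple, because the derivative of \<open>W\<close>
  there is \<open>b * e\<close>. Comparing multiplicity at 1 and degree on both sides leaves
  \<open>W\<close> linear, so the sum has a single term.\<close>

lemma power_linear_relation:
  fixes W :: "'a::field_char_0 poly"
  assumes "[:-1, 1:] ^ i = smult w (W ^ n)" "i \<ge> 1" "n \<ge> 1"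
    and W': "pderiv W = smult b (\<Sum>j<e. XX ^ j)" "b \<noteq> 0"
  shows "e = 1"
proof -
  have w: "w \<noteq> 0" using assms(1) by auto
  have "poly ([:-1, 1:] ^ i) 1 = w * poly W 1 ^ n" using assms(1) by simp
  then have "poly W 1 = 0" using assms(2) w by (simp add: zero_power)
  then obtain W1 where W1: "W = [:-1, 1:] * W1" using poly_eq_0_iff_dvd by (metis dvdE)
  have "([:-1, 1:] :: 'a poly) ^ i \<noteq> 0" by simp
  then have W10: "W1 \<noteq> 0" using assms(1) W1 assms(3) by (auto simp: zero_power)
  have e0: "e \<noteq> 0"
  proof
    assume "e = 0"
    then have "pderiv W = 0" using W' by simp
    then have "degree W = 0" by (simp add: pderiv_eq_0_iff)
    then show False using W1 W10 by (simp add: degree_mult_eq del: mult_pCons_left)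
  qed
  have "poly (pderiv W) 1 = poly W1 1"
    unfolding W1 pderiv_mult by (simp add: pderiv_pCons)
  then have W11: "poly W1 1 \<noteq> 0" using W' e0 by (simp add: poly_sum flip: \<open>poly (pderiv W) 1 = poly W1 1\<close>)
  have eq: "[:-1, 1:] ^ i = smult w ([:-1, 1:] ^ n * W1 ^ n)"
    using assms(1) by (simp add: W1 power_mult_distrib del: mult_pCons_left)
  have "i \<le> n"
  proof (rule ccontr)
    assume "\<not> i \<le> n"
    then obtain j where j: "i = n + Suc j" by (metis less_imp_Suc_add not_le add_Suc_right)
    have "[:-1, 1:] ^ n * [:-1, 1:] ^ Suc j = [:-1, 1:] ^ n * smult w (W1 ^ n)"
      using eq unfolding j power_add by simp
    then have "[:-1, 1:] ^ Suc j = smult w (W1 ^ n)" by (subst (asm) mult_cancel_left) auto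
    then have "poly ([:-1, 1:] ^ Suc j) 1 = poly (smult w (W1 ^ n)) 1" by (rule arg_cong)
    then show False using W11 w by simp
  qed
  have "degree ([:-1, 1:] ^ i :: 'a poly) = degree (smult w ([:-1, 1:] ^ n * W1 ^ n))"
    by (simp only: eq)
  then have "i = n + n * degree W1" using w W10 by (simp add: degree_mult_eq degree_power_eq)
  then have "degree W1 = 0" using \<open>i \<le> n\<close> assms(3) by simp
  then have "degree (pderiv W) = 0"
    using W1 by (simp add: degree_pderiv degree_mult_eq W10 del: mult_pCons_left)
  then have c0: "coeff (pderiv W) j = 0" if "j > 0" for j using that by (intro coeff_eq_0) simp
  have "coeff (pderiv W) (e - 1) = b"
    using e0 by (simp add: W' coeff_sum monom_altdef[of 1, simplified, symmetric])
  then have "e - 1 = 0" using c0[of "e - 1"] W' by fastforce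
  then show ?thesis using e0 by simp
qed

lemma pderiv_sum: "pderiv (sum f A) = (\<Sum>x\<in>A. pderiv (f x))"
  by (induction A rule: infinite_finite_induct) (auto simp: pderiv_add)

text \<open>Up to constants, the function with logarithmic derivative \<open>i a / (X^a - 1)\<close>
  is \<open>(X - 1)^i\<close> for \<open>a = 1\<close> and \<open>((X - 1)/(X + 1))^i\<close> for
  \<open>a = 2\<close>; the sign of \<open>i\<close> decides which factor is \<open>f1\<close>. In
  the last clause \<open>f1/f2\<close> is a multiple of the polynomial \<open>W ^ n\<close> and has
  no pole, so evaluating at a zero of \<open>f2\<close> excludes every case but
  \<open>(X - 1)^i\<close> with \<open>i > 0\<close>.\<close>

lemma log_derivative_polys:
  fixes i :: int and a :: nat
  assumes "a = 1 \<or> a = 2" "i \<noteq> 0" and F: "subfield F"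
  obtains f1 f2 :: "'a::field_char_0 poly" where
    "f1 \<in> polys F" "f2 \<in> polys F" "f1 \<noteq> 0" "f2 \<noteq> 0"
    "(XX ^ a - 1) * wronskian f1 f2 = smult (of_int i * of_nat a) (f1 * f2)"
    "\<And>w W n. n \<ge> 1 \<Longrightarrow> f1 = smult w (f2 * W ^ n) \<Longrightarrow> a = 1 \<and> i > 0 \<and> f1 = [:-1,1:] ^ nat i \<and> f2 = 1"
proof -
  let ?p = "[:-1,1:] :: 'a poly" and ?q = "[:1,1:] :: 'a poly"
  have pol: "?p \<in> polys F" "?q \<in> polys F" using F by (auto simp: polys_0 subfield_closed)
  have nz: "?p ^ j \<noteq> 0" "?q ^ j \<noteq> 0" for j by auto
  define j where "j = nat \<bar>i\<bar>"
  obtain j' where j': "j = Suc j'" using assms(2) by (cases j) (auto simp: j_def)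
  have dp: "pderiv (?p ^ j) = smult (of_nat j) (?p ^ j')" "pderiv (?q ^ j) = smult (of_nat j) (?q ^ j')"
    unfolding j' by (simp_all only: pderiv_power_Suc) (simp_all add: pderiv_pCons)
  show ?thesis
  proof (cases "a = 1")
    case True
    have X: "XX ^ a - 1 = ?p" using True by (simp add: one_pCons)
    show ?thesis
    proof (cases "i > 0")
      case i: True
      then have ij: "i = int j" "nat i = j" by (auto simp: j_def)
      show ?thesis
      proof (rule that[of "?p ^ j" 1])
        show "(XX ^ a - 1) * wronskian (?p ^ j) 1 = smult (of_int i * of_nat a) (?p ^ j * 1)"
          unfolding X wronskian_def dp by (simp add: True ij j' pderiv_1)
      qed (use True i ij pol F in \<open>auto simp: polys_closed\<close>)
    next
      case i: False
      then have ij: "i = - int j" by (auto simp: j_def)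
      show ?thesis
      proof (rule that[of 1 "?p ^ j"])
        show "(XX ^ a - 1) * wronskian 1 (?p ^ j) = smult (of_int i * of_nat a) (1 * ?p ^ j)"
        proof -
          have "of_int i * of_nat a = (- of_nat j :: 'a)" using True ij by simp
          then show ?thesis
            unfolding X wronskian_def dp by (simp add: j' pderiv_1 del: of_nat_Suc)
        qed
      next
        fix w :: 'a and W and n :: nat assume "1 = smult w (?p ^ j * W ^ n)"
        then have "poly 1 1 = poly (smult w (?p ^ j * W ^ n)) 1" by simp
        then show "a = 1 \<and> i > 0 \<and> 1 = [:-1,1:] ^ nat i \<and> ?p ^ j = 1" by (simp add: j')
      qed (use pol F in \<open>auto simp: polys_closed\<close>)
    qed
  next
    case False
    then have a: "a = 2" using assms by auto
    have X: "XX ^ a - 1 = ?p * ?q" by (simp add: a power2_eq_square one_pCons)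
    have W: "wronskian (?p ^ j) (?q ^ j) = smult (2 * of_nat j) (?p ^ j' * ?q ^ j')"
    proof -
      have "wronskian (?p ^ j) (?q ^ j) = smult (of_nat j) (?p ^ j' * ?q ^ j') * (?q - ?p)"
      proof -
        have "smult b r * (Q * s) - P * r * smult b s = smult b (r * s) * (Q - P)"
          for b and P Q r s :: "'a poly" by (simp add: algebra_simps smult_diff_right)
        then show ?thesis unfolding wronskian_def dp unfolding j' power_Suc .
      qed
      then show ?thesis by (simp add: mult.commute)
    qed
    have W': "wronskian (?q ^ j) (?p ^ j) = smult (- 2 * of_nat j) (?p ^ j' * ?q ^ j')"
    proof -
      have "wronskian (?q ^ j) (?p ^ j) = - wronskian (?p ^ j) (?q ^ j)"
        by (simp add: wronskian_def mult.commute)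
      then show ?thesis by (simp add: W)
    qed
    show ?thesis
    proof (cases "i > 0")
      case True
      then have ij: "i = int j" by (auto simp: j_def)
      show ?thesis
      proof (rule that[of "?p ^ j" "?q ^ j"])
        show "(XX ^ a - 1) * wronskian (?p ^ j) (?q ^ j) = smult (of_int i * of_nat a) (?p ^ j * ?q ^ j)"
          unfolding X W by (simp add: a ij j' mult_ac del: mult_pCons_left mult_pCons_right)
      next
        fix w :: 'a and W and n :: nat assume "?p ^ j = smult w (?q ^ j * W ^ n)"
        then have "poly (?p ^ j) (-1) = poly (smult w (?q ^ j * W ^ n)) (-1)" by simp
        then show "a = 1 \<and> i > 0 \<and> ?p ^ j = [:-1,1:] ^ nat i \<and> ?q ^ j = 1" by (simp add: j')
      qed (use pol F nz in \<open>auto simp: polys_closed\<close>)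
    next
      case False
      then have ij: "i = - int j" by (auto simp: j_def)
      show ?thesis
      proof (rule that[of "?q ^ j" "?p ^ j"])
        show "(XX ^ a - 1) * wronskian (?q ^ j) (?p ^ j) = smult (of_int i * of_nat a) (?q ^ j * ?p ^ j)"
          unfolding X W' by (simp add: a ij j' mult_ac del: mult_pCons_left mult_pCons_right)
      next
        fix w :: 'a and W and n :: nat assume "?q ^ j = smult w (?p ^ j * W ^ n)"
        then have "poly (?q ^ j) 1 = poly (smult w (?p ^ j * W ^ n)) 1" by simp
        then show "a = 1 \<and> i > 0 \<and> ?q ^ j = [:-1,1:] ^ nat i \<and> ?p ^ j = 1" by (simp add: j')
      qed (use pol F nz in \<open>auto simp: polys_closed\<close>)
    qed
  qed
qed

section \<open>Towers of logarithmic, exponential and Lambert extensions\<close>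

context diff_field
begin

text \<open>The first claim is the rationality of \<open>\<rho> ^ (e + 1)\<close>, written without
  division. The second is conditional: its premise follows from the first claim and coprimality once
  complex roots of unity are at hand, in \<open>closed_form_power_ode\<close>.\<close>

lemma power_ode_step:
  fixes a e :: nat
  assumes k: "subfield k" "alg k = k" "\<And>a. a \<in> k \<Longrightarrow> D a \<in> k" "constants \<subseteq> k"
    and u: "u \<notin> k" "u \<in> alg (adj k \<theta>)"
    and ode: "u ^ e * D u = \<kappa> * (u ^ a - 1)" and \<kappa>: "D \<kappa> = 0" "\<kappa> \<noteq> 0" and a: "a \<ge> 1"
    and lm: "l = 0 \<and> m = 1 \<or> l = 1 \<and> m = 0 \<or> l = 1 \<and> m = 1"
    and g: "g \<in> k" "(l * \<theta> + m) * D \<theta> = g * \<theta>"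
  shows "\<And>\<rho>::'a. \<rho> ^ a = 1 \<Longrightarrow> \<exists>i j::int. j \<noteq> 0 \<and> of_int j * \<rho> ^ (e + 1) = of_int i"
    and "a = 1 \<or> a = 2 \<and> even e \<Longrightarrow> e < a \<or> l = 1 \<and> m = 1 \<and> a = 1 \<and> e = 1"
proof -
  define G H where "G = smult \<kappa> (XX ^ a - 1)" "H = (XX ^ e :: 'a poly)"
  have C: "subfield constants" "\<kappa> \<in> constants" using \<kappa> subfield_constants by (auto simp: constants_def)
  have u0: "u \<noteq> 0" using u(1) k(1) subfield_closed(1) by blast
  have ua: "u ^ a \<noteq> 1"
  proof
    assume "u ^ a = 1"
    then have "poly (XX ^ a - 1) u = 0" by simp
    moreover have "XX ^ a - 1 \<in> polys k" using k(1) by (auto intro!: polys_closed simp: subfield_closed)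
    ultimately have "u \<in> alg k" using X_power_minus_1(2)[OF a, where 'a='a] unfolding alg_def by blast
    then show False using u k(2) by simp
  qed
  have GH: "G \<in> polys constants" "H \<in> polys constants" "poly G u \<noteq> 0" "poly H u \<noteq> 0"
      "D u = poly G u / poly H u"
    using C ua u0 \<kappa> ode
    by (auto simp: G_H_def field_simps intro!: polys_closed subfield_closed)
  have "l \<in> constants" "m \<in> constants" "l \<noteq> 0 \<or> m \<noteq> 0"
    using lm subfield_closed(1,2)[OF C(1)] by auto
  then obtain d c where "lifted_step k u \<theta> d l m c G H"
    using lifted_step_exists[OF k u GH _ _ _ g] by metis
  then interpret L: lifted_step k u \<theta> d l m c G H .
  obtain n N1 N2 T1 T2 where n: "n \<ge> 1" "N1 \<noteq> 0" "N2 \<noteq> 0" "T2 \<noteq> 0"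
    and id: "smult (of_nat n * c) H * N1 * N2 * T2\<^sup>2 =
      G * (smult m (wronskian N1 N2) * T2\<^sup>2 + smult l (wronskian T1 T2) * N1 * N2)"
    by (rule L.trace_polys)
  have nc: "of_nat n * c \<noteq> 0" using n L.c by simp
  \<comment> \<open>The residue at \<rho>. Multiplication by \<rho> turns the power
    \<open>\<rho>^(a-1)\<close> in the derivative of \<open>G\<close> into
    \<open>\<rho>^a = 1\<close>.\<close>
  have res: "\<exists>i::int. of_nat n * c * \<rho> ^ (e + 1) = of_int i * m * \<kappa> * of_nat a" if \<rho>: "\<rho> ^ a = 1" for \<rho> :: 'a
  proof -
    obtain a' where a': "a = Suc a'" using a by (cases a) auto
    have \<rho>0: "\<rho> \<noteq> 0" using \<rho> a by (auto simp: zero_power)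
    have dG: "poly (pderiv G) \<rho> = \<kappa> * (of_nat a * \<rho> ^ a')"
      unfolding G_H_def a' pderiv_smult pderiv_diff pderiv_power_Suc
      by (simp add: pderiv_pCons pderiv_1)
    then have "poly G \<rho> = 0" "poly (pderiv G) \<rho> \<noteq> 0"
      using \<rho> \<rho>0 \<kappa> a by (auto simp: G_H_def)
    from residue_identity[OF n(2-4) this id] obtain i :: int where
      "poly (smult (of_nat n * c) H) \<rho> = of_int i * m * poly (pderiv G) \<rho>" by blast
    then have "of_nat n * c * \<rho> ^ e = of_int i * m * (\<kappa> * (of_nat a * \<rho> ^ a'))"
      unfolding dG by (simp add: G_H_def)
    then have "of_nat n * c * \<rho> ^ e * \<rho> = of_int i * m * (\<kappa> * (of_nat a * \<rho> ^ a')) * \<rho>" by simp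
    also have "\<dots> = of_int i * m * \<kappa> * of_nat a * \<rho> ^ a" by (simp add: a')
    finally show ?thesis using \<rho> by (auto simp: mult_ac)
  qed
  \<comment> \<open>At \<open>\<rho> = 1\<close> the residue is nonzero. This rules out
    \<open>m = 0\<close>, so \<open>u\<close> does not enter by a logarithm, and it fixes the scale
    \<open>n c = i \<kappa> a\<close> against which the other residues are rational.\<close>
  obtain i :: int where i: "of_nat n * c = of_int i * m * \<kappa> * of_nat a"
    using res[of 1] by auto
  then have i0: "i \<noteq> 0" "m \<noteq> 0" using nc by auto
  then have m1: "m = 1" using lm by auto
  show "\<exists>i j::int. j \<noteq> 0 \<and> of_int j * \<rho> ^ (e + 1) = of_int i" if \<rho>: "\<rho> ^ a = 1" for \<rho> :: 'a
  proof -
    obtain i' :: int where "of_nat n * c * \<rho> ^ (e + 1) = of_int i' * m * \<kappa> * of_nat a"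
      using res[OF \<rho>] by blast
    then have "of_int i * \<rho> ^ (e + 1) * (\<kappa> * of_nat a) = of_int i' * (\<kappa> * of_nat a)"
      unfolding i m1 by (simp add: mult_ac)
    then have "of_int i * \<rho> ^ (e + 1) = of_int i'"
      using \<kappa> a by (subst (asm) mult_right_cancel) auto
    then show ?thesis using i0 by blast
  qed
  assume ae: "a = 1 \<or> a = 2 \<and> even e"
  show "e < a \<or> l = 1 \<and> m = 1 \<and> a = 1 \<and> e = 1"
  proof (cases "l = 0")
    case True
    then have eq: "smult (of_nat n * c) H * N1 * N2 * T2\<^sup>2 = G * wronskian N1 N2 * T2\<^sup>2"
      using id m1 by (simp add: mult.assoc)
    then have eq: "smult (of_nat n * c) H * N1 * N2 = G * wronskian N1 N2"
      using n(4) by (subst (asm) mult_right_cancel) auto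
    have H0: "H \<noteq> 0" "degree H = e" by (simp_all add: G_H_def degree_power_eq)
    have G0: "G \<noteq> 0" "degree G = a" using X_power_minus_1[OF a, where 'a='a] \<kappa> by (simp_all add: G_H_def)
    have "smult (of_nat n * c) H * N1 * N2 \<noteq> 0" using nc H0 n by simp
    then have w0: "wronskian N1 N2 \<noteq> 0" using eq by auto
    have "e + degree N1 + degree N2 = degree (smult (of_nat n * c) H * N1 * N2)"
      using nc n H0 by (simp add: degree_mult_eq)
    also have "\<dots> = a + degree (wronskian N1 N2)"
      unfolding eq using w0 G0 by (simp add: degree_mult_eq)
    finally show ?thesis using degree_wronskian[of N1 N2] w0 by auto
  next
    case False
    then have l1: "l = 1" using lm by auto
    obtain f1 f2 where f: "f1 \<in> polys k" "f2 \<in> polys k" "f1 \<noteq> 0" "f2 \<noteq> 0"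
      "(XX ^ a - 1) * wronskian f1 f2 = smult (of_int i * of_nat a) (f1 * f2)"
      and fin: "\<And>w W n. n \<ge> 1 \<Longrightarrow> f1 = smult w (f2 * W ^ n) \<Longrightarrow>
        a = 1 \<and> i > 0 \<and> f1 = [:-1,1:] ^ nat i \<and> f2 = 1"
      using log_derivative_polys[OF _ i0(1) k(1), of a thesis] ae by blast
    \<comment> \<open>As \<open>a\<close> divides \<open>e\<close>,
      \<open>X^e = (X^a - 1) S + 1\<close>, and \<open>H/G\<close> is \<open>V'\<close> plus
      \<open>1/(\<kappa> (X^a - 1))\<close> with a polynomial \<open>V\<close>. By
      \<open>n c = i \<kappa> a\<close> the second part is \<open>1/(n c)\<close> times the
      logarithmic derivative of \<open>f1/f2\<close>.\<close>
    define q where "q = e div a"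
    have q: "e = a * q" using ae by (auto simp: q_def)
    define S where "S = (\<Sum>j<q. (XX ^ a) ^ j :: 'a poly)"
    define V where "V = smult (1 / \<kappa>) (\<Sum>j<q. monom (1 / of_nat (a * j + 1)) (a * j + 1))"
    have dV: "pderiv V = smult (1 / \<kappa>) S"
    proof -
      have "pderiv (monom (1 / of_nat (a * j + 1)) (a * j + 1)) = ((XX ^ a) ^ j :: 'a poly)" for j
        unfolding pderiv_monom by (simp add: power_mult[symmetric] monom_altdef del: of_nat_Suc of_nat_add of_nat_mult)
      then show ?thesis by (simp add: V_def S_def pderiv_smult pderiv_sum)
    qed
    have Vk: "V \<in> polys k"
      unfolding V_def using k(1) C(2) k(4) by (auto intro!: polys_closed subfield_closed)
    have HS: "H = (XX ^ a - 1) * S + 1"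
    proof -
      have "(XX ^ a) ^ q - 1 = (XX ^ a - 1) * S" unfolding S_def by (rule power_diff_1_eq)
      then show ?thesis by (simp add: G_H_def q power_mult algebra_simps)
    qed
    have "smult (of_nat n * c) H * (f1 * f2) =
      G * (smult (of_nat n * c) (pderiv V) * (f1 * f2) + wronskian f1 f2)"
    proof -
      have "G * (smult (of_nat n * c) (pderiv V) * (f1 * f2) + wronskian f1 f2) =
        smult (of_nat n * c) ((XX ^ a - 1) * S) * (f1 * f2) + smult \<kappa> ((XX ^ a - 1) * wronskian f1 f2)"
        using \<kappa> by (simp add: G_H_def dV algebra_simps)
      also have "smult \<kappa> ((XX ^ a - 1) * wronskian f1 f2) = smult (of_nat n * c) (f1 * f2)"
        unfolding f(5) i m1 by (simp add: mult_ac)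
      finally show ?thesis unfolding HS by (simp add: algebra_simps smult_diff_right smult_add_right)
    qed
    from L.lambert_relation[OF l1 m1 n(1) Vk f(1-4) this] obtain w s where
      ws: "w \<noteq> 0" "f1 = smult w (f2 * (smult c V + [:s:]) ^ n)" by blast
    then have *: "a = 1" "i > 0" "f1 = [:-1,1:] ^ nat i" "f2 = 1" using fin[OF n(1)] by auto
    then have "[:-1,1:] ^ nat i = smult w ((smult c V + [:s:]) ^ n)" using ws by simp
    moreover have "pderiv (smult c V + [:s:]) = smult (c / \<kappa>) (\<Sum>j<e. XX ^ j)"
      by (simp add: pderiv_add pderiv_smult dV S_def q * pderiv_pCons)
    ultimately have "e = 1"
      using power_linear_relation[of "nat i" w "smult c V + [:s:]" n "c / \<kappa>" e] *(2) n(1) L.c \<kappa> by simp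
    then show ?thesis using l1 m1 * by simp
  qed
qed

text \<open>Closing algebraically after every step absorbs the algebraic operations and provides
  \<open>alg k = k\<close> at each level.\<close>

inductive tower :: "bool \<Rightarrow> 'a set \<Rightarrow> bool" for w where
  base: "tower w constants"
| step: "tower w k \<Longrightarrow> g \<in> k \<Longrightarrow> l = 0 \<and> m = 1 \<or> l = 1 \<and> m = 0 \<or> w \<and> l = 1 \<and> m = 1 \<Longrightarrow>
    (l * \<theta> + m) * D \<theta> = g * \<theta> \<Longrightarrow> tower w (alg (adj k \<theta>))"

lemma towerD:
  assumes "tower w k"
  shows "subfield k" "alg k = k" "\<And>a. a \<in> k \<Longrightarrow> D a \<in> k" "constants \<subseteq> k"
proof -
  have "subfield k \<and> alg k = k \<and> (\<forall>a\<in>k. D a \<in> k) \<and> constants \<subseteq> k"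
    using assms
  proof induction
    case base
    then show ?case
      using subfield_constants alg_constants by (auto simp: constants_def D_rules)
  next
    case (step k g l m \<theta>)
    then have k: "subfield k" "\<And>a. a \<in> k \<Longrightarrow> D a \<in> k" "constants \<subseteq> k" by auto
    define A where "A = adj k \<theta>"
    have A: "subfield A" "k \<subseteq> A" "\<theta> \<in> A"
      using subfield_adj[OF k(1)] adj_superset[OF k(1)] adj_gen[OF k(1)] by (auto simp: A_def)
    have D\<theta>: "D \<theta> \<in> A"
    proof (cases "l * \<theta> + m = 0")
      case True
      \<comment> \<open>In this degenerate case the equation says nothing about
        \<open>D \<theta>\<close>, but \<theta> is then itself a constant.\<close>
      then have "\<theta> = - 1 \<or> \<theta> = 0" using step(3) by (auto simp: eq_neg_iff_add_eq_0)
      then show ?thesis using A by (auto simp: D_rules subfield_closed)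
    next
      case False
      then have "D \<theta> = g * \<theta> / (l * \<theta> + m)" using step(4) by (simp add: field_simps)
      moreover have "l \<in> A" "m \<in> A" using step(3) subfield_closed(1,2)[OF A(1)] by auto
      ultimately show ?thesis using A step(2) by (auto intro!: subfield_closed)
    qed
    have DA: "D r \<in> A" if "r \<in> A" for r
      unfolding A_def
      by (rule derivation_adj_stable[OF subfield_UNIV D k(1)])
        (use D\<theta> k(2) A that in \<open>auto simp: A_def[symmetric]\<close>)
    have "D r \<in> alg A" if "r \<in> alg A" for r
    proof -
      have "D r \<in> adj A r"
        by (rule derivation_alg_stable[OF subfield_UNIV D A(1) _ _ that DA]) auto
      also have "adj A r \<subseteq> alg A"
        using that by (intro adj_minimal subfield_alg A alg_superset)
      finally show ?thesis .
    qed
    then show ?case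
      using subfield_alg[OF A(1)] alg_idem[OF A(1)] alg_superset[OF A(1)] A(2) k(3)
      unfolding A_def[symmetric] by blast
  qed
  then show "subfield k" "alg k = k" "\<And>a. a \<in> k \<Longrightarrow> D a \<in> k" "constants \<subseteq> k" by auto
qed

text \<open>The induction descends to the level at which \<open>u\<close> first appears; the bottom
  level is excluded by \<open>D u \<noteq> 0\<close>.\<close>

theorem power_ode_tower:
  fixes a e :: nat
  assumes "tower w k" "u \<in> k" "D u \<noteq> 0"
    and ode: "u ^ e * D u = \<kappa> * (u ^ a - 1)" "D \<kappa> = 0" "\<kappa> \<noteq> 0" "a \<ge> 1"
  shows "(\<forall>\<rho>::'a. \<rho> ^ a = 1 \<longrightarrow> (\<exists>i j::int. j \<noteq> 0 \<and> of_int j * \<rho> ^ (e + 1) = of_int i)) \<and>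
    (a = 1 \<or> a = 2 \<and> even e \<longrightarrow> e < a \<or> w \<and> a = 1 \<and> e = 1)"
  using assms(1-3)
proof induction
  case base
  then show ?case by (simp add: constants_def)
next
  case (step k g l m \<theta>)
  show ?case
  proof (cases "u \<in> k")
    case True
    then show ?thesis using step by blast
  next
    case False
    have lm: "l = 0 \<and> m = 1 \<or> l = 1 \<and> m = 0 \<or> l = 1 \<and> m = 1" using step(3) by auto
    note * = power_ode_step[OF towerD[OF step(1)] False step(6) ode lm step(2,4)]
    show ?thesis using *(1) *(2) step(3) by auto
  qed
qed

end

section \<open>Smooth functions of a real variable\<close>

definition deriv_on :: "real set \<Rightarrow> (real \<Rightarrow> complex) \<Rightarrow> (real \<Rightarrow> complex) \<Rightarrow> bool" where
  "deriv_on S f f' \<longleftrightarrow> (\<forall>t\<in>S. (f has_vector_derivative f' t) (at t))"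

lemma deriv_onI: "(\<And>t. t \<in> S \<Longrightarrow> (f has_vector_derivative f' t) (at t)) \<Longrightarrow> deriv_on S f f'"
  by (simp add: deriv_on_def)

lemma deriv_onD: "deriv_on S f f' \<Longrightarrow> t \<in> S \<Longrightarrow> (f has_vector_derivative f' t) (at t)"
  by (simp add: deriv_on_def)

text \<open>Infinite differentiability, expressed as membership in a family of functions that is closed
  under differentiation.\<close>

definition smooth_on :: "real set \<Rightarrow> (real \<Rightarrow> complex) \<Rightarrow> bool" where
  "smooth_on S f \<longleftrightarrow> (\<exists>\<F>. f \<in> \<F> \<and> (\<forall>g\<in>\<F>. \<exists>g'\<in>\<F>. deriv_on S g g'))"

lemma smooth_on_deriv:
  assumes "smooth_on S f" obtains f' where "smooth_on S f'" "deriv_on S f f'"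
  using assms unfolding smooth_on_def by blast

lemma smooth_on_subset: "smooth_on S f \<Longrightarrow> T \<subseteq> S \<Longrightarrow> smooth_on T f"
  unfolding smooth_on_def deriv_on_def by (meson subsetD)

inductive_set ring_gen :: "(real \<Rightarrow> complex) set \<Rightarrow> (real \<Rightarrow> complex) set" for G where
  base: "g \<in> G \<Longrightarrow> g \<in> ring_gen G"
| const: "(\<lambda>t. c) \<in> ring_gen G"
| add: "f \<in> ring_gen G \<Longrightarrow> g \<in> ring_gen G \<Longrightarrow> (\<lambda>t. f t + g t) \<in> ring_gen G"
| mult: "f \<in> ring_gen G \<Longrightarrow> g \<in> ring_gen G \<Longrightarrow> (\<lambda>t. f t * g t) \<in> ring_gen G"

lemma ring_gen_mono: assumes "f \<in> ring_gen G" "G \<subseteq> G'" shows "f \<in> ring_gen G'"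
  using assms by induction (auto intro: ring_gen.intros)

lemma ring_gen_sum: "(\<And>i. i \<in> A \<Longrightarrow> f i \<in> ring_gen G) \<Longrightarrow> (\<lambda>t. \<Sum>i\<in>A. f i t) \<in> ring_gen G"
  by (induction A rule: infinite_finite_induct) (auto intro: ring_gen.intros)

lemma ring_gen_power: "f \<in> ring_gen G \<Longrightarrow> (\<lambda>t. f t ^ n) \<in> ring_gen G"
  by (induction n) (auto intro: ring_gen.intros)

lemma ring_gen_uminus: assumes "f \<in> ring_gen G" shows "(\<lambda>t. - f t) \<in> ring_gen G"
  using ring_gen.mult[OF ring_gen.const[of "-1" G] assms] by simp

lemma ring_gen_deriv:
  assumes "f \<in> ring_gen G" "G \<subseteq> G'" "\<And>g. g \<in> G \<Longrightarrow> \<exists>g'\<in>ring_gen G'. deriv_on S g g'"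
  shows "\<exists>f'\<in>ring_gen G'. deriv_on S f f'"
  using assms(1)
proof induction
  case (base g)
  then show ?case using assms(3) by blast
next
  case (const c)
  show ?case by (intro bexI[of _ "\<lambda>t. 0"]) (auto intro: ring_gen.const simp: deriv_on_def)
next
  case (add f g)
  then obtain f' g' where "f' \<in> ring_gen G'" "g' \<in> ring_gen G'" "deriv_on S f f'" "deriv_on S g g'"
    by blast
  then show ?case
    by (intro bexI[of _ "\<lambda>t. f' t + g' t"]) (auto intro: ring_gen.add has_vector_derivative_add simp: deriv_on_def)
next
  case (mult f g)
  then obtain f' g' where *: "f' \<in> ring_gen G'" "g' \<in> ring_gen G'" "deriv_on S f f'" "deriv_on S g g'"
    by blast
  moreover have "f \<in> ring_gen G'" "g \<in> ring_gen G'" using mult assms(2) ring_gen_mono by auto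
  ultimately show ?case
    by (intro bexI[of _ "\<lambda>t. f t * g' t + f' t * g t"])
      (auto intro!: ring_gen.add ring_gen.mult has_vector_derivative_mult simp: deriv_on_def)
qed

text \<open>The ring is closed under differentiation once the derivatives of its generators lie in
  it, and it then serves as the family in \<open>smooth_on\<close>.\<close>

lemma ring_gen_smooth:
  assumes H: "\<And>h. h \<in> H \<Longrightarrow> \<exists>h'\<in>ring_gen ({g. smooth_on S g} \<union> H). deriv_on S h h'"
    and f: "f \<in> ring_gen ({g. smooth_on S g} \<union> H)"
  shows "smooth_on S f"
proof -
  let ?G = "{g. smooth_on S g} \<union> H"
  have "\<exists>g'\<in>ring_gen ?G. deriv_on S g g'" if "g \<in> ?G" for g
    using that
  proof
    assume "g \<in> {g. smooth_on S g}"
    then obtain g' where "smooth_on S g'" "deriv_on S g g'" using smooth_on_deriv by blast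
    then show ?thesis by (intro bexI[of _ g'] ring_gen.base) auto
  qed (rule H)
  from ring_gen_deriv[OF _ order_refl this]
  have "\<forall>g\<in>ring_gen ?G. \<exists>g'\<in>ring_gen ?G. deriv_on S g g'" by (rule ballI)
  then show ?thesis unfolding smooth_on_def[of S f] using f by (intro exI[of _ "ring_gen ?G"] conjI)
qed

lemma smooth_on_const: "smooth_on S (\<lambda>t. c)"
  using ring_gen_smooth[of "{}" S "\<lambda>t. c"] ring_gen.const by blast

lemma smooth_on_add: "smooth_on S f \<Longrightarrow> smooth_on S g \<Longrightarrow> smooth_on S (\<lambda>t. f t + g t)"
  using ring_gen_smooth[of "{}" S "\<lambda>t. f t + g t"] by (simp add: ring_gen.add ring_gen.base)

lemma smooth_on_mult: "smooth_on S f \<Longrightarrow> smooth_on S g \<Longrightarrow> smooth_on S (\<lambda>t. f t * g t)"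
  using ring_gen_smooth[of "{}" S "\<lambda>t. f t * g t"] by (simp add: ring_gen.mult ring_gen.base)

lemma smooth_on_if_deriv: "deriv_on S f f' \<Longrightarrow> smooth_on S f' \<Longrightarrow> smooth_on S f"
  by (rule ring_gen_smooth[of "{f}"]) (auto intro: ring_gen.base)

lemma smooth_on_of_real: "smooth_on S complex_of_real"
proof (rule smooth_on_if_deriv[OF _ smooth_on_const])
  show "deriv_on S complex_of_real (\<lambda>t. 1)"
    using has_vector_derivative_of_real[OF DERIV_ident] by (auto simp: deriv_on_def)
qed

lemma deriv_on_cong:
  assumes "open S" "deriv_on S f f'" "\<And>t. t \<in> S \<Longrightarrow> f t = g t"
  shows "deriv_on S g f'"
proof (rule deriv_onI)
  fix t assume t: "t \<in> S"
  show "(g has_vector_derivative f' t) (at t)"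
    by (rule has_vector_derivative_transform_within_open[OF deriv_onD[OF assms(2) t] assms(1) t assms(3)])
qed

lemma smooth_on_cong:
  assumes "open S" "smooth_on S f" "\<And>t. t \<in> S \<Longrightarrow> f t = g t"
  shows "smooth_on S g"
proof -
  obtain f' where f': "smooth_on S f'" "deriv_on S f f'" using smooth_on_deriv[OF assms(2)] .
  show ?thesis by (rule smooth_on_if_deriv[OF deriv_on_cong[OF assms(1) f'(2) assms(3)] f'(1)])
qed

lemma deriv_on_exp:
  assumes "deriv_on S f f'" shows "deriv_on S (\<lambda>t. exp (f t)) (\<lambda>t. f' t * exp (f t))"
  using field_vector_diff_chain_at[OF deriv_onD[OF assms] DERIV_exp]
  by (intro deriv_onI) (simp add: o_def)

lemma deriv_on_inverse:
  assumes "deriv_on S f f'" "\<And>t. t \<in> S \<Longrightarrow> f t \<noteq> 0"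
  shows "deriv_on S (\<lambda>t. inverse (f t)) (\<lambda>t. f' t * (- (inverse (f t) * inverse (f t))))"
proof (rule deriv_onI)
  fix t assume t: "t \<in> S"
  then have "(inverse has_field_derivative - (inverse (f t) * inverse (f t))) (at (f t))"
    using DERIV_inverse[of "f t"] assms(2) by (simp add: power2_eq_square)
  from field_vector_diff_chain_at[OF deriv_onD[OF assms(1) t] this]
  show "((\<lambda>t. inverse (f t)) has_vector_derivative f' t * (- (inverse (f t) * inverse (f t)))) (at t)"
    by (simp add: o_def)
qed

lemma smooth_on_exp: assumes "smooth_on S f" shows "smooth_on S (\<lambda>t. exp (f t))"
proof -
  obtain f' where f': "smooth_on S f'" "deriv_on S f f'" using smooth_on_deriv[OF assms] .
  let ?h = "\<lambda>t. exp (f t)"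
  show ?thesis
  proof (rule ring_gen_smooth[of "{?h}"])
    have "(\<lambda>t. f' t * ?h t) \<in> ring_gen ({g. smooth_on S g} \<union> {?h})"
      by (intro ring_gen.mult) (auto intro: ring_gen.base f')
    then show "\<exists>h'\<in>ring_gen ({g. smooth_on S g} \<union> {?h}). deriv_on S h h'" if "h \<in> {?h}" for h
      using that deriv_on_exp[OF f'(2)] by auto
  qed (auto intro: ring_gen.base)
qed

text \<open>Implicit differentiation divides by an expression \<open>Q\<close> in the unknown
  functions. With \<open>inverse Q\<close> as a further generator the ring stays closed, its
  derivative being \<open>- Q' / Q^2\<close>.\<close>

lemma smooth_on_implicit:
  assumes Q: "Q \<in> ring_gen ({g. smooth_on S g} \<union> H)" "\<And>t. t \<in> S \<Longrightarrow> Q t \<noteq> 0"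
    and H: "\<And>h. h \<in> H \<Longrightarrow>
      \<exists>h'\<in>ring_gen ({g. smooth_on S g} \<union> (H \<union> {\<lambda>t. inverse (Q t)})). deriv_on S h h'"
    and h: "h \<in> H"
  shows "smooth_on S h"
proof (rule ring_gen_smooth[of "H \<union> {\<lambda>t. inverse (Q t)}"])
  let ?G = "{g. smooth_on S g} \<union> H" and ?G' = "{g. smooth_on S g} \<union> (H \<union> {\<lambda>t. inverse (Q t)})"
  show "h \<in> ring_gen ?G'" using h by (auto intro: ring_gen.base)
  have "\<exists>g'\<in>ring_gen ?G'. deriv_on S g g'" if "g \<in> ?G" for g
    using that
  proof
    assume "g \<in> {g. smooth_on S g}"
    then obtain g' where "smooth_on S g'" "deriv_on S g g'" using smooth_on_deriv by blast
    then show ?thesis by (intro bexI[of _ g'] ring_gen.base) auto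
  qed (rule H)
  then obtain Q' where Q': "Q' \<in> ring_gen ?G'" "deriv_on S Q Q'"
    using ring_gen_deriv[OF Q(1), of ?G' S] by blast
  fix x assume "x \<in> H \<union> {\<lambda>t. inverse (Q t)}"
  moreover have "(\<lambda>t. Q' t * (- (inverse (Q t) * inverse (Q t)))) \<in> ring_gen ?G'"
    using Q' by (intro ring_gen.mult ring_gen_uminus) (auto intro: ring_gen.base)
  ultimately show "\<exists>h'\<in>ring_gen ?G'. deriv_on S x h'"
    using H deriv_on_inverse[OF Q'(2) Q(2)] by blast
qed

lemma smooth_on_inverse:
  assumes "smooth_on S f" "\<And>t. t \<in> S \<Longrightarrow> f t \<noteq> 0"
  shows "smooth_on S (\<lambda>t. inverse (f t))"
proof -
  obtain f' where f': "smooth_on S f'" "deriv_on S f f'" using smooth_on_deriv[OF assms(1)] .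
  show ?thesis
    by (rule ring_gen_smooth[of "{\<lambda>t. inverse (f t)}"])
      (use f' deriv_on_inverse[OF f'(2) assms(2)] in
        \<open>auto intro!: ring_gen.mult ring_gen_uminus intro: ring_gen.base\<close>)
qed

lemma has_vector_derivative_complex_iff:
  fixes g :: "real \<Rightarrow> complex"
  shows "(g has_vector_derivative g') (at x) \<longleftrightarrow>
    ((\<lambda>t. (g t - g x) / of_real (t - x)) \<longlongrightarrow> g') (at x)"
proof -
  have "(g has_vector_derivative g') (at x) \<longleftrightarrow>
    ((\<lambda>t. norm (g t - g x - (t - x) *\<^sub>R g') / norm (t - x)) \<longlongrightarrow> 0) (at x)"
    unfolding has_vector_derivative_def has_derivative_iff_norm
    by (simp add: bounded_linear_scaleR_left)
  also have "\<dots> \<longleftrightarrow> ((\<lambda>t. norm ((g t - g x) / of_real (t - x) - g')) \<longlongrightarrow> 0) (at x)"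
  proof (rule filterlim_cong[OF refl refl])
    show "\<forall>\<^sub>F t in at x. norm (g t - g x - (t - x) *\<^sub>R g') / norm (t - x) =
      norm ((g t - g x) / of_real (t - x) - g')"
    proof (rule eventually_at_filter[THEN iffD2], rule always_eventually, intro allI impI)
      fix t assume "t \<noteq> x"
      then have "(g t - g x) / of_real (t - x) - g' = (g t - g x - (t - x) *\<^sub>R g') / of_real (t - x)"
        by (simp add: field_simps scaleR_conv_of_real)
      then show "norm (g t - g x - (t - x) *\<^sub>R g') / norm (t - x) = norm ((g t - g x) / of_real (t - x) - g')"
        by (simp add: norm_divide flip: of_real_diff)
    qed
  qed
  also have "\<dots> \<longleftrightarrow> ((\<lambda>t. (g t - g x) / of_real (t - x)) \<longlongrightarrow> g') (at x)"
    by (simp add: tendsto_norm_zero_iff LIM_zero_iff)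
  finally show ?thesis .
qed

text \<open>Stands in for the implicit function theorem: the branch is given, so an exact
  factorisation of its increment suffices, and the continuity of the branch enters through that of
  the cofactor \<open>Q\<close>.\<close>

lemma has_vector_derivative_quotient:
  fixes f Q R :: "real \<Rightarrow> complex"
  assumes S: "open S" "t0 \<in> S" and eq: "\<And>t. t \<in> S \<Longrightarrow> (f t - f t0) * Q t = R t - R t0"
    and Q: "isCont Q t0" "Q t0 \<noteq> 0" and R: "(R has_vector_derivative r) (at t0)"
  shows "(f has_vector_derivative r / Q t0) (at t0)"
  unfolding has_vector_derivative_complex_iff
proof (rule Lim_transform_eventually)
  show "((\<lambda>t. (R t - R t0) / of_real (t - t0) / Q t) \<longlongrightarrow> r / Q t0) (at t0)"
    using R Q unfolding has_vector_derivative_complex_iff isCont_def by (intro tendsto_divide)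
  have "eventually (\<lambda>t. Q t \<noteq> 0) (at t0)"
    using tendsto_imp_eventually_ne[of Q "Q t0" "at t0" 0] Q by (simp add: isCont_def)
  moreover have "eventually (\<lambda>t. t \<in> S) (at t0)"
    using S by (auto simp: eventually_at_topological)
  ultimately show "\<forall>\<^sub>F t in at t0. (R t - R t0) / of_real (t - t0) / Q t = (f t - f t0) / of_real (t - t0)"
  proof eventually_elim
    case (elim t)
    show ?case unfolding eq[OF elim(2), symmetric] using elim by simp
  qed
qed

lemma smooth_on_isCont: assumes "smooth_on S f" "t \<in> S" shows "isCont f t"
proof -
  obtain f' where "deriv_on S f f'" using smooth_on_deriv[OF assms(1)] .
  then show ?thesis using assms(2) by (intro has_vector_derivative_continuous[of f "f' t"] deriv_onD)
qed

lemma smooth_on_log: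
  assumes S: "open S" and g: "smooth_on S g" and f: "continuous_on S f"
    and eq: "\<And>t. t \<in> S \<Longrightarrow> exp (f t) = g t"
  shows "smooth_on S f"
proof -
  obtain g' where g': "smooth_on S g'" "deriv_on S g g'" using smooth_on_deriv[OF g] .
  have "deriv_on S f (\<lambda>t. g' t * inverse (g t))"
  proof (rule deriv_onI)
    fix t assume t: "t \<in> S"
    \<comment> \<open>Caratheodory's form of the derivative of \<open>exp\<close> factors the
      increment of \<open>g\<close> through that of \<open>f\<close>, with a continuous
      cofactor.\<close>
    obtain h where h: "\<And>z. exp z - exp (f t) = h z * (z - f t)" "isCont h (f t)" "h (f t) = exp (f t)"
      using DERIV_exp[of "f t"] unfolding CARAT_DERIV by blast
    have cf: "isCont f t" using f S t by (simp add: continuous_on_eq_continuous_at)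
    have ct: "isCont (\<lambda>s. h (f s)) t" by (rule isCont_o2[OF cf h(2)])
    have eq': "(f s - f t) * h (f s) = g s - g t" if "s \<in> S" for s
      unfolding eq[OF that, symmetric] eq[OF t, symmetric] h(1) by (rule mult.commute)
    have h0: "h (f t) \<noteq> 0" using h(3) by simp
    have "(f has_vector_derivative g' t / h (f t)) (at t)"
      by (rule has_vector_derivative_quotient[where Q = "\<lambda>s. h (f s)" and R = g,
            OF S t eq' ct h0 deriv_onD[OF g'(2) t]])
    then show "(f has_vector_derivative g' t * inverse (g t)) (at t)"
      using h eq t by (simp add: divide_inverse)
  qed
  moreover have "g t \<noteq> 0" if "t \<in> S" for t using eq[OF that] by (metis exp_not_eq_zero)
  then have "smooth_on S (\<lambda>t. g' t * inverse (g t))"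
    by (intro smooth_on_mult smooth_on_inverse g g')
  ultimately show ?thesis by (rule smooth_on_if_deriv)
qed

lemma smooth_on_lambert:
  assumes S: "open S" and g: "smooth_on S g" and f: "continuous_on S f"
    and eq: "\<And>t. t \<in> S \<Longrightarrow> f t * exp (f t) = g t" and nz: "\<And>t. t \<in> S \<Longrightarrow> f t \<noteq> -1"
  shows "smooth_on S f"
proof -
  obtain g' where g': "smooth_on S g'" "deriv_on S g g'" using smooth_on_deriv[OF g] .
  define Q where "Q t = (f t + 1) * exp (f t)" for t
  \<comment> \<open>\<open>Q\<close> involves \<open>f\<close> and \<open>exp f\<close>; both have
    derivatives in the ring that they generate together with smooth functions and
    \<open>inverse Q\<close>.\<close>
  define H where "H = {f, \<lambda>t. exp (f t)}"
  have df: "deriv_on S f (\<lambda>t. g' t * inverse (Q t))"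
  proof (rule deriv_onI)
    fix t assume t: "t \<in> S"
    have "((\<lambda>w. w * exp w) has_field_derivative Q t) (at (f t))"
      unfolding Q_def by (auto intro!: derivative_eq_intros simp: algebra_simps)
    then obtain h where h: "\<And>z. z * exp z - f t * exp (f t) = h z * (z - f t)" "isCont h (f t)" "h (f t) = Q t"
      unfolding CARAT_DERIV by blast
    have cf: "isCont f t" using f S t by (simp add: continuous_on_eq_continuous_at)
    have ct: "isCont (\<lambda>s. h (f s)) t" by (rule isCont_o2[OF cf h(2)])
    have eq': "(f s - f t) * h (f s) = g s - g t" if "s \<in> S" for s
      unfolding eq[OF that, symmetric] eq[OF t, symmetric] h(1) by (rule mult.commute)
    have h0: "h (f t) \<noteq> 0" using h(3) nz[OF t] by (simp add: Q_def add_eq_0_iff2)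
    have "(f has_vector_derivative g' t / h (f t)) (at t)"
      by (rule has_vector_derivative_quotient[where Q = "\<lambda>s. h (f s)" and R = g,
            OF S t eq' ct h0 deriv_onD[OF g'(2) t]])
    then show "(f has_vector_derivative g' t * inverse (Q t)) (at t)"
      using h by (simp add: divide_inverse)
  qed
  show ?thesis
  proof (rule smooth_on_implicit[of Q S H])
    let ?G = "{g. smooth_on S g} \<union> (H \<union> {\<lambda>t. inverse (Q t)})"
    show "Q \<in> ring_gen ({g. smooth_on S g} \<union> H)"
      unfolding Q_def H_def by (intro ring_gen.mult ring_gen.add ring_gen.const) (auto intro: ring_gen.base)
    show "Q t \<noteq> 0" if "t \<in> S" for t using nz[OF that] by (simp add: Q_def add_eq_0_iff2)
    have df': "(\<lambda>t. g' t * inverse (Q t)) \<in> ring_gen ?G"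
      using g' by (intro ring_gen.mult) (auto intro: ring_gen.base)
    moreover have "(\<lambda>t. g' t * inverse (Q t) * exp (f t)) \<in> ring_gen ?G"
      by (rule ring_gen.mult[OF df']) (auto simp: H_def intro: ring_gen.base)
    ultimately show "\<exists>h'\<in>ring_gen ?G. deriv_on S h h'" if "h \<in> H" for h
      using that df deriv_on_exp[OF df] unfolding H_def by blast
    show "f \<in> H" by (simp add: H_def)
  qed
qed

lemma smooth_on_root:
  assumes S: "open S" and a: "\<And>i. i \<le> n \<Longrightarrow> smooth_on S (a i)" and f: "continuous_on S f"
    and eq: "\<And>t. t \<in> S \<Longrightarrow> (\<Sum>i\<le>n. a i t * f t ^ i) = 0"
    and nz: "\<And>t. t \<in> S \<Longrightarrow> (\<Sum>i\<le>n. of_nat i * a i t * f t ^ (i - 1)) \<noteq> 0"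
  shows "smooth_on S f"
proof -
  have "\<forall>i. \<exists>a'. i \<le> n \<longrightarrow> smooth_on S a' \<and> deriv_on S (a i) a'" using a smooth_on_deriv by metis
  then obtain a' where a': "\<And>i. i \<le> n \<Longrightarrow> smooth_on S (a' i)" "\<And>i. i \<le> n \<Longrightarrow> deriv_on S (a i) (a' i)"
    by metis
  define Q where "Q t = (\<Sum>i\<le>n. of_nat i * a i t * f t ^ (i - 1))" for t
  define N where "N t = - (\<Sum>i\<le>n. a' i t * f t ^ i)" for t
  have df: "deriv_on S f (\<lambda>t. N t * inverse (Q t))"
  proof (rule deriv_onI)
    fix t assume t: "t \<in> S"
    \<comment> \<open>The increment of the equation is split: \<open>q\<close> is the difference
      quotient in the unknown with the coefficients taken at \<open>s\<close>, and \<open>R\<close>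
      varies the coefficients with the unknown frozen at \<open>t\<close>.\<close>
    define q where "q s = (\<Sum>i\<le>n. a i s * (\<Sum>j<i. f t ^ (i - Suc j) * f s ^ j))" for s
    define R where "R s = - (\<Sum>i\<le>n. a i s * f t ^ i)" for s
    have qt: "q t = Q t"
      unfolding q_def Q_def
    proof (intro sum.cong refl)
      fix i
      have "(\<Sum>j<i. f t ^ (i - Suc j) * f t ^ j) = (\<Sum>j<i. f t ^ (i - 1))"
        by (intro sum.cong refl) (simp flip: power_add)
      then show "a i t * (\<Sum>j<i. f t ^ (i - Suc j) * f t ^ j) = of_nat i * a i t * f t ^ (i - 1)" by simp
    qed
    have "(f has_vector_derivative N t / q t) (at t)"
    proof (rule has_vector_derivative_quotient[OF S t, of f q R])
      fix s assume s: "s \<in> S"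
      have "(f s - f t) * q s = (\<Sum>i\<le>n. a i s * (f s ^ i - f t ^ i))"
        unfolding q_def sum_distrib_left power_diff_sumr2 by (intro sum.cong refl) (simp add: mult_ac)
      also have "\<dots> = (\<Sum>i\<le>n. a i s * f s ^ i) + R s"
        by (simp add: R_def algebra_simps sum_subtractf)
      also have "\<dots> = R s - R t" using eq[OF s] eq[OF t] by (simp add: R_def)
      finally show "(f s - f t) * q s = R s - R t" .
    next
      have "isCont f t" using f S t by (simp add: continuous_on_eq_continuous_at)
      moreover have "isCont (a i) t" if "i \<le> n" for i using a[OF that] t by (rule smooth_on_isCont)
      ultimately show "isCont q t" unfolding q_def by (intro continuous_intros) auto
      show "q t \<noteq> 0" using nz[OF t] qt by (simp add: Q_def)
      have "((\<lambda>s. \<Sum>i\<le>n. a i s * f t ^ i) has_vector_derivative (\<Sum>i\<le>n. a' i t * f t ^ i)) (at t)"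
        using deriv_onD[OF a'(2) t] by (intro has_vector_derivative_sum has_vector_derivative_mult_left) auto
      then show "(R has_vector_derivative N t) (at t)"
        unfolding R_def N_def by (rule has_vector_derivative_minus)
    qed
    then show "(f has_vector_derivative N t * inverse (Q t)) (at t)" by (simp add: qt divide_inverse)
  qed
  show ?thesis
  proof (rule smooth_on_implicit[of Q S "{f}"])
    let ?G = "{g. smooth_on S g} \<union> ({f} \<union> {\<lambda>t. inverse (Q t)})"
    show "Q \<in> ring_gen ({g. smooth_on S g} \<union> {f})"
      unfolding Q_def using a
      by (intro ring_gen_sum ring_gen.mult ring_gen_power ring_gen.const) (auto intro: ring_gen.base)
    show "Q t \<noteq> 0" if "t \<in> S" for t using nz[OF that] by (simp add: Q_def)
    have "N \<in> ring_gen ?G"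
      unfolding N_def using a'
      by (intro ring_gen_uminus ring_gen_sum ring_gen.mult ring_gen_power) (auto intro: ring_gen.base)
    then have "(\<lambda>t. N t * inverse (Q t)) \<in> ring_gen ?G"
      by (rule ring_gen.mult) (auto intro: ring_gen.base)
    then show "\<exists>h'\<in>ring_gen ?G. deriv_on S h h'" if "h \<in> {f}" for h
      using that df by blast
  qed auto
qed

text \<open>Where every root is multiple, \<open>f\<close> is also a root of the formal derivative.\<close>

lemma smooth_on_root_generic:
  assumes "open W" "W \<noteq> {}" "\<And>i. i \<le> n \<Longrightarrow> smooth_on W (a i)" "continuous_on W f"
    "\<And>t. t \<in> W \<Longrightarrow> (\<Sum>i\<le>n. a i t * f t ^ i) = 0" "\<And>t. t \<in> W \<Longrightarrow> \<exists>i\<le>n. a i t \<noteq> 0"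
  shows "\<exists>W'\<subseteq>W. open W' \<and> W' \<noteq> {} \<and> smooth_on W' f"
  using assms
proof (induction n arbitrary: a)
  case 0
  then show ?case by auto
next
  case (Suc n)
  define Q where "Q t = (\<Sum>i\<le>Suc n. of_nat i * a i t * f t ^ (i - 1))" for t
  show ?case
  proof (cases "\<forall>t\<in>W. Q t = 0")
    case True
    have Q: "Q t = (\<Sum>i\<le>n. (of_nat (Suc i) * a (Suc i) t) * f t ^ i)" for t
      unfolding Q_def sum.atMost_Suc_shift by simp
    show ?thesis
    proof (rule Suc.IH[of "\<lambda>i t. of_nat (Suc i) * a (Suc i) t"])
      show "smooth_on W (\<lambda>t. of_nat (Suc i) * a (Suc i) t)" if "i \<le> n" for i
        using Suc.prems(3) that by (intro smooth_on_mult smooth_on_const) auto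
      show "(\<Sum>i\<le>n. (of_nat (Suc i) * a (Suc i) t) * f t ^ i) = 0" if "t \<in> W" for t
        using True Q that by simp
      show "\<exists>i\<le>n. of_nat (Suc i) * a (Suc i) t \<noteq> 0" if "t \<in> W" for t
      proof (rule ccontr)
        assume "\<not> ?thesis"
        then have 0: "a (Suc i) t = 0" if "i \<le> n" for i using that by (auto simp del: of_nat_Suc)
        then have "a 0 t = 0" using Suc.prems(5)[OF that] by (simp add: sum.atMost_Suc_shift del: sum.atMost_Suc)
        then show False using Suc.prems(6)[OF that] 0 by (metis Suc_le_mono not0_implies_Suc)
      qed
    qed (use Suc.prems in auto)
  next
    case False
    define W' where "W' = {t \<in> W. Q t \<noteq> 0}"
    have "continuous_on W Q"
      unfolding Q_def using Suc.prems(1,3,4)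
      by (intro continuous_intros) (auto simp: continuous_on_eq_continuous_at intro: smooth_on_isCont)
    then have "open (W \<inter> Q -` (- {0}))"
      using Suc.prems(1) by (intro continuous_open_preimage) auto
    also have "W \<inter> Q -` (- {0}) = W'" by (auto simp: W'_def)
    finally have "open W'" .
    moreover have "smooth_on W' f"
    proof (rule smooth_on_root[OF \<open>open W'\<close>])
      have W': "W' \<subseteq> W" by (auto simp: W'_def)
      show "smooth_on W' (a i)" if "i \<le> Suc n" for i
        using smooth_on_subset[OF Suc.prems(3)[OF that] W'] .
      show "continuous_on W' f" using continuous_on_subset[OF Suc.prems(4) W'] .
      show "(\<Sum>i\<le>Suc n. a i t * f t ^ i) = 0" if "t \<in> W'" for t
        using Suc.prems(5) W' that by blast
      show "(\<Sum>i\<le>Suc n. of_nat i * a i t * f t ^ (i - 1)) \<noteq> 0" if "t \<in> W'" for t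
        using that by (simp add: W'_def Q_def del: sum.atMost_Suc)
    qed
    ultimately show ?thesis using False by (intro exI[of _ W']) (auto simp: W'_def)
  qed
qed

section \<open>Taylor germs of closed forms\<close>

definition vderiv :: "(real \<Rightarrow> complex) \<Rightarrow> real \<Rightarrow> complex" where
  "vderiv f t = vector_derivative f (at t)"

text \<open>A formal series: no analyticity is claimed, and each coefficient depends on finitely
  many derivatives at \<open>t\<close>.\<close>

definition taylor :: "real \<Rightarrow> (real \<Rightarrow> complex) \<Rightarrow> complex fps" where
  "taylor t f = Abs_fps (\<lambda>n. (vderiv ^^ n) f t / fact n)"

lemma vderiv_eq: "deriv_on S f f' \<Longrightarrow> t \<in> S \<Longrightarrow> vderiv f t = f' t"
  by (simp add: vderiv_def vector_derivative_at deriv_onD)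

lemma deriv_on_vderiv: assumes "smooth_on S f" shows "deriv_on S f (vderiv f)"
proof -
  obtain f' where f': "deriv_on S f f'" using smooth_on_deriv[OF assms] .
  show ?thesis by (rule deriv_onI) (simp add: vderiv_eq[OF f'] deriv_onD[OF f'])
qed

lemma smooth_on_vderiv: assumes "open S" "smooth_on S f" shows "smooth_on S (vderiv f)"
proof -
  obtain f' where f': "smooth_on S f'" "deriv_on S f f'" using smooth_on_deriv[OF assms(2)] .
  show ?thesis by (rule smooth_on_cong[OF assms(1) f'(1)]) (simp add: vderiv_eq[OF f'(2)])
qed

lemma deriv_on_add:
  "deriv_on S f f' \<Longrightarrow> deriv_on S g g' \<Longrightarrow> deriv_on S (\<lambda>t. f t + g t) (\<lambda>t. f' t + g' t)"
  by (simp add: deriv_on_def has_vector_derivative_add)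

lemma deriv_on_mult:
  "deriv_on S f f' \<Longrightarrow> deriv_on S g g' \<Longrightarrow> deriv_on S (\<lambda>t. f t * g t) (\<lambda>t. f t * g' t + f' t * g t)"
  by (simp add: deriv_on_def has_vector_derivative_mult)

text \<open>\<open>vderiv\<close> is defined pointwise and serves on all members of \<S> at once,
  whereas families of derivatives chosen separately on each member need not fit together.\<close>

lemma smooth_on_Union:
  assumes "\<And>S. S \<in> \<S> \<Longrightarrow> open S" "\<And>S. S \<in> \<S> \<Longrightarrow> smooth_on S f"
  shows "smooth_on (\<Union>\<S>) f"
proof -
  define \<F> where "\<F> = {g. \<forall>S\<in>\<S>. smooth_on S g}"
  have "vderiv g \<in> \<F>" "deriv_on (\<Union>\<S>) g (vderiv g)" if "g \<in> \<F>" for g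
    using that assms(1) deriv_on_vderiv smooth_on_vderiv by (auto simp: \<F>_def deriv_on_def)
  moreover have "f \<in> \<F>" using assms(2) by (simp add: \<F>_def)
  ultimately show ?thesis unfolding smooth_on_def by blast
qed

lemma taylor_0: "fps_nth (taylor t f) 0 = f t"
  by (simp add: taylor_def)

lemma fps_deriv_taylor_vderiv: "fps_deriv (taylor t f) = taylor t (vderiv f)"
  by (rule fps_ext) (simp add: taylor_def funpow_Suc_right del: funpow.simps of_nat_Suc)

lemma taylor_Suc: "fps_nth (taylor t f) (Suc n) = fps_nth (taylor t (vderiv f)) n / of_nat (Suc n)"
  using arg_cong[OF fps_deriv_taylor_vderiv[of t f], of "\<lambda>x. fps_nth x n"]
  by (simp add: field_simps del: of_nat_Suc)

context
  fixes S :: "real set" and t :: real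
  assumes S: "open S" "t \<in> S"
begin

lemma taylor_cong:
  assumes "smooth_on S f" "\<And>s. s \<in> S \<Longrightarrow> f s = g s"
  shows "taylor t f = taylor t g"
proof (rule fps_ext)
  fix n show "fps_nth (taylor t f) n = fps_nth (taylor t g) n"
    using assms
  proof (induction n arbitrary: f g)
    case 0
    then show ?case using S by (simp add: taylor_0)
  next
    case (Suc n)
    have "deriv_on S g (vderiv f)"
      by (rule deriv_on_cong[OF S(1) deriv_on_vderiv[OF Suc.prems(1)] Suc.prems(2)])
    then have "vderiv f s = vderiv g s" if "s \<in> S" for s using vderiv_eq that by metis
    then show ?case
      using Suc.IH[OF smooth_on_vderiv[OF S(1) Suc.prems(1)]] by (simp add: taylor_Suc)
  qed
qed

lemma fps_deriv_taylor:
  assumes "smooth_on S f" "deriv_on S f f'"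
  shows "fps_deriv (taylor t f) = taylor t f'"
  unfolding fps_deriv_taylor_vderiv
  by (rule taylor_cong[OF smooth_on_vderiv[OF S(1) assms(1)] vderiv_eq[OF assms(2)]])

lemma taylor_add:
  assumes "smooth_on S f" "smooth_on S g"
  shows "taylor t (\<lambda>s. f s + g s) = taylor t f + taylor t g"
proof (rule fps_ext)
  fix n show "fps_nth (taylor t (\<lambda>s. f s + g s)) n = fps_nth (taylor t f + taylor t g) n"
    using assms
  proof (induction n arbitrary: f g)
    case 0
    then show ?case by (simp add: taylor_0)
  next
    case (Suc n)
    note sm = smooth_on_vderiv[OF S(1) Suc.prems(1)] smooth_on_vderiv[OF S(1) Suc.prems(2)]
    have "deriv_on S (\<lambda>s. f s + g s) (\<lambda>s. vderiv f s + vderiv g s)"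
      by (rule deriv_on_add[OF deriv_on_vderiv[OF Suc.prems(1)] deriv_on_vderiv[OF Suc.prems(2)]])
    from fps_deriv_taylor[OF smooth_on_add[OF Suc.prems] this]
    have "taylor t (vderiv (\<lambda>s. f s + g s)) = taylor t (\<lambda>s. vderiv f s + vderiv g s)"
      by (simp add: fps_deriv_taylor_vderiv)
    then show ?case using Suc.IH[OF sm] by (simp add: taylor_Suc add_divide_distrib)
  qed
qed

text \<open>Coefficient \<open>n + 1\<close> of a Taylor series is determined by coefficient
  \<open>n\<close> for the derivative, so induction with the product rule replaces the Leibniz
  formula.\<close>

lemma taylor_mult:
  assumes "smooth_on S f" "smooth_on S g"
  shows "taylor t (\<lambda>s. f s * g s) = taylor t f * taylor t g"
proof (rule fps_ext)
  fix n show "fps_nth (taylor t (\<lambda>s. f s * g s)) n = fps_nth (taylor t f * taylor t g) n"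
    using assms
  proof (induction n arbitrary: f g)
    case 0
    then show ?case by (simp add: taylor_0)
  next
    case (Suc n)
    note sm = smooth_on_vderiv[OF S(1) Suc.prems(1)] smooth_on_vderiv[OF S(1) Suc.prems(2)]
    have "deriv_on S (\<lambda>s. f s * g s) (\<lambda>s. f s * vderiv g s + vderiv f s * g s)"
      by (rule deriv_on_mult[OF deriv_on_vderiv[OF Suc.prems(1)] deriv_on_vderiv[OF Suc.prems(2)]])
    from fps_deriv_taylor[OF smooth_on_mult[OF Suc.prems] this]
    have "taylor t (vderiv (\<lambda>s. f s * g s)) = taylor t (\<lambda>s. f s * vderiv g s) + taylor t (\<lambda>s. vderiv f s * g s)"
      using sm Suc.prems by (simp add: fps_deriv_taylor_vderiv taylor_add smooth_on_mult)
    then have "fps_nth (taylor t (vderiv (\<lambda>s. f s * g s))) n =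
      fps_nth (taylor t f * taylor t (vderiv g) + taylor t (vderiv f) * taylor t g) n"
      using Suc.IH[OF Suc.prems(1) sm(2)] Suc.IH[OF sm(1) Suc.prems(2)] by simp
    also have "\<dots> = fps_nth (fps_deriv (taylor t f * taylor t g)) n"
      by (simp add: fps_deriv_taylor_vderiv)
    also have "\<dots> = of_nat (Suc n) * fps_nth (taylor t f * taylor t g) (Suc n)"
      by (simp only: fps_deriv_nth Suc_eq_plus1)
    finally show ?case unfolding taylor_Suc by (simp del: of_nat_Suc fps_mult_nth)
  qed
qed

end

lemma taylor_const: "taylor t (\<lambda>s. c) = fps_const c"
proof -
  have d: "vderiv (\<lambda>s. c') = (\<lambda>s. 0)" for c' by (rule ext) (simp add: vderiv_def)
  have "(vderiv ^^ n) (\<lambda>s. 0) = (\<lambda>s. 0)" for n by (induction n) (auto simp: d)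
  then have "taylor t (\<lambda>s. 0) = 0" by (simp add: taylor_def fps_eq_iff)
  then have "fps_nth (taylor t (\<lambda>s. c)) n = fps_nth (fps_const c) n" for n
    by (cases n) (simp_all add: taylor_0 taylor_Suc d)
  then show ?thesis by (rule fps_ext)
qed

text \<open>Laurent series form a field, which power series do not. A flat function has germ 0
  without vanishing nearby, so nonvanishing of a germ is always inferred from a nonzero value at
  \<open>t\<close>.\<close>

definition germ :: "real \<Rightarrow> (real \<Rightarrow> complex) \<Rightarrow> complex fls" where
  "germ t f = fps_to_fls (taylor t f)"

lemma germ_const: "germ t (\<lambda>s. c) = fls_const c"
  by (simp add: germ_def taylor_const)

lemma germ_nz: "f t \<noteq> 0 \<Longrightarrow> germ t f \<noteq> 0"
  using taylor_0[of t f] by (auto simp: germ_def)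

context
  fixes S :: "real set" and t :: real
  assumes S: "open S" "t \<in> S"
begin

lemma germ_cong: "smooth_on S f \<Longrightarrow> (\<And>s. s \<in> S \<Longrightarrow> f s = g s) \<Longrightarrow> germ t f = germ t g"
  using taylor_cong[OF S] by (simp add: germ_def)

lemma germ_deriv: "smooth_on S f \<Longrightarrow> deriv_on S f f' \<Longrightarrow> fls_deriv (germ t f) = germ t f'"
  using fps_deriv_taylor[OF S] by (simp add: germ_def fls_deriv_fps_to_fls)

lemma germ_add: "smooth_on S f \<Longrightarrow> smooth_on S g \<Longrightarrow> germ t (\<lambda>s. f s + g s) = germ t f + germ t g"
  by (simp add: germ_def taylor_add[OF S])

lemma germ_mult: "smooth_on S f \<Longrightarrow> smooth_on S g \<Longrightarrow> germ t (\<lambda>s. f s * g s) = germ t f * germ t g"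
  by (simp add: germ_def taylor_mult[OF S] fls_times_fps_to_fls)

lemma germ_power: assumes "smooth_on S f" shows "smooth_on S (\<lambda>s. f s ^ n) \<and> germ t (\<lambda>s. f s ^ n) = germ t f ^ n"
proof (induction n)
  case 0
  then show ?case by (simp add: smooth_on_const germ_const)
next
  case (Suc n)
  then show ?case using assms by (simp add: smooth_on_mult germ_mult)
qed

lemma germ_sum:
  assumes "finite A" "\<And>i. i \<in> A \<Longrightarrow> smooth_on S (f i)"
  shows "smooth_on S (\<lambda>s. \<Sum>i\<in>A. f i s) \<and> germ t (\<lambda>s. \<Sum>i\<in>A. f i s) = (\<Sum>i\<in>A. germ t (f i))"
  using assms
proof (induction A rule: finite_induct)
  case empty
  then show ?case by (simp add: smooth_on_const germ_const)
next
  case (insert i A)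
  then show ?case by (simp add: smooth_on_add germ_add)
qed

end

interpretation fls: diff_field "fls_deriv :: complex fls \<Rightarrow> complex fls"
  by unfold_locales (simp add: derivation_on_def algebra_simps)

lemma fls_constants: "fls.constants = range fls_const"
  by (auto simp: fls.constants_def fls_deriv_eq_0_iff)

text \<open>Finite intersections of open dense sets are again open and dense, so one point can be
  chosen that is good for all subterms of a closed form.\<close>

definition dense_in :: "real set \<Rightarrow> real set \<Rightarrow> bool" where
  "dense_in I U \<longleftrightarrow> open U \<and> U \<subseteq> I \<and> (\<forall>W. open W \<longrightarrow> W \<subseteq> I \<longrightarrow> W \<noteq> {} \<longrightarrow> W \<inter> U \<noteq> {})"

lemma dense_in_refl: "open I \<Longrightarrow> dense_in I I"
  by (auto simp: dense_in_def)

lemma dense_in_Int: assumes "dense_in I U" "dense_in I V" shows "dense_in I (U \<inter> V)"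
  unfolding dense_in_def
proof (intro conjI allI impI)
  fix W assume W: "open W" "W \<subseteq> I" "W \<noteq> {}"
  then have "open (W \<inter> U)" "W \<inter> U \<noteq> {}" "W \<inter> U \<subseteq> I" using assms(1) by (auto simp: dense_in_def)
  then show "W \<inter> (U \<inter> V) \<noteq> {}" using assms(2) unfolding dense_in_def by (metis Int_assoc)
qed (use assms in \<open>auto simp: dense_in_def\<close>)

lemma dense_in_INT: "\<lbrakk>open I; \<And>i. i \<le> n \<Longrightarrow> dense_in I (U i)\<rbrakk> \<Longrightarrow> dense_in I (\<Inter>i\<le>n. U i)"
  for n :: nat
proof (induction n)
  case (Suc n)
  have "(\<Inter>i\<le>Suc n. U i) = U (Suc n) \<inter> (\<Inter>i\<le>n. U i)" by (auto simp: le_Suc_eq)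
  then show ?case using Suc by (auto intro!: dense_in_Int)
qed simp

lemma dense_in_smooth:
  assumes V: "dense_in I V"
    and ex: "\<And>W. open W \<Longrightarrow> W \<subseteq> V \<Longrightarrow> W \<noteq> {} \<Longrightarrow> \<exists>W'\<subseteq>W. open W' \<and> W' \<noteq> {} \<and> smooth_on W' f"
  obtains U where "dense_in I U" "U \<subseteq> V" "smooth_on U f"
proof -
  define \<S> where "\<S> = {S. open S \<and> S \<subseteq> V \<and> smooth_on S f}"
  have "smooth_on (\<Union>\<S>) f" by (rule smooth_on_Union) (auto simp: \<S>_def)
  moreover have sub: "\<Union>\<S> \<subseteq> V" by (auto simp: \<S>_def)
  moreover have "dense_in I (\<Union>\<S>)"
    unfolding dense_in_def
  proof (intro conjI allI impI)
    show "open (\<Union>\<S>)" by (auto simp: \<S>_def)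
    show "\<Union>\<S> \<subseteq> I" using sub V by (auto simp: dense_in_def)
    fix W assume "open W" "W \<subseteq> I" "W \<noteq> {}"
    then have "open (W \<inter> V)" "W \<inter> V \<noteq> {}" using V by (auto simp: dense_in_def)
    then obtain W' where W': "W' \<subseteq> W \<inter> V" "open W'" "W' \<noteq> {}" "smooth_on W' f"
      using ex[of "W \<inter> V"] by auto
    then have "W' \<in> \<S>" by (auto simp: \<S>_def)
    then show "W \<inter> \<Union>\<S> \<noteq> {}" using W' by blast
  qed
  ultimately show ?thesis using that by blast
qed

text \<open>The quantifier over all tower fields \<open>k\<close> lets the germs of several subterms
  be adjoined one after another on top of the same tower, without a compositum of towers.\<close>

definition tower_germ :: "bool \<Rightarrow> real \<Rightarrow> (real \<Rightarrow> complex) \<Rightarrow> bool" where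
  "tower_germ w t f \<longleftrightarrow> (\<forall>k. fls.tower w k \<longrightarrow> (\<exists>k'. fls.tower w k' \<and> k \<subseteq> k' \<and> germ t f \<in> k'))"

lemma tower_extend:
  assumes k: "fls.tower w k" and "g \<in> k" "l = 0 \<and> m = 1 \<or> l = 1 \<and> m = 0 \<or> w \<and> l = 1 \<and> m = 1"
    "(l * \<theta> + m) * fls_deriv \<theta> = g * \<theta>"
  shows "\<exists>k'. fls.tower w k' \<and> k \<subseteq> k' \<and> \<theta> \<in> k'"
proof -
  note K = fls.towerD(1)[OF k]
  have "fls.tower w (alg (adj k \<theta>))" by (rule fls.tower.step[OF assms])
  moreover have "adj k \<theta> \<subseteq> alg (adj k \<theta>)" by (rule alg_superset[OF subfield_adj[OF K]])
  ultimately show ?thesis using adj_superset[OF K] adj_gen[OF K] by blast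
qed

lemma tower_germ_INT:
  fixes n :: nat
  assumes "\<And>i. i \<le> n \<Longrightarrow> tower_germ w t (a i)" and k: "fls.tower w k"
  shows "\<exists>k'. fls.tower w k' \<and> k \<subseteq> k' \<and> (\<forall>i\<le>n. germ t (a i) \<in> k')"
  using assms(1)
proof (induction n)
  case 0
  then show ?case using k by (simp add: tower_germ_def)
next
  case (Suc n)
  then obtain k' where k': "fls.tower w k'" "k \<subseteq> k'" "\<forall>i\<le>n. germ t (a i) \<in> k'" by auto
  then obtain k'' where k'': "fls.tower w k''" "k' \<subseteq> k''" "germ t (a (Suc n)) \<in> k''"
    using Suc.prems[of "Suc n"] unfolding tower_germ_def by blast
  then show ?case using k' by (intro exI[of _ k'']) (auto simp: le_Suc_eq)
qed

theorem closed_form_germs: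
  assumes "closed_form w J f"
  shows "\<exists>U. dense_in (interior J) U \<and> smooth_on U f \<and> (\<forall>t\<in>U. tower_germ w t f)"
  using assms
proof induction
  case (const c)
  have "fls_const c \<in> k" if "fls.tower w k" for k
    using fls.towerD(4)[OF that] by (auto simp: fls_constants)
  then have "tower_germ w t (\<lambda>t. c)" for t unfolding tower_germ_def germ_const by blast
  then show ?case using dense_in_refl[OF open_interior] smooth_on_const by blast
next
  case var
  have "tower_germ w t complex_of_real" for t
    unfolding tower_germ_def
  proof (intro allI impI)
    fix k assume k: "fls.tower w k"
    have "deriv_on UNIV complex_of_real (\<lambda>t. 1)"
      using has_vector_derivative_of_real[OF DERIV_ident] by (auto simp: deriv_on_def)
    then have "fls_deriv (germ t complex_of_real) = 1"
      using germ_deriv[OF open_UNIV UNIV_I smooth_on_of_real, of _ t] by (simp add: germ_const)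
    \<comment> \<open>The variable enters by a step of logarithm type with \<open>g = 1\<close>,
      since its derivative is 1.\<close>
    then show "\<exists>k'. fls.tower w k' \<and> k \<subseteq> k' \<and> germ t complex_of_real \<in> k'"
      using subfield_0_1(2)[OF fls.towerD(1)[OF k]] by (intro tower_extend[OF k, of 1 1 0]) auto
  qed
  then show ?case using dense_in_refl[OF open_interior] smooth_on_of_real by blast
next
  case (add f g)
  then obtain U V where U: "dense_in (interior J) U" "smooth_on U f" "\<forall>t\<in>U. tower_germ w t f"
    and V: "dense_in (interior J) V" "smooth_on V g" "\<forall>t\<in>V. tower_germ w t g" by blast
  define W where "W = U \<inter> V"
  have W: "dense_in (interior J) W" unfolding W_def by (rule dense_in_Int[OF U(1) V(1)])
  have sm: "smooth_on W f" "smooth_on W g" using U V by (auto simp: W_def intro: smooth_on_subset)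
  have "tower_germ w t (\<lambda>t. f t + g t)" if t: "t \<in> W" for t
    unfolding tower_germ_def
  proof (intro allI impI)
    fix k assume "fls.tower w k"
    then obtain k' where "fls.tower w k'" "k \<subseteq> k'" "germ t f \<in> k'"
      using U t unfolding W_def tower_germ_def by blast
    moreover from this obtain k'' where "fls.tower w k''" "k' \<subseteq> k''" "germ t g \<in> k''"
      using V t unfolding W_def tower_germ_def by blast
    moreover have "germ t (\<lambda>t. f t + g t) = germ t f + germ t g"
      using W t sm by (intro germ_add[of W]) (auto simp: dense_in_def)
    ultimately show "\<exists>k'. fls.tower w k' \<and> k \<subseteq> k' \<and> germ t (\<lambda>t. f t + g t) \<in> k'"
      by (intro exI[of _ k'']) (auto intro: subfield_add[OF fls.towerD(1)])
  qed
  then show ?case using W smooth_on_add[OF sm] by blast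
next
  case (mult f g)
  then obtain U V where U: "dense_in (interior J) U" "smooth_on U f" "\<forall>t\<in>U. tower_germ w t f"
    and V: "dense_in (interior J) V" "smooth_on V g" "\<forall>t\<in>V. tower_germ w t g" by blast
  define W where "W = U \<inter> V"
  have W: "dense_in (interior J) W" unfolding W_def by (rule dense_in_Int[OF U(1) V(1)])
  have sm: "smooth_on W f" "smooth_on W g" using U V by (auto simp: W_def intro: smooth_on_subset)
  have "tower_germ w t (\<lambda>t. f t * g t)" if t: "t \<in> W" for t
    unfolding tower_germ_def
  proof (intro allI impI)
    fix k assume "fls.tower w k"
    then obtain k' where "fls.tower w k'" "k \<subseteq> k'" "germ t f \<in> k'"
      using U t unfolding W_def tower_germ_def by blast
    moreover from this obtain k'' where "fls.tower w k''" "k' \<subseteq> k''" "germ t g \<in> k''"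
      using V t unfolding W_def tower_germ_def by blast
    moreover have "germ t (\<lambda>t. f t * g t) = germ t f * germ t g"
      using W t sm by (intro germ_mult[of W]) (auto simp: dense_in_def)
    ultimately show "\<exists>k'. fls.tower w k' \<and> k \<subseteq> k' \<and> germ t (\<lambda>t. f t * g t) \<in> k'"
      by (intro exI[of _ k'']) (auto intro: subfield_minus_mult(2)[OF fls.towerD(1)])
  qed
  then show ?case using W smooth_on_mult[OF sm] by blast
next
  case (algebraic n a f)
  have "\<forall>i. \<exists>U. i \<le> n \<longrightarrow> dense_in (interior J) U \<and> smooth_on U (a i) \<and> (\<forall>t\<in>U. tower_germ w t (a i))"
    using algebraic.IH by meson
  then obtain V where V: "\<And>i. i \<le> n \<Longrightarrow> dense_in (interior J) (V i)"
    "\<And>i. i \<le> n \<Longrightarrow> smooth_on (V i) (a i)" "\<And>i t. i \<le> n \<Longrightarrow> t \<in> V i \<Longrightarrow> tower_germ w t (a i)"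
    by metis
  define V' where "V' = (\<Inter>i\<le>n. V i)"
  have V': "dense_in (interior J) V'" unfolding V'_def using V(1) by (intro dense_in_INT) auto
  have VJ: "V' \<subseteq> J" using V' interior_subset[of J] by (auto simp: dense_in_def)
  have smV: "smooth_on V' (a i)" if "i \<le> n" for i
    using V(2)[OF that] that by (auto simp: V'_def intro: smooth_on_subset)
  obtain U where U: "dense_in (interior J) U" "U \<subseteq> V'" "smooth_on U f"
  proof (rule dense_in_smooth[OF V', of f])
    fix W assume W: "open W" "W \<subseteq> V'" "W \<noteq> {}"
    show "\<exists>W'\<subseteq>W. open W' \<and> W' \<noteq> {} \<and> smooth_on W' f"
    proof (rule smooth_on_root_generic[OF W(1,3)])
      show "smooth_on W (a i)" if "i \<le> n" for i using smooth_on_subset[OF smV[OF that] W(2)] .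
      have WJ: "W \<subseteq> J" using W VJ by blast
      show "continuous_on W f" using algebraic.hyps(3) WJ by (rule continuous_on_subset)
      show "(\<Sum>i\<le>n. a i t * f t ^ i) = 0" "\<exists>i\<le>n. a i t \<noteq> 0" if "t \<in> W" for t
        using bspec[OF algebraic.hyps(4), of t] bspec[OF algebraic.hyps(2), of t] WJ that by auto
    qed
  qed
  have "tower_germ w t f" if t: "t \<in> U" for t
    unfolding tower_germ_def
  proof (intro allI impI)
    fix k assume k: "fls.tower w k"
    have "tower_germ w t (a i)" if "i \<le> n" for i
      using V(3)[OF that] t U(2) that by (auto simp: V'_def)
    from tower_germ_INT[where a = a and n = n and t = t, OF this k]
    obtain k' where k': "fls.tower w k'" "k \<subseteq> k'" "\<And>i. i \<le> n \<Longrightarrow> germ t (a i) \<in> k'"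
      by auto
    note K = fls.towerD(1)[OF k'(1)]
    have oU: "open U" using U by (simp add: dense_in_def)
    define p where "p = (\<Sum>i\<le>n. monom (germ t (a i)) i)"
    have "p \<in> polys k'" unfolding p_def using k'(3) K by (intro polys_sum polys_monom) auto
    moreover have "p \<noteq> 0"
    proof
      assume "p = 0"
      obtain i where i: "i \<le> n" "a i t \<noteq> 0"
        using bspec[OF algebraic.hyps(2), of t] t U(2) VJ by auto
      have "coeff p i = germ t (a i)" using i by (simp add: p_def coeff_sum)
      then show False using germ_nz[of "a i" t] i \<open>p = 0\<close> by simp
    qed
    moreover have "poly p (germ t f) = 0"
    proof -
      have sma: "smooth_on U (a i)" if "i \<le> n" for i using smV[OF that] U(2) by (rule smooth_on_subset)
      note pw = germ_power[OF oU t U(3)]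
      have 1: "smooth_on U (\<lambda>s. a i s * f s ^ i)" "germ t (\<lambda>s. a i s * f s ^ i) = germ t (a i) * germ t f ^ i"
        if "i \<le> n" for i
        using sma[OF that] pw[of i] by (auto intro: smooth_on_mult simp: germ_mult[OF oU t])
      have "poly p (germ t f) = (\<Sum>i\<le>n. germ t (\<lambda>s. a i s * f s ^ i))"
        unfolding p_def poly_sum poly_monom by (intro sum.cong) (simp_all add: 1)
      also have "\<dots> = germ t (\<lambda>s. \<Sum>i\<le>n. a i s * f s ^ i)"
        using germ_sum[OF oU t, of "{..n}" "\<lambda>i s. a i s * f s ^ i"] 1 by simp
      also have "\<dots> = germ t (\<lambda>s. 0)"
        using germ_sum[OF oU t, of "{..n}" "\<lambda>i s. a i s * f s ^ i"] 1 algebraic.hyps(4) U(2) VJ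
        by (intro germ_cong[OF oU t]) auto
      finally show ?thesis by (simp add: germ_const)
    qed
    \<comment> \<open>No step is added here: \<open>k'\<close> already contains everything algebraic
      over it.\<close>
    ultimately have "germ t f \<in> alg k'" unfolding alg_def by blast
    then show "\<exists>k'. fls.tower w k' \<and> k \<subseteq> k' \<and> germ t f \<in> k'"
      using k' fls.towerD(2)[OF k'(1)] by auto
  qed
  then show ?case using U by blast
next
  case (exp f)
  then obtain U where U: "dense_in (interior J) U" "smooth_on U f" "\<forall>t\<in>U. tower_germ w t f" by blast
  have oU: "open U" using U by (simp add: dense_in_def)
  note sm = smooth_on_exp[OF U(2)]
  obtain f' where f': "smooth_on U f'" "deriv_on U f f'" using smooth_on_deriv[OF U(2)] .
  have "tower_germ w t (\<lambda>t. exp (f t))" if t: "t \<in> U" for t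
    unfolding tower_germ_def
  proof (intro allI impI)
    fix k assume "fls.tower w k"
    then obtain k' where k': "fls.tower w k'" "k \<subseteq> k'" "germ t f \<in> k'"
      using U t unfolding tower_germ_def by blast
    have "fls_deriv (germ t (\<lambda>t. exp (f t))) = fls_deriv (germ t f) * germ t (\<lambda>t. exp (f t))"
      unfolding germ_deriv[OF oU t sm deriv_on_exp[OF f'(2)]] germ_deriv[OF oU t U(2) f'(2)]
      by (rule germ_mult[OF oU t f'(1) sm])
    then have "\<exists>k''. fls.tower w k'' \<and> k' \<subseteq> k'' \<and> germ t (\<lambda>t. exp (f t)) \<in> k''"
      by (intro tower_extend[OF k'(1) fls.towerD(3)[OF k'(1,3)], of 0 1]) simp_all
    then show "\<exists>k'. fls.tower w k' \<and> k \<subseteq> k' \<and> germ t (\<lambda>t. exp (f t)) \<in> k'"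
      using k'(2) by blast
  qed
  then show ?case using U(1) sm by blast
next
  case (log g f)
  then obtain U where U: "dense_in (interior J) U" "smooth_on U g" "\<forall>t\<in>U. tower_germ w t g" by blast
  have oU: "open U" using U by (simp add: dense_in_def)
  have UJ: "U \<subseteq> J" using U interior_subset[of J] by (auto simp: dense_in_def)
  have eq: "exp (f t) = g t" if "t \<in> U" for t using log.hyps(3) UJ that by blast
  have sm: "smooth_on U f"
    using smooth_on_log[OF oU U(2) continuous_on_subset[OF log.hyps(2) UJ] eq] .
  obtain f' where f': "smooth_on U f'" "deriv_on U f f'" using smooth_on_deriv[OF sm] .
  have "tower_germ w t f" if t: "t \<in> U" for t
    unfolding tower_germ_def
  proof (intro allI impI)
    fix k assume "fls.tower w k"
    then obtain k' where k': "fls.tower w k'" "k \<subseteq> k'" "germ t g \<in> k'"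
      using U t unfolding tower_germ_def by blast
    have "g t \<noteq> 0" using eq[OF t] by (metis exp_not_eq_zero)
    then have g0: "germ t g \<noteq> 0" by (rule germ_nz)
    have ge: "germ t (\<lambda>t. exp (f t)) = germ t g" by (rule germ_cong[OF oU t smooth_on_exp[OF sm] eq])
    have "fls_deriv (germ t (\<lambda>t. exp (f t))) = fls_deriv (germ t f) * germ t (\<lambda>t. exp (f t))"
      unfolding germ_deriv[OF oU t smooth_on_exp[OF sm] deriv_on_exp[OF f'(2)]] germ_deriv[OF oU t sm f'(2)]
      by (rule germ_mult[OF oU t f'(1) smooth_on_exp[OF sm]])
    then have "fls_deriv (germ t f) = fls_deriv (germ t g) / germ t g" using g0 by (simp add: ge)
    moreover have "fls_deriv (germ t g) / germ t g \<in> k'"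
      using k' fls.towerD(1,3) by (intro subfield_divide) auto
    ultimately have "\<exists>k''. fls.tower w k'' \<and> k' \<subseteq> k'' \<and> germ t f \<in> k''"
      by (intro tower_extend[OF k'(1), of "fls_deriv (germ t g) / germ t g" 1 0]) (auto simp: mult.commute)
    then show "\<exists>k'. fls.tower w k' \<and> k \<subseteq> k' \<and> germ t f \<in> k'"
      using k'(2) by blast
  qed
  then show ?case using U(1) sm by blast
next
  case (lambert g f)
  then obtain V where V: "dense_in (interior J) V" "smooth_on V g" "\<forall>t\<in>V. tower_germ w t g" by blast
  have VJ: "V \<subseteq> J" using V interior_subset[of J] by (auto simp: dense_in_def)
  obtain U where U: "dense_in (interior J) U" "U \<subseteq> V" "smooth_on U f"
  proof (rule dense_in_smooth[OF V(1), of f])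
    fix W assume W: "open W" "W \<subseteq> V" "W \<noteq> {}"
    have cf: "continuous_on W f"
      by (rule continuous_on_subset[OF lambert.hyps(3) subset_trans[OF W(2) VJ]])
    show "\<exists>W'\<subseteq>W. open W' \<and> W' \<noteq> {} \<and> smooth_on W' f"
    \<comment> \<open>\<open>-1\<close> is the critical point of \<open>w * exp w\<close>. Either
      \<open>f\<close> stays there on all of \<open>W\<close> and is constant, or an open part of
      \<open>W\<close> avoids it.\<close>
    proof (cases "\<forall>t\<in>W. f t = -1")
      case True
      have "smooth_on W f" by (rule smooth_on_cong[OF W(1) smooth_on_const[of W "-1"]]) (use True in auto)
      then show ?thesis using W by blast
    next
      case False
      define W' where "W' = W \<inter> f -` (- {-1})"
      have W'o: "open W'" unfolding W'_def using cf W(1) by (intro continuous_open_preimage) auto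
      have W'W: "W' \<subseteq> W" by (auto simp: W'_def)
      have "smooth_on W' f"
      proof (rule smooth_on_lambert[OF W'o])
        show "smooth_on W' g" using V(2) W'W W(2) by (auto intro: smooth_on_subset)
        show "continuous_on W' f" using cf W'W by (rule continuous_on_subset)
        show "f t * exp (f t) = g t" "f t \<noteq> -1" if "t \<in> W'" for t
          using lambert.hyps(4) that W'W W(2) VJ by (auto simp: W'_def)
      qed
      moreover have "W' \<noteq> {}" using False by (auto simp: W'_def)
      ultimately show ?thesis using W'o W'W by blast
    qed
  qed
  have oU: "open U" using U by (simp add: dense_in_def)
  obtain f' where f': "smooth_on U f'" "deriv_on U f f'" using smooth_on_deriv[OF U(3)] .
  have smg: "smooth_on U g" using V(2) U(2) by (rule smooth_on_subset)
  have eq: "f t * exp (f t) = g t" if "t \<in> U" for t using lambert.hyps(4) U(2) VJ that by blast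
  have "tower_germ w t f" if t: "t \<in> U" for t
    unfolding tower_germ_def
  proof (intro allI impI)
    fix k assume "fls.tower w k"
    then obtain k' where k': "fls.tower w k'" "k \<subseteq> k'" "germ t g \<in> k'"
      using V U(2) t unfolding tower_germ_def by blast
    define F H where "F = germ t f" "H = germ t (\<lambda>t. exp (f t))"
    have H0: "H \<noteq> 0" unfolding F_H_def by (rule germ_nz) simp
    have FH: "germ t g = F * H"
      unfolding F_H_def germ_mult[OF oU t U(3) smooth_on_exp[OF U(3)], symmetric]
      by (rule germ_cong[OF oU t smg, symmetric, THEN sym]) (simp add: eq)
    have dH: "fls_deriv H = fls_deriv F * H"
      unfolding F_H_def germ_deriv[OF oU t smooth_on_exp[OF U(3)] deriv_on_exp[OF f'(2)]] germ_deriv[OF oU t U(3) f'(2)]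
      by (rule germ_mult[OF oU t f'(1) smooth_on_exp[OF U(3)]])
    have "\<exists>k''. fls.tower w k'' \<and> k' \<subseteq> k'' \<and> F \<in> k''"
    proof (cases "germ t g = 0")
      case True
      then have "F = 0" using FH H0 by simp
      then show ?thesis using k'(1) subfield_0_1(1)[OF fls.towerD(1)[OF k'(1)]] by auto
    next
      case False
      \<comment> \<open>The logarithmic derivative of \<open>F * exp F = g\<close> is
        \<open>(1 + 1/F) F' = g'/g\<close>, which is the Lambert form of a tower step.\<close>
      define b where "b = fls_deriv (germ t g) / germ t g"
      have b: "b \<in> k'" unfolding b_def using k' fls.towerD(1,3) by (intro subfield_divide) auto
      have "fls_deriv (germ t g) = (F + 1) * fls_deriv F * H"
        unfolding FH by (simp add: dH algebra_simps)
      then have "(F + 1) * fls_deriv F = b * F"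
        using False H0 unfolding b_def FH by (simp add: field_simps)
      then show ?thesis using b lambert.hyps(1) by (intro tower_extend[OF k'(1), of b 1 1]) auto
    qed
    then show "\<exists>k'. fls.tower w k' \<and> k \<subseteq> k' \<and> germ t f \<in> k'"
      using k'(2) unfolding F_H_def by blast
  qed
  then show ?case using U by blast
qed

section \<open>The differential equation\<close>

text \<open>A rational number of modulus 1 is 1 or -1, so the root of unity raised to
  \<open>2 * n\<close> is 1 and \<open>a\<close> divides \<open>2 * n\<close>; coprimality leaves
  \<open>a\<close> dividing 2.\<close>

lemma cis_rational_power:
  fixes a n :: nat and i j :: int
  assumes "a \<ge> 1" "coprime n a" "j \<noteq> 0"
    and "of_int j * (exp (2 * of_real pi * \<i> / of_nat a) :: complex) ^ n = of_int i"
  shows "a = 1 \<or> a = 2"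
proof -
  define z :: complex where "z = exp (2 * of_real pi * \<i> / of_nat a)"
  have zp: "z ^ m = exp (2 * of_real pi * \<i> * of_nat m / of_nat a)" for m
    unfolding z_def exp_of_nat_mult[symmetric] by (simp add: mult_ac)
  have nz: "norm z = 1" by (simp add: z_def)
  have zn: "z ^ n = complex_of_real (of_int i / of_int j)"
    using assms(3,4) by (simp add: z_def field_simps)
  have "norm (z ^ n) = 1" by (simp add: norm_power nz)
  then have "\<bar>of_int i / of_int j :: real\<bar> = 1" unfolding zn norm_of_real .
  then have "(of_int i / of_int j :: real)\<^sup>2 = 1" by (metis power2_abs power_one)
  then have "(z ^ n)\<^sup>2 = 1" unfolding zn by (metis of_real_power of_real_1)
  then have "z ^ (2 * n) = 1" by (simp add: power_mult[symmetric] mult.commute)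
  then have "a dvd 2 * n" using complex_root_unity_eq_1[OF assms(1), of "2 * n"] unfolding zp by simp
  then have "a dvd 2" using assms(2) by (metis coprime_commute coprime_dvd_mult_left_iff)
  then show ?thesis using assms(1) by (auto dest!: dvd_imp_le simp: le_Suc_eq numeral_2_eq_2)
qed

lemma closed_form_continuous: "closed_form w J f \<Longrightarrow> continuous_on J f"
  by (induction rule: closed_form.induct) (auto intro!: continuous_intros)

text \<open>The equation is passed to the germ at one good point, where \<open>0 < v < 1\<close>
  keeps the derivative away from 0. Coprimality of \<open>e + 1\<close> and \<open>a\<close> yields
  \<open>a \<le> 2\<close>, and makes \<open>e\<close> even for \<open>a = 2\<close>.\<close>

lemma closed_form_power_ode:
  fixes v v' :: "real \<Rightarrow> real" and a e :: nat
  assumes cf: "closed_form w J (\<lambda>t. complex_of_real (v t))" and J: "interior J \<noteq> {}"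
    and v: "\<And>t. t \<in> interior J \<Longrightarrow> (v has_real_derivative v' t) (at t)"
    and ode: "\<And>t. t \<in> interior J \<Longrightarrow> v t ^ e * v' t = \<kappa> * (v t ^ a - 1)"
    and v01: "\<And>t. t \<in> interior J \<Longrightarrow> 0 < v t \<and> v t < 1"
    and \<kappa>: "\<kappa> \<noteq> 0" and a: "a \<ge> 1" "coprime (e + 1) a"
  shows "(a = 1 \<or> a = 2) \<and> (e < a \<or> w \<and> a = 1 \<and> e = 1)"
proof -
  let ?f = "\<lambda>t. complex_of_real (v t)" and ?f' = "\<lambda>t. complex_of_real (v' t)"
  obtain U where U: "dense_in (interior J) U" "smooth_on U ?f" "\<forall>t\<in>U. tower_germ w t ?f"
    using closed_form_germs[OF cf] by blast
  have oU: "open U" and UJ: "U \<subseteq> interior J" using U(1) by (auto simp: dense_in_def)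
  have "interior J \<inter> U \<noteq> {}" using U(1) J unfolding dense_in_def by blast
  then obtain t where t: "t \<in> U" by blast
  have df: "deriv_on U ?f ?f'"
    using v UJ by (intro deriv_onI has_vector_derivative_of_real) auto
  have smf': "smooth_on U ?f'"
    by (rule smooth_on_cong[OF oU smooth_on_vderiv[OF oU U(2)]]) (rule vderiv_eq[OF df])
  define u where "u = germ t ?f"
  have Du: "fls_deriv u = germ t ?f'" unfolding u_def by (rule germ_deriv[OF oU t U(2) df])
  have "v t \<noteq> 0" "v t ^ a \<noteq> 1" using v01[of t] t UJ a power_less_one_iff[of "v t" a] by auto
  then have "v' t \<noteq> 0" using ode[of t] t UJ \<kappa> by auto
  then have Du0: "fls_deriv u \<noteq> 0" unfolding Du by (intro germ_nz) simp
  obtain k where k: "fls.tower w k" "u \<in> k"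
    using U(3) t fls.tower.base[of w] unfolding tower_germ_def u_def by blast
  note pw = germ_power[OF oU t U(2)]
  have "u ^ e * fls_deriv u = germ t (\<lambda>s. ?f s ^ e * ?f' s)"
    unfolding Du unfolding u_def using pw[of e] germ_mult[OF oU t _ smf'] by simp
  also have "\<dots> = germ t (\<lambda>s. of_real \<kappa> * (?f s ^ a + (- 1)))"
  proof (rule germ_cong[OF oU t])
    show "smooth_on U (\<lambda>s. ?f s ^ e * ?f' s)" using pw[of e] smf' by (intro smooth_on_mult) auto
    show "?f s ^ e * ?f' s = of_real \<kappa> * (?f s ^ a + (- 1))" if "s \<in> U" for s
      using arg_cong[OF ode[of s], of complex_of_real] that UJ by auto
  qed
  also have "\<dots> = fls_const (of_real \<kappa>) * (u ^ a + fls_const (- 1))"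
  proof -
    have sm: "smooth_on U (\<lambda>s. ?f s ^ a)" and pa: "germ t (\<lambda>s. ?f s ^ a) = u ^ a"
      using pw[of a] by (auto simp: u_def)
    have "germ t (\<lambda>s. of_real \<kappa> * (?f s ^ a + (- 1))) = germ t (\<lambda>s. of_real \<kappa>) * germ t (\<lambda>s. ?f s ^ a + (- 1))"
      by (rule germ_mult[OF oU t smooth_on_const smooth_on_add[OF sm smooth_on_const]])
    also have "germ t (\<lambda>s. ?f s ^ a + (- 1)) = germ t (\<lambda>s. ?f s ^ a) + germ t (\<lambda>s. - 1)"
      by (rule germ_add[OF oU t sm smooth_on_const])
    finally show ?thesis unfolding pa germ_const .
  qed
  also have "fls_const (- 1 :: complex) = - 1" by (simp add: fls_const_uminus[symmetric])
  finally have "u ^ e * fls_deriv u = fls_const (of_real \<kappa>) * (u ^ a - 1)" by simp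
  from fls.power_ode_tower[OF k Du0 this _ _ a(1)] \<kappa>
  have R: "\<And>\<rho>::complex fls. \<rho> ^ a = 1 \<Longrightarrow>
      \<exists>i j::int. j \<noteq> 0 \<and> of_int j * \<rho> ^ (e + 1) = of_int i"
    and E: "a = 1 \<or> a = 2 \<and> even e \<Longrightarrow> e < a \<or> w \<and> a = 1 \<and> e = 1"
    by auto
  \<comment> \<open>A primitive \<open>a\<close>-th root of unity: this one choice of \<rho> already
    bounds \<open>a\<close>.\<close>
  define z :: complex where "z = exp (2 * of_real pi * \<i> / of_nat a)"
  have fp: "fls_const z ^ m = fls_const (z ^ m)" for m
    by (induction m) (simp_all add: fls_const_mult_const)
  have "z ^ a = 1"
    unfolding z_def exp_of_nat_mult[symmetric] using a(1) by simp
  then obtain i j :: int where "j \<noteq> 0" "of_int j * fls_const z ^ (e + 1) = of_int i"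
    using R[of "fls_const z"] by (auto simp: fp)
  then have "fls_const (of_int j * z ^ (e + 1)) = fls_const (of_int i)"
    by (simp only: fp fls_of_int fls_const_mult_const)
  then have "of_int j * z ^ (e + 1) = of_int i" by (metis fls_const_nth)
  then have a12: "a = 1 \<or> a = 2"
    using cis_rational_power[OF a \<open>j \<noteq> 0\<close>] unfolding z_def by blast
  moreover have "even e" if "a = 2" using a(2) that by simp
  ultimately show ?thesis using E by blast
qed

lemma interior_sol_domain: "interior (sol_domain \<alpha>) = (if \<alpha> > 0 then {0<..} else {..<0})"
  by (simp add: sol_domain_def)

text \<open>With \<open>v^b = y\<close> the equation becomes
  \<open>v^(b-1) v' = - (C/b) (v^a - 1)\<close> if the exponent is positive. If it is negative,
  multiplication by \<open>v^a\<close> removes the negative power, reverses the sign and raises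
  \<open>e\<close> to \<open>b - 1 + a\<close>.\<close>

lemma solution_closed_form_imp:
  fixes C \<alpha> :: real and a b :: nat
  assumes C: "C > 0" and y: "ivp_solution C \<alpha> y" and J: "interior J \<noteq> {}" "J \<subseteq> sol_domain \<alpha>"
    and ab: "a \<ge> 1" "b \<ge> 1" "coprime a b" and \<alpha>: "\<alpha> = real a / real b \<or> \<alpha> = - (real a / real b)"
    and cf: "closed_form w J (\<lambda>t. complex_of_real (y t))"
  shows "\<alpha> \<in> {1, 2} \<or> w \<and> \<alpha> \<in> {-1, 1/2}"
proof -
  define v where "v t = root b (y t)" for t
  define v' where "v' t = C * (1 - y t powr \<alpha>) * inverse (real b * v t ^ (b - 1))" for t
  have IJ: "interior J \<subseteq> interior (sol_domain \<alpha>)" using J(2) by (rule interior_mono)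
  have dom: "t \<in> sol_domain \<alpha>" "t \<noteq> 0" if "t \<in> interior J" for t
    using that IJ interior_subset[of "sol_domain \<alpha>"] by (auto simp: interior_sol_domain split: if_splits)
  have y01: "0 \<le> y t" "y t < 1" if "t \<in> sol_domain \<alpha>" for t
    using y that unfolding ivp_solution_def by auto
  have y0: "0 < y t" if "t \<in> interior J" for t
  proof -
    \<comment> \<open>\<open>y t = 0\<close> would make the integral, and with it
      \<open>C * t\<close>, equal to 0.\<close>
    have "sep_integral \<alpha> (y t) = C * t" using y dom(1)[OF that] unfolding ivp_solution_def by auto
    then have "y t \<noteq> 0" using dom(2)[OF that] C by (auto simp: sep_integral_def)
    then show ?thesis using y01(1)[OF dom(1)[OF that]] by simp
  qed
  have dy: "(y has_real_derivative C * (1 - y t powr \<alpha>)) (at t)" if "t \<in> interior J" for t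
  proof -
    have "(y has_real_derivative C * (1 - y t powr \<alpha>)) (at t within sol_domain \<alpha>)"
      using y dom[OF that] unfolding ivp_solution_def by auto
    moreover have "at t within sol_domain \<alpha> = at t" using that IJ by (intro at_within_interior) auto
    ultimately show ?thesis by simp
  qed
  have v0: "0 < v t" if "t \<in> interior J" for t using y0[OF that] ab(2) by (simp add: v_def)
  have v01: "0 < v t \<and> v t < 1" if "t \<in> interior J" for t
    using v0[OF that] y01(2)[OF dom(1)[OF that]] ab(2) by (simp add: v_def)
  have dv: "(v has_real_derivative v' t) (at t)" if "t \<in> interior J" for t
    using DERIV_chain2[OF DERIV_real_root[of b "y t"] dy[OF that]] y0[OF that] ab(2)
    by (simp add: v_def[abs_def] v'_def mult.commute)
  have vb: "v t ^ b = y t" if "t \<in> sol_domain \<alpha>" for t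
    using y01[OF that] ab(2) by (simp add: v_def)
  have va: "y t powr (real a / real b) = v t ^ a" if "t \<in> interior J" for t
    using y0[OF that] v0[OF that] ab
    by (simp add: v_def root_powr_inverse powr_powr flip: powr_realpow)
  have vv: "v t ^ (b - 1) * v' t = C / b * (1 - y t powr \<alpha>)" if "t \<in> interior J" for t
    using v0[OF that] ab(2) by (simp add: v'_def field_simps)
  \<comment> \<open>\<open>v\<close> is a continuous branch of a root of \<open>X^b - y\<close>,
    whose coefficients are listed by index.\<close>
  have cfv: "closed_form w J (\<lambda>t. complex_of_real (v t))"
  proof (rule closed_form.algebraic[of b _ _ "\<lambda>i t. if i = 0 then (- 1) * complex_of_real (y t) else if i = b then 1 else 0"])
    show "closed_form w J (\<lambda>t. if i = 0 then (- 1) * complex_of_real (y t) else if i = b then 1 else 0)" for i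
      using closed_form.mult[OF closed_form.const[of w J "-1"] cf] closed_form.const[of w J 0]
        closed_form.const[of w J 1] by (cases "i = 0"; cases "i = b") simp_all
    show "\<forall>t\<in>J. \<exists>i\<le>b. (if i = 0 then (- 1) * complex_of_real (y t) else if i = b then 1 else 0) \<noteq> 0"
      using ab(2) by (intro ballI exI[of _ b]) auto
    have "continuous_on J (\<lambda>t. Re (complex_of_real (y t)))"
      using closed_form_continuous[OF cf] by (rule continuous_on_Re)
    then show "continuous_on J (\<lambda>t. complex_of_real (v t))"
      unfolding v_def by (auto intro!: continuous_intros)
    show "\<forall>t\<in>J. (\<Sum>i\<le>b. (if i = 0 then (- 1) * complex_of_real (y t) else if i = b then 1 else 0) *
        complex_of_real (v t) ^ i) = 0"
    proof
      fix t assume t: "t \<in> J"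
      obtain b' where b': "b = Suc b'" using ab(2) by (cases b) auto
      have "(\<Sum>i\<le>b. (if i = 0 then (- 1) * complex_of_real (y t) else if i = b then 1 else 0) *
        complex_of_real (v t) ^ i) = - complex_of_real (y t) + complex_of_real (v t ^ b)"
        unfolding b' sum.atMost_Suc_shift by (simp add: mult_delta_left)
      then show "(\<Sum>i\<le>b. (if i = 0 then (- 1) * complex_of_real (y t) else if i = b then 1 else 0) *
        complex_of_real (v t) ^ i) = 0" using vb[of t] t J(2) by (simp add: subset_iff flip: of_real_power)
    qed
  qed
  have b0: "real b > 0" using ab(2) by simp
  from \<alpha> show ?thesis
  proof
    assume \<alpha>: "\<alpha> = real a / real b"
    have "v t ^ (b - 1) * v' t = - (C / b) * (v t ^ a - 1)" if "t \<in> interior J" for t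
      using vv[OF that] va[OF that] by (simp add: \<alpha> algebra_simps)
    then have *: "(a = 1 \<or> a = 2) \<and> (b - 1 < a \<or> w \<and> a = 1 \<and> b - 1 = 1)"
      using C ab b0 by (intro closed_form_power_ode[OF cfv J(1) dv _ v01, of _ "- (C / b)"])
        (auto simp: coprime_commute)
    then consider "a = 1" "b = 1" | "a = 2" "b = 1 \<or> b = 2" | "a = 1" "b = 2" w using ab(2) by linarith
    then show ?thesis using \<alpha> ab(3) by cases auto
  next
    assume \<alpha>: "\<alpha> = - (real a / real b)"
    have "v t ^ (b - 1 + a) * v' t = C / b * (v t ^ a - 1)" if "t \<in> interior J" for t
    proof -
      have "v t ^ (b - 1 + a) * v' t = (v t ^ (b - 1) * v' t) * v t ^ a" by (simp add: power_add)
      also have "\<dots> = C / b * (1 - inverse (v t ^ a)) * v t ^ a"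
        unfolding vv[OF that] by (simp add: \<alpha> powr_minus va[OF that])
      also have "\<dots> = C / b * ((1 - inverse (v t ^ a)) * v t ^ a)" by (rule mult.assoc)
      also have "(1 - inverse (v t ^ a)) * v t ^ a = v t ^ a - 1"
        using v0[OF that] by (simp add: left_diff_distrib)
      finally show ?thesis .
    qed
    moreover have "coprime (b - 1 + a + 1) a"
    proof -
      have "b - 1 + a + 1 = b + a" using ab(2) by simp
      moreover have "gcd (b + a) a = gcd b a" by (rule gcd_add1)
      ultimately show ?thesis
        using ab(3) by (metis coprime_iff_gcd_eq_1 gcd.commute)
    qed
    \<comment> \<open>\<open>b - 1 + a < a\<close> is impossible for \<open>b \<ge> 1\<close>, so
      only the Lambert alternative with \<open>a = b = 1\<close> is left.\<close>
    ultimately have "(a = 1 \<or> a = 2) \<and> (b - 1 + a < a \<or> w \<and> a = 1 \<and> b - 1 + a = 1)"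
      using C ab(1) b0 by (intro closed_form_power_ode[OF cfv J(1) dv _ v01, of _ "C / b"]) auto
    then show ?thesis using \<alpha> ab(2) by auto
  qed
qed

section \<open>The separation integral for the four exceptional exponents\<close>

lemma sep_integral_eq:
  assumes y: "0 \<le> y" "y < 1" and F: "F 0 = 0" "continuous_on {0..y} F"
    and d: "\<And>s. 0 < s \<Longrightarrow> s < 1 \<Longrightarrow> (F has_real_derivative 1 / (1 - s powr \<alpha>)) (at s)"
  shows "sep_integral \<alpha> y = F y"
proof -
  \<comment> \<open>The fundamental theorem with derivatives in the interior only: it tolerates the
    value of the integrand at 0 and the non-differentiability of \<open>sqrt\<close> there.\<close>
  have "((\<lambda>s. 1 / (1 - s powr \<alpha>)) has_integral F y - F 0) {0..y}"
    using y F d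
    by (intro fundamental_theorem_of_calculus_interior)
      (auto simp: has_real_derivative_iff_has_vector_derivative[symmetric])
  then show ?thesis unfolding sep_integral_def using F by (simp add: integral_unique)
qed

lemma sep_integral_1: assumes "0 \<le> y" "y < 1" shows "sep_integral 1 y = - ln (1 - y)"
proof (rule sep_integral_eq[OF assms])
  show "continuous_on {0..y} (\<lambda>y. - ln (1 - y))" using assms by (auto intro!: continuous_intros)
  show "((\<lambda>y. - ln (1 - y)) has_real_derivative 1 / (1 - s powr 1)) (at s)" if "0 < s" "s < 1" for s :: real
    using that by (auto intro!: derivative_eq_intros simp: field_simps)
qed simp

lemma sep_integral_2: assumes "0 \<le> y" "y < 1" shows "sep_integral 2 y = (ln (1 + y) - ln (1 - y)) / 2"
proof (rule sep_integral_eq[OF assms])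
  show "continuous_on {0..y} (\<lambda>y. (ln (1 + y) - ln (1 - y)) / 2)"
    using assms by (auto intro!: continuous_intros)
  show "((\<lambda>y. (ln (1 + y) - ln (1 - y)) / 2) has_real_derivative 1 / (1 - s powr 2)) (at s)"
    if "0 < s" "s < 1" for s :: real
  proof -
    have eq: "1 / (1 - s powr 2) = (1 / (1 + s) + 1 / (1 - s)) / 2"
    proof -
      have "1 - s powr 2 = (1 + s) * (1 - s)" using that by (simp add: power2_eq_square algebra_simps)
      moreover have "1 / (1 + s) + 1 / (1 - s) = 2 / ((1 + s) * (1 - s))"
        using that by (simp add: add_frac_eq)
      ultimately show ?thesis by simp
    qed
    show ?thesis unfolding eq using that by (auto intro!: derivative_eq_intros)
  qed
qed simp

lemma sep_integral_minus_1: assumes "0 \<le> y" "y < 1" shows "sep_integral (-1) y = y + ln (1 - y)"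
proof (rule sep_integral_eq[OF assms])
  show "continuous_on {0..y} (\<lambda>y. y + ln (1 - y))" using assms by (auto intro!: continuous_intros)
  show "((\<lambda>y. y + ln (1 - y)) has_real_derivative 1 / (1 - s powr - 1)) (at s)" if "0 < s" "s < 1" for s :: real
  proof -
    have eq: "1 / (1 - s powr - 1) = 1 - 1 / (1 - s)"
      using that by (simp add: powr_minus divide_simps) (simp add: algebra_simps)
    show ?thesis unfolding eq using that by (auto intro!: derivative_eq_intros)
  qed
qed simp

lemma sep_integral_half:
  assumes "0 \<le> y" "y < 1" shows "sep_integral (1/2) y = - 2 * sqrt y - 2 * ln (1 - sqrt y)"
proof (rule sep_integral_eq[OF assms])
  show "continuous_on {0..y} (\<lambda>y. - 2 * sqrt y - 2 * ln (1 - sqrt y))"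
    using assms by (auto intro!: continuous_intros)
  show "((\<lambda>y. - 2 * sqrt y - 2 * ln (1 - sqrt y)) has_real_derivative 1 / (1 - s powr (1/2))) (at s)"
    if s: "0 < s" "s < 1" for s :: real
  proof -
    have q: "0 < sqrt s" "sqrt s < 1" using s by auto
    have "((\<lambda>y. - 2 * sqrt y - 2 * ln (1 - sqrt y)) has_real_derivative
      - 2 * (inverse (sqrt s) / 2) - 2 * (- (inverse (sqrt s) / 2) / (1 - sqrt s))) (at s)"
      using s q by (auto intro!: derivative_eq_intros simp: mult.commute)
    also have "- 2 * (inverse (sqrt s) / 2) - 2 * (- (inverse (sqrt s) / 2) / (1 - sqrt s)) = 1 / (1 - s powr (1/2))"
      using q s by (simp add: powr_half_sqrt field_simps)
    finally show ?thesis .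
  qed
qed simp

section \<open>The principal branch of the Lambert function\<close>

lemma mult_exp_strict_mono:
  fixes x y :: real
  assumes "-1 \<le> x" "x < y" shows "x * exp x < y * exp y"
proof (rule DERIV_pos_imp_increasing_open[OF assms(2)])
  fix s assume "x < s" "s < y"
  then have "0 < (1 + s) * exp s" using assms by simp
  moreover have "((\<lambda>w. w * exp w) has_real_derivative (1 + s) * exp s) (at s)"
    by (auto intro!: derivative_eq_intros simp: algebra_simps)
  ultimately show "\<exists>z. ((\<lambda>w. w * exp w) has_real_derivative z) (at s) \<and> 0 < z" by blast
qed (auto intro!: continuous_intros)

lemma lambert_W0_eq:
  assumes "-1 \<le> x" shows "lambert_W0 (x * exp x) = x"
proof -
  have "inj_on (\<lambda>w::real. w * exp w) {-1..}"
    by (rule linorder_inj_onI) (use mult_exp_strict_mono in fastforce)+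
  then show ?thesis unfolding lambert_W0_def using assms by (intro inv_into_f_f) auto
qed

section \<open>The exceptional solutions on their domain\<close>

context
  fixes C \<alpha> :: real and y :: "real \<Rightarrow> real"
  assumes C: "C > 0" and y: "ivp_solution C \<alpha> y"
begin

lemma solution_range: "t \<in> sol_domain \<alpha> \<Longrightarrow> 0 \<le> y t" "t \<in> sol_domain \<alpha> \<Longrightarrow> y t < 1"
  and solution_integral: "t \<in> sol_domain \<alpha> \<Longrightarrow> sep_integral \<alpha> (y t) = C * t"
  using y by (auto simp: ivp_solution_def)

lemma solution_1: assumes "\<alpha> = 1" "t \<in> sol_domain \<alpha>" shows "y t = 1 - exp (- C * t)"
proof -
  have "- ln (1 - y t) = C * t"
    using sep_integral_1 solution_range[OF assms(2)] solution_integral[OF assms(2)] assms(1) by simp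
  then have "exp (- C * t) = exp (ln (1 - y t))" by (simp flip: \<open>- ln (1 - y t) = C * t\<close>)
  then show ?thesis using solution_range[OF assms(2)] by simp
qed

text \<open>This is \<open>y = tanh (C t)\<close>, kept as a linear equation for \<open>y\<close>
  because \<open>closed_form_linear\<close> takes it in that form.\<close>

lemma solution_2: assumes "\<alpha> = 2" "t \<in> sol_domain \<alpha>" shows "(exp (2 * C * t) + 1) * y t + (1 - exp (2 * C * t)) = 0"
proof -
  note r = solution_range[OF assms(2)]
  have "ln (1 + y t) - ln (1 - y t) = 2 * C * t"
    using sep_integral_2[OF r] solution_integral[OF assms(2)] assms(1) by simp
  then have "exp (2 * C * t) = exp (ln (1 + y t)) / exp (ln (1 - y t))"
    by (simp flip: exp_diff)
  then have "exp (2 * C * t) = (1 + y t) / (1 - y t)" using r by simp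
  then show ?thesis using r by (simp add: field_simps)
qed

lemma solution_minus_1_exp:
  assumes "\<alpha> = -1" "t \<in> sol_domain \<alpha>"
  shows "exp (C * t) = exp (y t) * (1 - y t)"
proof -
  note r = solution_range[OF assms(2)]
  have "y t + ln (1 - y t) = C * t"
    using sep_integral_minus_1[OF r] solution_integral[OF assms(2)] assms(1) by simp
  then show ?thesis using r by (simp add: exp_add flip: \<open>_ = C * t\<close>)
qed

lemma solution_minus_1:
  assumes "\<alpha> = -1" "t \<in> sol_domain \<alpha>"
  shows "(y t - 1) * exp (y t - 1) = - (1 / exp 1) * exp (C * t)"
  unfolding solution_minus_1_exp[OF assms] exp_diff by (simp add: divide_simps) (simp add: algebra_simps)

lemma solution_half:
  assumes "\<alpha> = 1/2" "t \<in> sol_domain \<alpha>"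
  shows "(sqrt (y t) - 1) * exp (sqrt (y t) - 1) = - (1 / exp 1) * exp (- (1/2) * C * t)"
proof -
  note r = solution_range[OF assms(2)]
  have "- 2 * sqrt (y t) - 2 * ln (1 - sqrt (y t)) = C * t"
    using sep_integral_half[OF r] solution_integral[OF assms(2)] assms(1) by simp
  then have "- (1/2) * C * t = sqrt (y t) + ln (1 - sqrt (y t))" by simp
  then have "exp (- (1/2) * C * t) = exp (sqrt (y t)) * (1 - sqrt (y t))" using r by (simp only: exp_add) simp
  then show ?thesis unfolding exp_diff by (simp add: divide_simps) (simp add: algebra_simps)
qed

lemma solution_continuous_pos: assumes "\<alpha> > 0" shows "continuous_on (sol_domain \<alpha>) y"
  using y assms unfolding ivp_solution_def
  by (intro DERIV_continuous_on[of _ _ "\<lambda>t. C * (1 - y t powr \<alpha>)"]) auto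

text \<open>At \<open>t = 0\<close> the differential equation gives nothing, but \<open>(1 - y) exp y \<le> 1 - y\<^sup>3\<close> forces
  \<open>y\<close> to tend to \<open>0\<close>.\<close>

lemma solution_continuous_minus_1: assumes "\<alpha> = -1" shows "continuous_on (sol_domain \<alpha>) y"
proof -
  have dom: "sol_domain \<alpha> = {..0}" using assms by (simp add: sol_domain_def)
  have y0: "y 0 = 0" using y by (simp add: ivp_solution_def)
  have bound: "y t \<le> root 3 (- C * t)" if t: "t \<in> sol_domain \<alpha>" for t
  proof -
    note r = solution_range[OF t]
    have "exp (C * t) = (1 - y t) * exp (y t)"
      using solution_minus_1_exp[OF assms t] by (simp add: mult.commute)
    also have "\<dots> \<le> (1 - y t) * (1 + y t + (y t)\<^sup>2)" using r by (intro mult_left_mono exp_bound) auto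
    also have "\<dots> = 1 - y t ^ 3" by (simp add: algebra_simps power2_eq_square power3_eq_cube)
    finally have "exp (C * t) \<le> 1 - y t ^ 3" .
    \<comment> \<open>With the upper bound \<open>1 - y^3\<close> for the exponential this gives
      \<open>y^3 \<le> - C t\<close>, which squeezes \<open>y\<close> to 0 at
      \<open>t = 0\<close>.\<close>
    moreover have "1 + C * t \<le> exp (C * t)" by simp
    ultimately have "y t ^ 3 \<le> - (C * t)" by linarith
    then have "y t ^ 3 \<le> - C * t" by simp
    then have "root 3 (y t ^ 3) \<le> root 3 (- C * t)" by (simp only: real_root_le_iff zero_less_numeral)
    then show ?thesis using r by (simp add: real_root_power_cancel)
  qed
  show ?thesis unfolding continuous_on_eq_continuous_within
  proof
    fix t assume t: "t \<in> sol_domain \<alpha>"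
    show "continuous (at t within sol_domain \<alpha>) y"
    proof (cases "t = 0")
      case True
      have "((\<lambda>t. root 3 (- C * t)) \<longlongrightarrow> root 3 (- C * 0)) (at 0 within sol_domain \<alpha>)"
        by (intro tendsto_intros)
      then have lim: "((\<lambda>t. root 3 (- C * t)) \<longlongrightarrow> 0) (at 0 within sol_domain \<alpha>)" by simp
      have "(y \<longlongrightarrow> 0) (at 0 within sol_domain \<alpha>)"
        by (rule tendsto_sandwich[OF _ _ tendsto_const lim])
          (use bound solution_range in \<open>auto simp: eventually_at_filter intro!: always_eventually\<close>)
      then show ?thesis using True y0 by (simp add: continuous_within)
    next
      case False
      then have "(y has_real_derivative C * (1 - y t powr \<alpha>)) (at t within sol_domain \<alpha>)"
        using y t unfolding ivp_solution_def by blast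
      then show ?thesis by (rule DERIV_continuous)
    qed
  qed
qed

end

text \<open>Besides division this permits a change of function outside \<open>J\<close>: the
  algebraic rule constrains \<open>f\<close> on \<open>J\<close> only, whereas sums and products fix
  the function on the whole line.\<close>

lemma closed_form_linear:
  assumes "closed_form w J a" "closed_form w J b" "\<And>t. t \<in> J \<Longrightarrow> a t \<noteq> 0" "continuous_on J f"
    "\<And>t. t \<in> J \<Longrightarrow> a t * f t + b t = 0"
  shows "closed_form w J f"
proof (rule closed_form.algebraic[of 1 _ _ "\<lambda>i. if i = 0 then b else a"])
  show "\<forall>t\<in>J. \<exists>i\<le>1::nat. (if i = 0 then b else a) t \<noteq> 0" using assms(3) by (intro ballI exI[of _ 1]) auto
  show "\<forall>t\<in>J. (\<Sum>i\<le>1::nat. (if i = 0 then b else a) t * f t ^ i) = 0"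
    using assms(5) by (simp add: add.commute)
qed (use assms in auto)

lemma closed_form_exp_linear: "closed_form w J (\<lambda>t. complex_of_real (a * exp (b * t)))"
  using closed_form.mult[OF closed_form.const[of w J "of_real a"]
      closed_form.exp[OF closed_form.mult[OF closed_form.const[of w J "of_real b"] closed_form.var]]]
  by (simp flip: exp_of_real)

lemma solution_elementary:
  assumes C: "C > 0" and y: "ivp_solution C \<alpha> y" and J: "J \<subseteq> sol_domain \<alpha>" and \<alpha>: "\<alpha> = 1 \<or> \<alpha> = 2"
  shows "closed_form w J (\<lambda>t. complex_of_real (y t))"
proof -
  have cont: "continuous_on J (\<lambda>t. complex_of_real (y t))"
    using continuous_on_subset[OF solution_continuous_pos[OF C y] J] \<alpha> by (auto intro: continuous_on_of_real)
  note one = closed_form.const[of w J 1]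
  from \<alpha> show ?thesis
  proof
    assume \<alpha>: "\<alpha> = 1"
    show ?thesis
    proof (rule closed_form_linear[OF one closed_form.add[OF closed_form.const[of w J "-1"] closed_form_exp_linear[of w J 1 "-C"]] _ cont])
      show "1 * complex_of_real (y t) + (- 1 + complex_of_real (1 * exp (- C * t))) = 0" if "t \<in> J" for t
        using solution_1[OF C y \<alpha>, of t] J that by auto
    qed simp
  next
    assume \<alpha>: "\<alpha> = 2"
    show ?thesis
    proof (rule closed_form_linear[OF closed_form.add[OF closed_form_exp_linear[of w J 1 "2 * C"] one]
          closed_form.add[OF one closed_form_exp_linear[of w J "-1" "2 * C"]] _ cont])
      fix t assume "t \<in> J"
      then have "(exp (2 * C * t) + 1) * y t + (1 - exp (2 * C * t)) = 0"
        using solution_2[OF C y \<alpha>] J by blast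
      then have "complex_of_real ((1 * exp (2 * C * t) + 1) * y t + (1 + - 1 * exp (2 * C * t))) = 0" by simp
      then show "(complex_of_real (1 * exp (2 * C * t)) + 1) * complex_of_real (y t) +
        (1 + complex_of_real (- 1 * exp (2 * C * t))) = 0" by simp
      have "(1 * exp (2 * C * t) + 1 :: real) \<noteq> 0" by (metis add_pos_pos exp_gt_zero less_irrefl mult_1 zero_less_one)
      then show "complex_of_real (1 * exp (2 * C * t)) + 1 \<noteq> 0" by (metis of_real_1 of_real_add of_real_eq_0_iff)
    qed
  qed
qed

lemma solution_lambert:
  assumes C: "C > 0" and y: "ivp_solution C \<alpha> y" and J: "J \<subseteq> sol_domain \<alpha>" and \<alpha>: "\<alpha> = -1 \<or> \<alpha> = 1/2"
  shows "closed_form True J (\<lambda>t. complex_of_real (y t))"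
  using \<alpha>
proof
  assume \<alpha>: "\<alpha> = -1"
  let ?f = "\<lambda>t. complex_of_real (y t - 1)"
  have "closed_form True J ?f"
  proof (rule closed_form.lambert[OF TrueI closed_form_exp_linear[of True J "- (1 / exp 1)" C]])
    show "continuous_on J ?f"
      using continuous_on_subset[OF solution_continuous_minus_1[OF C y \<alpha>] J] by (intro continuous_intros)
    show "\<forall>t\<in>J. ?f t * exp (?f t) = complex_of_real (- (1 / exp 1) * exp (C * t))"
    proof
      fix t assume "t \<in> J"
      then show "?f t * exp (?f t) = complex_of_real (- (1 / exp 1) * exp (C * t))"
        using solution_minus_1[OF C y \<alpha>, of t] J by (simp only: exp_of_real of_real_mult[symmetric] subset_iff)
    qed
  qed
  from closed_form.add[OF closed_form.const[of True J 1] this] show ?thesis by simp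
next
  assume \<alpha>: "\<alpha> = 1/2"
  let ?f = "\<lambda>t. complex_of_real (sqrt (y t) - 1)"
  have cy: "continuous_on J y" using continuous_on_subset[OF solution_continuous_pos[OF C y] J] \<alpha> by simp
  have "closed_form True J ?f"
  proof (rule closed_form.lambert[OF TrueI closed_form_exp_linear[of True J "- (1 / exp 1)" "- (1/2) * C"]])
    show "continuous_on J ?f" using cy by (intro continuous_intros)
    show "\<forall>t\<in>J. ?f t * exp (?f t) = complex_of_real (- (1 / exp 1) * exp (- (1/2) * C * t))"
    proof
      fix t assume "t \<in> J"
      then show "?f t * exp (?f t) = complex_of_real (- (1 / exp 1) * exp (- (1/2) * C * t))"
        using solution_half[OF C y \<alpha>, of t] J by (simp only: exp_of_real of_real_mult[symmetric] subset_iff)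
    qed
  qed
  from closed_form.add[OF closed_form.const[of True J 1] this]
  have s: "closed_form True J (\<lambda>t. complex_of_real (sqrt (y t)))" by simp
  \<comment> \<open>\<open>y = sqrt y * sqrt y\<close> is known on \<open>J\<close> only, so the
    product is transferred to \<open>y\<close> by a linear equation.\<close>
  show ?thesis
  proof (rule closed_form_linear[OF closed_form.const[of True J 1] closed_form.mult[OF closed_form.const[of True J "-1"] closed_form.mult[OF s s]]])
    show "continuous_on J (\<lambda>t. complex_of_real (y t))" using cy by (intro continuous_intros)
    show "1 * complex_of_real (y t) + - 1 * (complex_of_real (sqrt (y t)) * complex_of_real (sqrt (y t))) = 0"
      if "t \<in> J" for t
    proof -
      have "sqrt (y t) * sqrt (y t) = y t" using solution_range(1)[OF C y, of t] J that by auto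
      then show ?thesis by (simp flip: of_real_mult)
    qed
  qed simp
qed

theorem theorem8:
  fixes C \<alpha> :: real and A B :: int and y :: "real \<Rightarrow> real" and J :: "real set"
  assumes "C > 0"
    and "A \<noteq> 0" and "B \<noteq> 0" and "coprime A B" and "\<alpha> = of_int A / of_int B"
    and "ivp_solution C \<alpha> y"
    and "is_interval J" and "interior J \<noteq> {}" and "J \<subseteq> sol_domain \<alpha>"
  shows "(elementary_lambert_on J y \<longleftrightarrow> \<alpha> \<in> {-1, 1/2, 1, 2}) \<and>
    (elementary_lambert_on J y \<and> \<not> elementary_on J y \<longleftrightarrow> \<alpha> \<in> {-1, 1/2}) \<and>
    (\<alpha> = -1 \<longrightarrow> (\<forall>t\<in>sol_domain \<alpha>. y t = 1 + lambert_W0 (- (1 / exp 1) * exp (C * t)))) \<and>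
    (\<alpha> = 1/2 \<longrightarrow>
       (\<forall>t\<in>sol_domain \<alpha>. y t = (1 + lambert_W0 (- (1 / exp 1) * exp (- (1/2) * C * t)))\<^sup>2))"
proof -
  note C = assms(1) and y = assms(6) and J = assms(8,9)
  define a b where "a = nat \<bar>A\<bar>" "b = nat \<bar>B\<bar>"
  have ab: "a \<ge> 1" "b \<ge> 1" using assms(2,3) by (auto simp: a_b_def)
  have cop: "coprime a b" using assms(4) by (simp add: a_b_def coprime_int_iff[symmetric])
  have \<alpha>: "\<alpha> = real a / real b \<or> \<alpha> = - (real a / real b)"
    unfolding assms(5) a_b_def by (cases "A \<ge> 0"; cases "B \<ge> 0") auto
  note imp = solution_closed_form_imp[OF C y J ab cop \<alpha>]
  have *: "elementary_lambert_on J y \<longleftrightarrow> \<alpha> \<in> {-1, 1/2, 1, 2}"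
    using imp[of True] solution_elementary[OF C y J(2), of True] solution_lambert[OF C y J(2)]
    unfolding elementary_lambert_on_def by blast
  have **: "elementary_on J y \<longleftrightarrow> \<alpha> \<in> {1, 2}"
    using imp[of False] solution_elementary[OF C y J(2), of False]
    unfolding elementary_on_def by blast
  \<comment> \<open>\<open>y t \<ge> 0\<close> places \<open>y t - 1\<close> in
    \<open>[-1, \<infinity>)\<close>, where \<open>lambert_W0\<close> inverts
    \<open>w * exp w\<close>; this selects the principal branch.\<close>
  have "y t = 1 + lambert_W0 (- (1 / exp 1) * exp (C * t))" if "\<alpha> = -1" "t \<in> sol_domain \<alpha>" for t
    using lambert_W0_eq[of "y t - 1"] solution_range(1)[OF C y that(2)]
    unfolding solution_minus_1[OF C y that] by simp
  moreover have "y t = (1 + lambert_W0 (- (1 / exp 1) * exp (- (1/2) * C * t)))\<^sup>2"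
    if "\<alpha> = 1/2" "t \<in> sol_domain \<alpha>" for t
  proof -
    have "0 \<le> y t" using solution_range(1)[OF C y that(2)] .
    then show ?thesis
      using lambert_W0_eq[of "sqrt (y t) - 1"] unfolding solution_half[OF C y that] by simp
  qed
  ultimately show ?thesis using * ** by auto
qed

end
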